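(* Let $d\in\mathbb N$, $\mathbf N=(N_1,\dots,N_d)\in\mathbb N^d$, $\widetilde N=\min_{1\le j\le d}N_j$, and let $f\in B^q_{\boldsymbol\pi,d}$ with $q\ge 1+\big(\pi^2(\widetilde N+1/2)^2-2\big)^{-1}$. For $\mathbf x\in\mathbb R^d$ let $\mathfrak J_{\mathbf x}=\{\mathbf n\in\mathbb Z^d:\ |x_j-n_j|\le N_j\text{ for all }j=1,\dots,d\}$ and \[T_{\mathbf N,d}(f;\mathbf x)=f(\mathbf x)-\sum_{\mathbf n\in\mathfrak J_{\mathbf x}}f(\mathbf n)\prod_{j=1}^d\mathrm{sinc}(x_j-n_j).\] Then \[\|T_{\mathbf N,d}(f;\cdot)\|_\infty\le C(\mathbf N,d,q)\,\|f\|_q,\] where \[C(\mathbf N,d,q)=\frac{2^{2-\frac1q}}{\pi}\,\mathfrak C_{\frac{q}{q-1}}^{(d-1)(1-\frac1q)}\,\mathfrak B_{d,q}^{1/q}\Big(\sum_{j=1}^d\lambda\Big(\frac{q}{q-1};N_j\Big)\Big)^{1-\frac1q},\] with $\mathfrak B_{d,q}=\Big(\frac{8(e^{q\pi/2}-1)}{q\pi^2}\Big)^d$ and, for $p>1$, $\mathfrak C_p=1+\big(\frac2\pi\big)^p\frac{p}{p-1}$ if $1<p<2$ and $\mathfrak C_p=1$ if $p\ge2$.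
   Context: $\boldsymbol\pi=(\pi,\dots,\pi)\in\mathbb R^d$. $B^q_{\boldsymbol\pi,d}$ is the Bernstein class of entire functions of $d$ complex variables of exponential type at most $\pi$ in each variable whose restriction to $\mathbb R^d$ belongs to $L^q(\mathbb R^d)$; $\|f\|_q$ is the $L^q(\mathbb R^d)$-norm and $\|\cdot\|_\infty$ the essential supremum over $\mathbf x\in\mathbb R^d$. $\mathrm{sinc}(x)=\frac{\sin(\pi x)}{\pi x}$ for $x\ne0$, $\mathrm{sinc}(0)=1$. The incomplete Lambda function is $\lambda(s;a)=\sum_{n=1}^\infty (2(n+a)-1)^{-s}$ for $s>1$, $a\ge0$. *)

theory Defs
  imports "HOL-Analysis.Analysis" "HOL-Probability.Essential_Supremum"
begin

definition sinc :: "real \<Rightarrow> real" where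
  "sinc x = (if x = 0 then 1 else sin (pi * x) / (pi * x))"

definition incomplete_lambda :: "real \<Rightarrow> real \<Rightarrow> real" where
  "incomplete_lambda s a = (\<Sum>n. (2 * (real (Suc n) + a) - 1) powr (- s))"

text \<open>Entire function of several complex variables: continuous and holomorphic
  in each variable separately (equivalent to joint holomorphy by Osgood's lemma).\<close>
definition entire_multi :: "(complex ^ 'n \<Rightarrow> complex) \<Rightarrow> bool" where
  "entire_multi f \<longleftrightarrow> continuous_on UNIV f \<and>
     (\<forall>z j. (\<lambda>w. f (\<chi> k. if k = j then w else z $ k)) holomorphic_on UNIV)"

definition exp_type_le :: "real \<Rightarrow> (complex ^ 'n \<Rightarrow> complex) \<Rightarrow> bool" where
  "exp_type_le \<sigma> f \<longleftrightarrow> (\<forall>\<epsilon>>0. \<exists>A. \<forall>z.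
     norm (f z) \<le> A * exp (\<Sum>j\<in>UNIV. (\<sigma> + \<epsilon>) * norm (z $ j)))"

definition real_restr :: "(complex ^ 'n \<Rightarrow> complex) \<Rightarrow> real ^ 'n \<Rightarrow> complex" where
  "real_restr f x = f (\<chi> j. complex_of_real (x $ j))"

definition Lq_integral :: "real \<Rightarrow> (real ^ 'n \<Rightarrow> complex) \<Rightarrow> ennreal" where
  "Lq_integral q g = (\<integral>\<^sup>+ x. ennreal (norm (g x) powr q) \<partial>lborel)"

definition Lq_norm :: "real \<Rightarrow> (real ^ 'n \<Rightarrow> complex) \<Rightarrow> real" where
  "Lq_norm q g = enn2real (Lq_integral q g) powr (1 / q)"

definition bernstein_class :: "real \<Rightarrow> (complex ^ 'n \<Rightarrow> complex) \<Rightarrow> bool" where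
  "bernstein_class q f \<longleftrightarrow> entire_multi f \<and> exp_type_le pi f \<and>
     real_restr f \<in> borel_measurable lborel \<and> Lq_integral q (real_restr f) < \<infinity>"

definition index_set :: "nat ^ 'n \<Rightarrow> real ^ 'n \<Rightarrow> (int ^ 'n) set" where
  "index_set N x = {n. \<forall>j. \<bar>x $ j - real_of_int (n $ j)\<bar> \<le> real (N $ j)}"

definition trunc_error :: "nat ^ 'n \<Rightarrow> (complex ^ 'n \<Rightarrow> complex) \<Rightarrow> real ^ 'n \<Rightarrow> complex" where
  "trunc_error N f x = f (\<chi> j. complex_of_real (x $ j)) -
     (\<Sum>n\<in>index_set N x. f (\<chi> j. of_int (n $ j)) *
        complex_of_real (\<Prod>j\<in>UNIV. sinc (x $ j - real_of_int (n $ j))))"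

definition frakC :: "real \<Rightarrow> real" where
  "frakC p = (if p < 2 then 1 + (2 / pi) powr p * (p / (p - 1)) else 1)"

definition frakB :: "nat \<Rightarrow> real \<Rightarrow> real" where
  "frakB d q = (8 * (exp (q * pi / 2) - 1) / (q * pi\<^sup>2)) ^ d"

definition const_C :: "nat ^ 'n \<Rightarrow> real \<Rightarrow> real" where
  "const_C N q = 2 powr (2 - 1 / q) / pi
     * frakC (q / (q - 1)) powr ((real CARD('n) - 1) * (1 - 1 / q))
     * frakB CARD('n) q powr (1 / q)
     * (\<Sum>j\<in>UNIV. incomplete_lambda (q / (q - 1)) (real (N $ j))) powr (1 - 1 / q)"

end

theory Submission
  imports Defs "HOL-Complex_Analysis.Residue_Theorem" "HOL-Real_Asymp.Real_Asymp"
begin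

text \<open>By the cardinal series \<open>f(x) = \<Sum>\<^sub>n f(n) \<Prod>\<^sub>j sinc (x\<^sub>j - n\<^sub>j)\<close>, the truncation error is the part
  of the series over the lattice points outside the box around \<open>x\<close>. Hoelder's inequality with
  \<open>p = q / (q - 1)\<close> separates the samples from the kernel.

  The samples are controlled by the Plancherel-Polya inequality. Bounding \<open>\<bar>f(n)\<bar>\<^sup>q\<close> by its mean over a
  disc of radius \<open>1/2\<close> in each variable reduces it to
  \<open>\<integral> \<bar>f(x + iy)\<bar>\<^sup>q dx \<le> exp (q \<pi> \<bar>y\<bar>) \<integral> \<bar>f(x)\<bar>\<^sup>q dx\<close>. This follows by duality from the Phragmen-Lindelof bound
  for a bounded function, applied to \<open>z \<mapsto> \<integral> f(z + s) \<phi>(s) ds\<close> with \<open>\<phi>\<close> of compact support.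

  For the kernel, a lattice point outside the box has some coordinate with \<open>\<bar>x\<^sub>j - n\<^sub>j\<bar> > N\<^sub>j\<close>. The other
  coordinates contribute at most \<open>\<Sum>\<^sub>n \<bar>sinc (x - n)\<bar>\<^sup>p\<close> each, and the tail in the coordinate \<open>j\<close> is largest
  when \<open>x\<^sub>j\<close> is a half-integer; this is where the lower bound on \<open>q\<close> enters.

  The cardinal series is only needed for functions with summable samples, since dilating \<open>f\<close> and
  multiplying it by squares of \<open>sinc\<close> approximates \<open>f\<close> pointwise without enlarging the bounds.\<close>

section \<open>Phragmen-Lindelof bounds for functions of exponential type\<close>

text \<open>Sums over the lattice are integrals against a product of counting measures on the real
  line. Samples and Lebesgue integrals then become two instances of one product construction, and
  each inequality in several variables follows by treating one coordinate at a time while the others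
  stay frozen at real values. The obstacle is the cardinal series. A function of the class is
  bounded on the real space, but no rate of decay is at hand for the contour argument. The error
  bound is therefore proved for damped functions, and the damping is removed at a fixed point
  \<open>x\<close>, where the truncated sum is finite. The damping must not raise the exponential
  type, which is why \<open>f\<close> is dilated as well. The hypothesis on \<open>q\<close> is a
  bound on the dual exponent in disguise: \<open>p = 1 + 1 / (q - 1)\<close>, so it says
  \<open>p + 1 \<le> pi^2 (m + 1/2)^2\<close> for the least entry \<open>m\<close> of
  \<open>N\<close>. One unit of the \<open>- 2\<close> comes from \<open>p + 1\<close> and the other
  from \<open>p = 1 + 1 / (q - 1)\<close>.\<close>

lemma phragmen_lindelof_halfplane_bounded:
  assumes F: "F holomorphic_on UNIV" and M: "M > 0"
    and K: "\<And>z. Im z \<ge> 0 \<Longrightarrow> norm (F z) \<le> K"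
    and bM: "\<And>x::real. norm (F (of_real x)) \<le> M"
    and z: "Im \<xi> \<ge> 0"
  shows "norm (F \<xi>) \<le> M"
proof (cases "Im \<xi> = 0")
  case True
  then have "\<xi> = of_real (Re \<xi>)" by (simp add: complex_eq_iff)
  then show ?thesis using bM by metis
next
  case False
  then have im: "Im \<xi> > 0" using z by simp
  have low: "norm (1 - \<i> * z) \<ge> 1" "norm (1 - \<i> * z) \<ge> norm z - 1" if "Im z \<ge> 0" for z
  proof -
    have "Re (1 - \<i> * z) \<ge> 1" using that by simp
    then show "norm (1 - \<i> * z) \<ge> 1" using complex_Re_le_cmod order_trans by blast
    have "norm (\<i> * z) - norm (1::complex) \<le> norm (\<i> * z - 1)" by (rule norm_triangle_ineq2)
    then show "norm (1 - \<i> * z) \<ge> norm z - 1" by (simp add: norm_mult norm_minus_commute)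
  qed
  have main: "norm (F \<xi>) ^ n \<le> M ^ n * norm (1 - \<i> * \<xi>)" for n
  proof -
    \<comment> \<open>The divisor has modulus at least 1 in the upper half-plane and grows at
      infinity, so it makes the bounded function \<open>F ^ n\<close> small on a large arc. Passing
      to the n-th power makes its cost harmless: at \<open>\<xi>\<close> it is a single factor that
      does not depend on \<open>n\<close>.\<close>
    define G where "G = (\<lambda>z. F z ^ n / (1 - \<i> * z))"
    define R where "R = max (norm \<xi> + 1) (1 + max 1 (K ^ n / M ^ n))"
    define S where "S = {z. Im z > 0} \<inter> ball 0 R"
    have oS: "open S" unfolding S_def by (intro open_Int open_halfspace_Im_gt open_ball)
    have cl: "closure S \<subseteq> {z. Im z \<ge> 0} \<inter> cball 0 R"
      by (rule closure_minimal) (auto simp: S_def intro!: closed_Int closed_halfspace_Im_ge)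
    have nz: "1 - \<i> * z \<noteq> 0" if "Im z \<ge> 0" for z
      using low(1)[OF that] by (metis norm_zero not_one_le_zero)
    have "norm (G \<xi>) \<le> M ^ n"
    proof (rule maximum_modulus_frontier[where f=G and S=S and \<xi>=\<xi>])
      have "G holomorphic_on S" unfolding G_def
        using nz by (intro holomorphic_intros holomorphic_on_subset[OF F]) (auto simp: S_def)
      then show "G holomorphic_on interior S" by (simp only: interior_open[OF oS])
      show "continuous_on (closure S) G" unfolding G_def
        using nz cl by (intro continuous_intros continuous_on_subset[OF holomorphic_on_imp_continuous_on[OF F]]) auto
      show "bounded S" unfolding S_def by (simp add: bounded_Int)
      show "\<xi> \<in> S" unfolding S_def R_def using im by auto
      fix z assume "z \<in> frontier S"
      then have zz: "z \<in> closure S" "z \<notin> S" by (auto simp: frontier_def interior_open[OF oS])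
      then have a: "Im z \<ge> 0" "norm z \<le> R" using cl by auto
      then consider "Im z = 0" | "norm z = R" using zz(2) by (force simp: S_def)
      then show "norm (G z) \<le> M ^ n"
      proof cases
        case 1
        then have "z = of_real (Re z)" by (simp add: complex_eq_iff)
        then have "norm (F z) \<le> M" using bM by metis
        then have "norm (F z) ^ n \<le> M ^ n" by (simp add: power_mono)
        moreover have "norm (G z) \<le> norm (F z) ^ n"
          unfolding G_def norm_divide norm_power using low(1)[OF a(1)]
          by (simp add: divide_le_eq mult_le_cancel_left1)
        ultimately show ?thesis by simp
      next
        case 2
        have p: "norm (1 - \<i> * z) \<ge> max 1 (K ^ n / M ^ n)" using low(2)[OF a(1)] unfolding 2 R_def by linarith
        have "norm (F z) ^ n \<le> K ^ n" using K[OF a(1)] by (simp add: power_mono)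
        also have "\<dots> = (K ^ n / M ^ n) * M ^ n" using M by simp
        also have "\<dots> \<le> norm (1 - \<i> * z) * M ^ n"
          using p M by (intro mult_right_mono) auto
        finally show ?thesis using p low(1)[OF a(1)] unfolding G_def norm_divide norm_power
          by (subst divide_le_eq) (auto simp: mult.commute)
      qed
    qed
    then show ?thesis using low(1)[OF z]
      unfolding G_def norm_divide norm_power by (subst (asm) divide_le_eq) (auto split: if_splits)
  qed
  show ?thesis
  proof (rule ccontr)
    assume "\<not> ?thesis"
    then have "norm (F \<xi>) / M > 1" using M by simp
    then obtain n where "norm (1 - \<i> * \<xi>) < (norm (F \<xi>) / M) ^ n" using real_arch_pow by blast
    then have "norm (1 - \<i> * \<xi>) * M ^ n < norm (F \<xi>) ^ n"
      using M by (simp add: power_divide pos_less_divide_eq)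
    then show False using main[of n] by (simp add: mult.commute)
  qed
qed

text \<open>The hypotheses place \<open>u\<close> in the sector \<open>|arg u| \<le> pi/8\<close>,
  so \<open>|arg (u^3)| \<le> 3 pi/8\<close>, and \<open>cos (3 pi/8)\<close> exceeds
  \<open>1/4\<close>. The slope \<open>tan (pi/8) = sqrt 2 - 1\<close> is rounded up to
  \<open>9/20\<close> to keep the arithmetic rational.\<close>

lemma Re_cube_ge:
  assumes "Re u \<ge> 0" "\<bar>Im (u\<^sup>2)\<bar> \<le> Re (u\<^sup>2)"
  shows "Re (u ^ 3) \<ge> norm u ^ 3 / 4"
proof -
  obtain a b where u: "u = Complex a b" by (cases u)
  have a: "a \<ge> 0" and ab: "2 * a * \<bar>b\<bar> \<le> a\<^sup>2 - b\<^sup>2"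
    using assms by (auto simp: u power2_eq_square abs_mult)
  have b1: "\<bar>b\<bar> \<le> 9 / 20 * a"
  proof (rule ccontr)
    assume n: "\<not> ?thesis"
    have "(9 / 20 * a) * (9 / 20 * a) \<le> \<bar>b\<bar> * \<bar>b\<bar>" "2 * a * (9 / 20 * a) \<le> 2 * a * \<bar>b\<bar>"
      using n a by (intro mult_mono; simp)+
    then have "441 / 400 * (a * a) \<le> a * a" using ab by (simp add: power2_eq_square abs_mult[symmetric])
    then have "a * a \<le> 0" by simp
    then have "a = 0" by (metis mult_eq_0_iff mult_nonneg_nonneg a order_antisym)
    then show False using n ab by auto
  qed
  have b2: "b * b \<le> 81 / 400 * (a * a)"
  proof -
    have "\<bar>b\<bar> * \<bar>b\<bar> \<le> (9 / 20 * a) * (9 / 20 * a)" using b1 a by (intro mult_mono) auto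
    then show ?thesis by (simp add: abs_mult[symmetric])
  qed
  have nu: "norm u \<le> 11 / 10 * a"
  proof -
    have "(norm u)\<^sup>2 = a * a + b * b" by (simp add: u cmod_power2) (simp add: power2_eq_square)
    also have "\<dots> \<le> 121 / 100 * (a * a)" using b2 mult_nonneg_nonneg[OF a a] by linarith
    also have "\<dots> = (11 / 10 * a)\<^sup>2" by (simp add: power2_eq_square)
    finally show ?thesis by (rule power2_le_imp_le) (use a in simp)
  qed
  have "norm u ^ 3 \<le> (11 / 10 * a) ^ 3" using nu by (intro power_mono) auto
  moreover have "Re (u ^ 3) = a * (a * a - 3 * (b * b))"
    by (simp add: u power3_eq_cube algebra_simps)
  moreover have "a * (a * a - 3 * (b * b)) \<ge> a * (39 / 100 * (a * a))"
    using b2 a mult_nonneg_nonneg[OF a a] by (intro mult_left_mono) linarith+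
  moreover have "a ^ 3 \<ge> 0" using a by simp
  ultimately show ?thesis by (simp add: power3_eq_cube power_mult_distrib)
qed

text \<open>The critical order for a quadrant is 2 and the growth of \<open>F\<close> has order 1. A
  factor \<open>exp (- \<delta> u^3)\<close> with \<open>|u|^2\<close> comparable to
  \<open>|z|\<close> decays with order \<open>3/2\<close>, so it beats the growth of
  \<open>F\<close> for every \<open>\<delta> > 0\<close>, and \<open>\<delta>\<close> then tends to
  0.\<close>

lemma phragmen_lindelof_quadrant:
  assumes F: "F holomorphic_on UNIV" and M: "M > 0"
    and gr: "\<And>z. norm (F z) \<le> A * exp (B * norm z)" and B: "B \<ge> 0"
    and b1: "\<And>x. x \<ge> 0 \<Longrightarrow> norm (F (of_real x)) \<le> M"
    and b2: "\<And>x. x \<ge> 0 \<Longrightarrow> norm (F (\<i> * of_real x)) \<le> M"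
    and z: "Re \<xi> \<ge> 0" "Im \<xi> \<ge> 0"
  shows "norm (F \<xi>) \<le> M"
proof (cases "Re \<xi> = 0 \<or> Im \<xi> = 0")
  case True
  then have "\<xi> = of_real (Re \<xi>) \<or> \<xi> = \<i> * of_real (Im \<xi>)" by (auto simp: complex_eq_iff)
  then show ?thesis using b1 b2 z by metis
next
  case False
  then have pos: "Re \<xi> > 0" "Im \<xi> > 0" using z by auto
  \<comment> \<open>The rotation moves the quadrant to the sector \<open>|arg| \<le> pi/4\<close>.
    Adding 1 in \<open>w\<close> keeps the values away from the branch cut of \<open>csqrt\<close>,
    so \<open>u\<close> is holomorphic near the region and takes values in the sector of
    \<open>Re_cube_ge\<close>.\<close>
  define \<omega> where "\<omega> = cis (- pi/4)"
  define w where "w = (\<lambda>z. 1 + \<omega> * z)"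
  define u where "u = (\<lambda>z. csqrt (w z))"
  have om: "Re \<omega> = sqrt 2 / 2" "Im \<omega> = - sqrt 2 / 2"
    by (auto simp: \<omega>_def cos_45 sin_45)
  have w: "Re (w z) \<ge> 1" "\<bar>Im (w z)\<bar> \<le> Re (w z)" if "Re z \<ge> 0" "Im z \<ge> 0" for z
  proof -
    have e: "Re (w z) = 1 + sqrt 2 / 2 * (Re z + Im z)" "Im (w z) = sqrt 2 / 2 * (Im z - Re z)"
      by (auto simp: w_def om algebra_simps)
    show "Re (w z) \<ge> 1" using that by (simp add: e)
    have "\<bar>Im (w z)\<bar> = sqrt 2 / 2 * \<bar>Im z - Re z\<bar>" by (simp add: e abs_mult)
    also have "\<dots> \<le> sqrt 2 / 2 * (Re z + Im z)" using that by (intro mult_left_mono) auto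
    finally show "\<bar>Im (w z)\<bar> \<le> Re (w z)" by (simp add: e)
  qed
  have u3: "Re (u z ^ 3) \<ge> norm (u z) ^ 3 / 4" if "Re z \<ge> 0" "Im z \<ge> 0" for z
    using w[OF that] Re_csqrt by (intro Re_cube_ge) (auto simp: u_def)
  have nz: "norm z - 1 \<le> (norm (u z))\<^sup>2" "norm z \<le> (norm (u z))\<^sup>2 + 1" for z
  proof -
    have "(norm (u z))\<^sup>2 = norm (w z)" by (simp add: u_def flip: norm_power)
    moreover have "norm (w z) \<ge> norm (\<omega> * z) - norm (1::complex)"
      unfolding w_def by (smt (verit) norm_diff_ineq add.commute)
    moreover have "norm (\<omega> * z) = norm z" by (simp add: norm_mult \<omega>_def)
    ultimately show "norm z - 1 \<le> (norm (u z))\<^sup>2" "norm z \<le> (norm (u z))\<^sup>2 + 1" by auto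
  qed
  have A: "A \<ge> 0" using order_trans[OF norm_ge_zero gr[of 0]] by simp
  have main: "norm (F \<xi>) \<le> M * exp (\<delta> * Re (u \<xi> ^ 3))" if d: "\<delta> > 0" for \<delta>
  proof -
    \<comment> \<open>This bounds \<open>G\<close> at a point with \<open>|u z| = s\<close>: there
      \<open>|z| \<le> s^2 + 1\<close>, and the cubic term eventually wins. The radius
      \<open>R\<close> below exceeds \<open>s0^2\<close> by 1 because only
      \<open>|u z|^2 \<ge> |z| - 1\<close> is available.\<close>
    let ?E = "\<lambda>s. A * exp (B * (s\<^sup>2 + 1) - \<delta> * (s ^ 3 / 4))"
    define G where "G = (\<lambda>z. F z * exp (- of_real \<delta> * u z ^ 3))"
    have nG: "norm (G z) = norm (F z) * exp (- \<delta> * Re (u z ^ 3))" for z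
      by (simp add: G_def norm_mult norm_exp_eq_Re)
    have "(?E \<longlongrightarrow> 0) at_top"
      using d B by real_asymp
    then have "eventually (\<lambda>s. ?E s < M) at_top"
      using M order_tendstoD(2) by blast
    then obtain s0 where s0: "\<And>s. s \<ge> s0 \<Longrightarrow> ?E s < M"
      by (auto simp: eventually_at_top_linorder)
    define R where "R = max (norm \<xi> + 1) (s0\<^sup>2 + 1)"
    define S where "S = {z. Re z > 0} \<inter> {z. Im z > 0} \<inter> ball 0 R"
    have oS: "open S" unfolding S_def
      by (intro open_Int open_halfspace_Im_gt open_halfspace_Re_gt open_ball)
    have cl: "closure S \<subseteq> {z. Re z \<ge> 0} \<inter> {z. Im z \<ge> 0} \<inter> cball 0 R"
      by (rule closure_minimal)
        (auto simp: S_def intro!: closed_Int closed_halfspace_Im_ge closed_halfspace_Re_ge)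
    have nr: "w z \<notin> \<real>\<^sub>\<le>\<^sub>0" if "Re z \<ge> 0" "Im z \<ge> 0" for z
      using w(1)[OF that] by (auto simp: complex_nonpos_Reals_iff)
    have "norm (G \<xi>) \<le> M"
    proof (rule maximum_modulus_frontier[where f=G and S=S and \<xi>=\<xi>])
      have "G holomorphic_on S" unfolding G_def u_def
        using nr by (intro holomorphic_intros holomorphic_on_subset[OF F])
          (auto simp: S_def w_def intro!: holomorphic_intros)
      then show "G holomorphic_on interior S" by (simp only: interior_open[OF oS])
      show "continuous_on (closure S) G" unfolding G_def u_def
      proof (intro continuous_intros continuous_on_subset[OF holomorphic_on_imp_continuous_on[OF F]])
        have "continuous_on (w ` closure S) csqrt"
          using nr cl by (intro continuous_on_subset[OF continuous_on_csqrt]) auto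
        then show "continuous_on (closure S) (\<lambda>x. csqrt (w x))"
          by (rule continuous_on_compose2) (auto simp: w_def intro!: continuous_intros)
      qed auto
      show "bounded S" unfolding S_def by (simp add: bounded_Int)
      show "\<xi> \<in> S" unfolding S_def R_def using pos by auto
      fix z assume "z \<in> frontier S"
      then have zz: "z \<in> closure S" "z \<notin> S" by (auto simp: frontier_def interior_open[OF oS])
      then have a: "Re z \<ge> 0" "Im z \<ge> 0" "norm z \<le> R" using cl by auto
      have u3': "Re (u z ^ 3) \<ge> norm (u z) ^ 3 / 4" by (rule u3) (use a in auto)
      then have "Re (u z ^ 3) \<ge> 0" by (smt (verit) divide_nonneg_nonneg norm_ge_zero zero_le_power)
      then have le: "norm (G z) \<le> norm (F z)"
        unfolding nG using d by (simp add: mult_le_cancel_left2)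
      consider "Re z = 0 \<or> Im z = 0" | "norm z = R" using zz(2) a by (force simp: S_def)
      then show "norm (G z) \<le> M"
      proof cases
        case 1
        then have "z = of_real (Re z) \<or> z = \<i> * of_real (Im z)" by (auto simp: complex_eq_iff)
        then have "norm (F z) \<le> M" using b1 b2 a by metis
        then show ?thesis using le by simp
      next
        case 2
        have "s0\<^sup>2 \<le> (norm (u z))\<^sup>2" using nz(1)[of z] 2 by (simp add: R_def)
        then have ss: "norm (u z) \<ge> s0" by (rule power2_le_imp_le) simp
        have "norm (G z) \<le> (A * exp (B * norm z)) * exp (- \<delta> * Re (u z ^ 3))"
          unfolding nG by (intro mult_right_mono gr) simp
        also have "\<dots> \<le> (A * exp (B * ((norm (u z))\<^sup>2 + 1))) * exp (- \<delta> * (norm (u z) ^ 3 / 4))"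
          using nz(2)[of z] A B d u3' by (intro mult_mono mult_left_mono) (auto simp: mult_left_mono)
        also have "\<dots> = ?E (norm (u z))"
          by (simp add: mult.assoc flip: exp_add)
        also have "\<dots> < M" by (rule s0[OF ss])
        finally show ?thesis by simp
      qed
    qed
    then show ?thesis unfolding nG by (simp add: exp_minus field_simps)
  qed
  have "((\<lambda>\<delta>. M * exp (\<delta> * Re (u \<xi> ^ 3))) \<longlongrightarrow> M * exp (0 * Re (u \<xi> ^ 3))) (at_right 0)"
    by (intro tendsto_intros)
  then show ?thesis
    by (intro tendsto_lowerbound[where F="at_right (0::real)" and f="\<lambda>\<delta>. M * exp (\<delta> * Re (u \<xi> ^ 3))"])
      (auto simp: eventually_at_right_less intro!: eventually_at_rightI[of 0 1] main)
qed

text \<open>The factor \<open>exp (i \<tau> z)\<close> has modulus 1 on the real axis and cancels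
  the growth on the positive imaginary axis. The two quadrants give boundedness by
  \<open>max M A\<close>, which is too weak but qualitative; the half-plane lemma then improves the
  constant to \<open>M\<close>.\<close>

lemma exponential_type_bound_upper:
  assumes F: "F holomorphic_on UNIV" and M: "M > 0" and s: "\<tau> \<ge> 0"
    and A: "\<And>z. norm (F z) \<le> A * exp (\<tau> * norm z)"
    and bM: "\<And>x::real. norm (F (of_real x)) \<le> M"
    and z: "Im \<xi> \<ge> 0"
  shows "norm (F \<xi>) \<le> M * exp (\<tau> * Im \<xi>)"
proof -
  have A0: "A \<ge> 0" using order_trans[OF norm_ge_zero A[of 0]] by simp
  define G where "G = (\<lambda>z. F z * exp (\<i> * of_real \<tau> * z))"
  have nG: "norm (G z) = norm (F z) * exp (- (\<tau> * Im z))" for z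
    by (simp add: G_def norm_mult norm_exp_eq_Re algebra_simps)
  have hG: "G holomorphic_on UNIV" unfolding G_def by (intro holomorphic_intros F)
  have K0: "max M A > 0" using M by simp
  have G1: "norm (G z) \<le> A * exp (2 * \<tau> * norm z)" for z
  proof -
    have "norm (G z) \<le> (A * exp (\<tau> * norm z)) * exp (\<tau> * norm z)"
      unfolding nG using s A0 abs_Im_le_cmod[of z]
      by (intro mult_mono A) (auto, smt (verit) minus_mult_right mult_left_mono)
    also have "\<dots> = A * exp (2 * \<tau> * norm z)"
      by (simp add: mult.assoc flip: exp_add)
    finally show ?thesis .
  qed
  have G2: "norm (G (of_real x)) \<le> max M A" for x :: real
    using bM[of x] by (simp add: nG)
  have G3: "norm (G (\<i> * of_real y)) \<le> max M A" if "y \<ge> 0" for y :: real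
  proof -
    have "norm (G (\<i> * of_real y)) \<le> (A * exp (\<tau> * norm (\<i> * of_real y))) * exp (- (\<tau> * y))"
      unfolding nG by (simp, intro mult_right_mono order_trans[OF A]) (auto simp: norm_mult)
    also have "\<dots> = A" using that by (simp add: norm_mult mult.assoc flip: exp_add)
    finally show ?thesis by simp
  qed
  have K: "norm (G z) \<le> max M A" if i: "Im z \<ge> 0" for z
  proof (cases "Re z \<ge> 0")
    case True
    show ?thesis
      by (rule phragmen_lindelof_quadrant[OF hG K0 G1]) (use G2 G3 True i s in auto)
  next
    case False
    \<comment> \<open>The second quadrant is the first one turned by a right angle, so the argument
      is repeated for \<open>z \<mapsto> G (\<i> * z)\<close>.\<close>
    have "norm ((\<lambda>z. G (\<i> * z)) (- \<i> * z)) \<le> max M A"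
    proof (rule phragmen_lindelof_quadrant[where F="\<lambda>z. G (\<i> * z)" and A=A and B="2 * \<tau>"])
      show "(\<lambda>z. G (\<i> * z)) holomorphic_on UNIV"
        by (rule holomorphic_on_compose_gen[OF _ hG, unfolded o_def]) (auto intro!: holomorphic_intros)
      show "norm (G (\<i> * z)) \<le> A * exp (2 * \<tau> * norm z)" for z
        using G1[of "\<i> * z"] by (simp add: norm_mult)
      show "norm (G (\<i> * (\<i> * of_real x))) \<le> max M A" for x :: real
        using G2[of "-x"] by (simp flip: mult.assoc)
    qed (use G3 K0 s False i in auto)
    then show ?thesis by (simp flip: mult.assoc)
  qed
  have "norm (G \<xi>) \<le> M"
    by (rule phragmen_lindelof_halfplane_bounded[OF hG M K _ z]) (use bM nG in auto)
  then show ?thesis unfolding nG minus_mult_left[symmetric] exp_minus by (simp add: field_simps)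
qed

text \<open>The \<open>\<epsilon>\<close> is spent twice: on the type, since only
  \<open>\<sigma> + \<epsilon>\<close> is granted by the growth hypothesis, and on \<open>M\<close>,
  since the one-sided bound wants a positive constant. The lower half-plane follows from
  \<open>z \<mapsto> - z\<close>.\<close>

lemma exponential_type_bound:
  assumes F: "F holomorphic_on UNIV" and M: "M \<ge> 0" and s: "\<sigma> \<ge> 0"
    and gr: "\<And>\<epsilon>. \<epsilon> > 0 \<Longrightarrow> \<exists>A. \<forall>z. norm (F z) \<le> A * exp ((\<sigma> + \<epsilon>) * norm z)"
    and bM: "\<And>x::real. norm (F (of_real x)) \<le> M"
  shows "norm (F \<xi>) \<le> M * exp (\<sigma> * \<bar>Im \<xi>\<bar>)"
proof -
  let ?b = "\<lambda>\<epsilon>. (M + \<epsilon>) * exp ((\<sigma> + \<epsilon>) * \<bar>Im \<xi>\<bar>)"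
  have main: "norm (F \<xi>) \<le> ?b \<epsilon>" if e: "\<epsilon> > 0" for \<epsilon>
  proof -
    obtain A where A: "\<And>z. norm (F z) \<le> A * exp ((\<sigma> + \<epsilon>) * norm z)" using gr[OF e] by blast
    have bM': "norm (F (of_real x)) \<le> M + \<epsilon>" for x :: real using bM[of x] e by simp
    have p: "M + \<epsilon> > 0" "\<sigma> + \<epsilon> \<ge> 0" using M s e by auto
    show ?thesis
    proof (cases "Im \<xi> \<ge> 0")
      case True
      then show ?thesis using exponential_type_bound_upper[OF F p A bM' True] by simp
    next
      case False
      have "norm ((\<lambda>z. F (- z)) (- \<xi>)) \<le> (M + \<epsilon>) * exp ((\<sigma> + \<epsilon>) * Im (- \<xi>))"
      proof (rule exponential_type_bound_upper[OF _ p])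
        show "(\<lambda>z. F (- z)) holomorphic_on UNIV"
          by (rule holomorphic_on_compose_gen[OF holomorphic_on_minus[OF holomorphic_on_ident] F, unfolded o_def]) simp
        show "norm (F (- z)) \<le> A * exp ((\<sigma> + \<epsilon>) * norm z)" for z using A[of "- z"] by simp
        show "norm (F (- of_real x)) \<le> M + \<epsilon>" for x :: real using bM'[of "- x"] by simp
      qed (use False in auto)
      then show ?thesis using False by simp
    qed
  qed
  have "(?b \<longlongrightarrow> (M + 0) * exp ((\<sigma> + 0) * \<bar>Im \<xi>\<bar>)) (at_right 0)" by (intro tendsto_intros)
  then show ?thesis
    by (intro tendsto_lowerbound[where F="at_right (0::real)" and f="?b"])
      (auto intro!: eventually_at_rightI[of 0 1] main)
qed

section \<open>Growth of L^q norms on horizontal lines\<close>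

text \<open>The data \<open>a\<close> and \<open>b\<close> are upper bounds for the two integrals,
  not their values, because each use has only estimates for them. Degenerate bounds are split off
  since the proof normalises by \<open>a\<close> and \<open>b\<close>.\<close>

lemma nn_integral_Holder:
  fixes u v :: "'a \<Rightarrow> real"
  assumes pq: "p > 1" "q > 1" "1 / p + 1 / q = 1"
    and [measurable]: "u \<in> borel_measurable M" "v \<in> borel_measurable M"
    and u0: "\<And>x. u x \<ge> 0" and v0: "\<And>x. v x \<ge> 0"
    and ab: "a \<ge> 0" "b \<ge> 0"
    and ua: "(\<integral>\<^sup>+x. ennreal (u x powr q) \<partial>M) \<le> ennreal a"
    and vb: "(\<integral>\<^sup>+x. ennreal (v x powr p) \<partial>M) \<le> ennreal b"
  shows "(\<integral>\<^sup>+x. ennreal (u x * v x) \<partial>M) \<le> ennreal (a powr (1/q) * b powr (1/p))"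
proof -
  have zero: "AE x in M. w x = 0"
    if "(\<integral>\<^sup>+x. ennreal (w x powr r) \<partial>M) \<le> ennreal 0" "w \<in> borel_measurable M" for w :: "'a \<Rightarrow> real" and r
  proof -
    note [measurable] = that(2)
    have "(\<integral>\<^sup>+x. ennreal (w x powr r) \<partial>M) = 0" using that by simp
    then have "AE x in M. ennreal (w x powr r) = 0" by (subst (asm) nn_integral_0_iff_AE) auto
    then show ?thesis by (rule eventually_mono) (auto simp: ennreal_eq_0_iff powr_def split: if_splits)
  qed
  show ?thesis
  proof (cases "a = 0 \<or> b = 0")
    case True
    then have "(AE x in M. u x = 0) \<or> (AE x in M. v x = 0)"
      using zero[of u q] zero[of v p] ua vb by auto
    then have "AE x in M. u x * v x = 0" by (auto elim: eventually_mono)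
    then have "(\<integral>\<^sup>+x. ennreal (u x * v x) \<partial>M) = (\<integral>\<^sup>+x. 0 \<partial>M)"
      by (intro nn_integral_cong_AE) (auto elim: eventually_mono)
    then show ?thesis by simp
  next
    case False
    then have 3: "a > 0" "b > 0" using ab by auto
    define \<alpha> where "\<alpha> = a powr (1/q)"
    define \<beta> where "\<beta> = b powr (1/p)"
    have pos: "\<alpha> > 0" "\<beta> > 0" using 3 by (auto simp: \<alpha>_def \<beta>_def)
    have pw: "\<alpha> powr q = a" "\<beta> powr p = b" using 3 pq by (auto simp: \<alpha>_def \<beta>_def powr_powr)
    \<comment> \<open>Young's inequality is applied to \<open>u / \<alpha>\<close> and
      \<open>v / \<beta>\<close>, whose q-th and p-th power integrals are at most 1. The two weights
      absorb the scaling, so that \<open>c1 * a + c2 * b = \<alpha> * \<beta>\<close>.\<close>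
    define c1 where "c1 = \<alpha> * \<beta> / (q * a)"
    define c2 where "c2 = \<alpha> * \<beta> / (p * b)"
    have le: "u x * v x \<le> c1 * u x powr q + c2 * v x powr p" for x
    proof -
      have "(u x / \<alpha>) * (v x / \<beta>) \<le> (u x / \<alpha>) powr q / q + (v x / \<beta>) powr p / p"
        using Youngs_inequality[of q p "u x / \<alpha>" "v x / \<beta>"] pq pos u0 v0 by (simp add: add.commute)
      also have "(u x / \<alpha>) powr q = u x powr q / a" using u0 pos pw by (simp add: powr_divide)
      also have "(v x / \<beta>) powr p = v x powr p / b" using v0 pos pw by (simp add: powr_divide)
      finally have "\<alpha> * \<beta> * ((u x / \<alpha>) * (v x / \<beta>)) \<le> \<alpha> * \<beta> * (u x powr q / a / q + v x powr p / b / p)"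
        using pos by (intro mult_left_mono) auto
      moreover have "\<alpha> * \<beta> * ((u x / \<alpha>) * (v x / \<beta>)) = u x * v x" using pos by simp
      ultimately show ?thesis by (simp add: algebra_simps c1_def c2_def)
    qed
    have nn: "c1 \<ge> 0" "c2 \<ge> 0" using pos pq 3 by (auto simp: c1_def c2_def)
    have "(\<integral>\<^sup>+x. ennreal (u x * v x) \<partial>M) \<le>
        (\<integral>\<^sup>+x. ennreal c1 * ennreal (u x powr q) + ennreal c2 * ennreal (v x powr p) \<partial>M)"
    proof (rule nn_integral_mono)
      fix x
      have "ennreal (u x * v x) \<le> ennreal (c1 * u x powr q + c2 * v x powr p)"
        by (rule ennreal_leI[OF le])
      also have "\<dots> = ennreal c1 * ennreal (u x powr q) + ennreal c2 * ennreal (v x powr p)"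
        using nn by (subst ennreal_plus) (auto simp: ennreal_mult)
      finally show "ennreal (u x * v x) \<le> \<dots>" .
    qed
    also have "\<dots> = ennreal c1 * (\<integral>\<^sup>+x. ennreal (u x powr q) \<partial>M) + ennreal c2 * (\<integral>\<^sup>+x. ennreal (v x powr p) \<partial>M)"
      by (subst nn_integral_add) (auto simp: nn_integral_cmult)
    also have "\<dots> \<le> ennreal c1 * ennreal a + ennreal c2 * ennreal b"
      by (intro add_mono mult_left_mono ua vb) auto
    also have "\<dots> = ennreal (c1 * a + c2 * b)"
      using nn 3 by (subst ennreal_plus) (auto simp: ennreal_mult)
    also have "c1 * a + c2 * b = \<alpha> * \<beta> * (1 / p + 1 / q)"
      using 3 pq(1,2) by (simp add: c1_def c2_def field_simps)
    finally show ?thesis by (simp add: pq \<alpha>_def \<beta>_def)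
  qed
qed

text \<open>With \<open>r = q - 1\<close> this is the map that sends a function to its extremal
  partner in Hoelder's inequality. Only the origin needs care: \<open>sgn\<close> jumps there, but
  the modulus \<open>|w|^r\<close> tends to 0.\<close>

lemma continuous_on_cnj_sgn_powr:
  assumes "r > 0"
  shows "continuous_on UNIV (\<lambda>w::complex. cnj (sgn w) * of_real (norm w powr r))"
proof (rule continuous_at_imp_continuous_on, rule ballI)
  fix w :: complex
  show "isCont (\<lambda>w. cnj (sgn w) * of_real (norm w powr r)) w"
  proof (cases "w = 0")
    case False
    then show ?thesis by (intro continuous_intros) auto
  next
    case True
    have "((\<lambda>w::complex. norm w powr r) \<longlongrightarrow> 0 powr r) (at 0)"
      by (intro tendsto_powr' tendsto_eq_intros) (use assms in auto)
    then have t: "((\<lambda>w::complex. norm w powr r) \<longlongrightarrow> 0) (at 0)" by simp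
    have "((\<lambda>w. cnj (sgn w) * complex_of_real (norm w powr r)) \<longlongrightarrow> 0) (at 0)"
      by (rule Lim_null_comparison[OF _ t]) (auto simp: norm_mult norm_sgn)
    then show ?thesis using True by (simp add: isCont_def)
  qed
qed

lemma nn_integral_le_exhausting:
  fixes f :: "'a \<Rightarrow> ennreal" and A :: "nat \<Rightarrow> 'a set"
  assumes [measurable]: "f \<in> borel_measurable M" "\<And>n. A n \<in> sets M"
    and A: "incseq A" "\<And>x. \<exists>n. x \<in> A n"
    and b: "\<And>n. (\<integral>\<^sup>+x. f x * indicator (A n) x \<partial>M) \<le> c"
  shows "(\<integral>\<^sup>+x. f x \<partial>M) \<le> c"
proof -
  have eq: "(SUP n. f x * indicator (A n) x) = f x" for x
  proof (rule antisym)
    obtain n where "x \<in> A n" using A(2) by blast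
    then have "f x \<le> f x * indicator (A n) x" by simp
    also have "\<dots> \<le> (SUP n. f x * indicator (A n) x)" by (rule SUP_upper) simp
    finally show "f x \<le> (SUP n. f x * indicator (A n) x)" .
  qed (auto intro!: SUP_least simp: indicator_def)
  have "(\<integral>\<^sup>+x. f x \<partial>M) = (\<integral>\<^sup>+x. (SUP n. f x * indicator (A n) x) \<partial>M)" by (simp add: eq)
  also have "\<dots> = (SUP n. (\<integral>\<^sup>+x. f x * indicator (A n) x \<partial>M))"
    by (rule nn_integral_monotone_convergence_SUP)
      (use A(1) in \<open>auto simp: incseq_def le_fun_def indicator_def\<close>)
  also have "\<dots> \<le> c" by (intro SUP_least b)
  finally show ?thesis .
qed

lemma nn_integral_interval_continuous:
  fixes h :: "real \<Rightarrow> real"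
  assumes "continuous_on UNIV h" "\<And>x. h x \<ge> 0"
  shows "(\<integral>\<^sup>+x. ennreal (h x) * indicator {a..b} x \<partial>lborel) = ennreal (integral {a..b} h)"
  by (rule nn_integral_has_integral_lebesgue')
    (use assms in \<open>auto intro!: integrable_integral integrable_continuous_interval continuous_on_subset[OF assms(1)]\<close>)

lemma holomorphic_integral_translate:
  fixes g :: "complex \<Rightarrow> complex" and \<phi> :: "real \<Rightarrow> complex"
  assumes g: "g holomorphic_on UNIV" and c\<phi>: "continuous_on {a..b} \<phi>"
  shows "(\<lambda>z. integral {a..b} (\<lambda>s. g (z + of_real s) * \<phi> s)) holomorphic_on UNIV"
  unfolding holomorphic_on_def
proof
  fix z0 :: complex
  have cg: "continuous_on UNIV g" using g by (rule holomorphic_on_imp_continuous_on)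
  have "deriv g holomorphic_on UNIV" by (intro holomorphic_deriv g open_UNIV)
  then have cd: "continuous_on UNIV (deriv g)" by (rule holomorphic_on_imp_continuous_on)
  have "(\<lambda>z. integral (cbox a b) (\<lambda>s. g (z + of_real s) * \<phi> s)) field_differentiable at z0 within UNIV"
  proof (rule leibniz_rule_field_differentiable[where fx="\<lambda>z s. deriv g (z + of_real s) * \<phi> s"])
    fix z t
    have "((\<lambda>z. g (z + of_real t)) has_field_derivative deriv g (z + of_real t)) (at z)"
      using holomorphic_derivI[OF g open_UNIV UNIV_I, of "z + of_real t" UNIV] by (simp add: DERIV_shift)
    then show "((\<lambda>z. g (z + of_real t) * \<phi> t) has_field_derivative deriv g (z + of_real t) * \<phi> t) (at z within UNIV)"
      by (rule DERIV_cmult_right)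
  next
    have "continuous_on (UNIV \<times> {a..b}) (\<lambda>x::complex \<times> real. deriv g (fst x + of_real (snd x)))"
      by (rule continuous_on_compose2[OF cd]) (auto intro!: continuous_intros)
    moreover have "continuous_on (UNIV \<times> {a..b}) (\<lambda>x::complex \<times> real. \<phi> (snd x))"
      by (rule continuous_on_compose2[OF c\<phi>]) (auto intro!: continuous_intros)
    ultimately show "continuous_on (UNIV \<times> cbox a b) (\<lambda>(z, t). deriv g (z + of_real t) * \<phi> t)"
      unfolding split_beta box_real by (rule continuous_on_mult)
  next
    fix z
    have "continuous_on {a..b} (\<lambda>s. g (z + of_real s))"
      by (rule continuous_on_compose2[OF cg]) (auto intro!: continuous_intros)
    then show "(\<lambda>s. g (z + of_real s) * \<phi> s) integrable_on cbox a b"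
      unfolding box_real by (intro integrable_continuous_interval continuous_on_mult c\<phi>)
  qed auto
  then show "(\<lambda>z. integral {a..b} (\<lambda>s. g (z + of_real s) * \<phi> s)) field_differentiable at z0 within UNIV"
    by simp
qed

lemma nn_integral_strip_le:
  fixes g :: "complex \<Rightarrow> complex"
  assumes g: "g holomorphic_on UNIV" and s: "\<sigma> \<ge> 0" and q: "q > 1"
    and gr: "\<And>\<epsilon>. \<epsilon> > 0 \<Longrightarrow> \<exists>A. \<forall>z. norm (g z) \<le> A * exp ((\<sigma> + \<epsilon>) * norm z)"
  shows "(\<integral>\<^sup>+x. ennreal (norm (g (Complex x y)) powr q) \<partial>lborel)
    \<le> ennreal (exp (q * \<sigma> * \<bar>y\<bar>)) * (\<integral>\<^sup>+x. ennreal (norm (g (of_real x)) powr q) \<partial>lborel)"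
    (is "_ \<le> _ * ?G")
proof (cases "?G = \<infinity>")
  case True
  then show ?thesis by (simp add: ennreal_mult_top)
next
  case False
  then obtain G0 where G0: "?G = ennreal G0" "G0 \<ge> 0"
    by (cases ?G rule: ennreal_cases) auto
  let ?g = "\<lambda>s. g (Complex s y)"
  define p where "p = q / (q - 1)"
  have p: "p > 1" "1 / p + 1 / q = 1" "(q - 1) * p = q" using q by (auto simp: p_def field_simps)
  have cg: "continuous_on UNIV g" using g by (rule holomorphic_on_imp_continuous_on)
  have cgc: "continuous_on A (\<lambda>x. g (h x))" if "continuous_on A h" for h and A :: "'z::topological_space set"
    by (rule continuous_on_compose2[OF cg that]) auto
  have cC: "continuous_on A (\<lambda>s. Complex s y)" for A
    unfolding Complex_eq by (intro continuous_intros)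
  \<comment> \<open>This is the equality case of Hoelder on the line at height \<open>y\<close>:
    \<open>|\<phi>|^p = |g|^q\<close> and \<open>g * \<phi> = |g|^q\<close>.\<close>
  define \<phi> where "\<phi> = (\<lambda>s. cnj (sgn (?g s)) * of_real (norm (?g s) powr (q - 1)))"
  have c\<phi>: "continuous_on A \<phi>" for A unfolding \<phi>_def
    by (rule continuous_on_compose2[OF continuous_on_cnj_sgn_powr cgc[OF cC]]) (use q in auto)
  have n\<phi>: "norm (\<phi> s) = norm (?g s) powr (q - 1)" for s
    by (cases "?g s = 0") (auto simp: \<phi>_def norm_mult norm_sgn)
  have g\<phi>: "?g s * \<phi> s = of_real (norm (?g s) powr q)" for s
  proof (cases "?g s = 0")
    case False
    then have "?g s * cnj (sgn (?g s)) = of_real (norm (?g s))"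
      by (simp add: sgn_div_norm complex_norm_square[symmetric] scaleR_conv_of_real field_simps power2_eq_square)
    then have "?g s * \<phi> s = of_real (norm (?g s) * norm (?g s) powr (q - 1))"
      by (simp add: \<phi>_def mult.assoc[symmetric])
    also have "norm (?g s) * norm (?g s) powr (q - 1) = norm (?g s) powr q"
      using False powr_add[of "norm (?g s)" 1 "q - 1"] by simp
    finally show ?thesis .
  qed (auto simp: \<phi>_def)
  have cq: "continuous_on UNIV (\<lambda>s. norm (?g s) powr q)"
    by (intro continuous_on_powr' continuous_intros cgc cC) (use q in auto)
  have main: "(\<integral>\<^sup>+x. ennreal (norm (?g x) powr q) * indicator {- real n..real n} x \<partial>lborel)
      \<le> ennreal (exp (q * \<sigma> * \<bar>y\<bar>) * G0)" for n
  proof -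
    define R where "R = real n"
    have R: "R \<ge> 0" by (simp add: R_def)
    define V where "V = integral {-R..R} (\<lambda>s. norm (?g s) powr q)"
    have Vn: "(\<integral>\<^sup>+x. ennreal (norm (?g x) powr q) * indicator {-R..R} x \<partial>lborel) = ennreal V"
      unfolding V_def by (rule nn_integral_interval_continuous[OF cq]) simp
    have V0: "V \<ge> 0" unfolding V_def
      by (intro integral_nonneg integrable_continuous_interval continuous_on_subset[OF cq]) auto
    \<comment> \<open>On the real axis Hoelder and translation invariance bound \<open>F\<close>,
      uniformly in \<open>x\<close>, by \<open>G0^(1/q) V^(1/p)\<close>; at the point
      \<open>i y\<close> its value is \<open>V\<close>. Averaging over a compact interval keeps the
      exponential type.\<close>
    define F where "F = (\<lambda>z. integral ({-R..R}) (\<lambda>s. g (z + of_real s) * \<phi> s))"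
    have int: "(\<lambda>s. g (z + of_real s) * \<phi> s) integrable_on {-R..R}" for z
      by (intro integrable_continuous_interval continuous_intros cgc c\<phi>)
    have hF: "F holomorphic_on UNIV" unfolding F_def by (rule holomorphic_integral_translate[OF g c\<phi>])
    have bF: "norm (F z) \<le> integral ({-R..R}) (\<lambda>s. norm (g (z + of_real s)) * norm (\<phi> s))" for z
      unfolding F_def
      by (rule integral_norm_bound_integral[OF int])
        (auto simp: norm_mult intro!: integrable_continuous_interval continuous_intros cgc c\<phi>)
    have grF: "\<exists>A. \<forall>z. norm (F z) \<le> A * exp ((\<sigma> + \<epsilon>) * norm z)" if e: "\<epsilon> > 0" for \<epsilon>
    proof -
      obtain A where A: "\<And>z. norm (g z) \<le> A * exp ((\<sigma> + \<epsilon>) * norm z)" using gr[OF e] by blast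
      have A0: "A \<ge> 0" using order_trans[OF norm_ge_zero A[of 0]] by simp
      define P where "P = integral ({-R..R}) (\<lambda>s. norm (\<phi> s))"
      have "norm (F z) \<le> (A * exp ((\<sigma> + \<epsilon>) * R) * P) * exp ((\<sigma> + \<epsilon>) * norm z)" for z
      proof -
        have "norm (F z) \<le> integral ({-R..R}) (\<lambda>s. (A * exp ((\<sigma> + \<epsilon>) * (norm z + R))) * norm (\<phi> s))"
        proof (rule order_trans[OF bF], rule integral_le)
          fix t assume t: "t \<in> {-R..R}"
          have "norm (z + of_real t) \<le> norm z + R"
            using norm_triangle_ineq[of z "of_real t"] t by auto
          then have "norm (g (z + of_real t)) \<le> A * exp ((\<sigma> + \<epsilon>) * (norm z + R))"
            using A0 s e by (intro order_trans[OF A] mult_left_mono) auto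
          then show "norm (g (z + of_real t)) * norm (\<phi> t) \<le> (A * exp ((\<sigma> + \<epsilon>) * (norm z + R))) * norm (\<phi> t)"
            by (intro mult_right_mono) auto
        qed (auto intro!: integrable_continuous_interval continuous_intros cgc c\<phi>)
        also have "\<dots> = (A * exp ((\<sigma> + \<epsilon>) * R) * P) * exp ((\<sigma> + \<epsilon>) * norm z)"
          by (simp add: P_def ring_distribs exp_add)
        finally show ?thesis .
      qed
      then show ?thesis by blast
    qed
    have rF: "norm (F (of_real x)) \<le> G0 powr (1/q) * V powr (1/p)" for x :: real
    proof -
      let ?u = "\<lambda>s. norm (g (of_real x + of_real s))"
      let ?v = "\<lambda>s. norm (\<phi> s) * indicator {-R..R} s"
      have cg': "continuous_on UNIV (\<lambda>s. norm (g (of_real s)))"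
        by (intro continuous_intros cgc)
      have "ennreal (integral {-R..R} (\<lambda>s. ?u s * norm (\<phi> s))) =
          (\<integral>\<^sup>+s. ennreal (?u s * norm (\<phi> s)) * indicator {-R..R} s \<partial>lborel)"
        by (rule nn_integral_interval_continuous[symmetric])
          (auto intro!: continuous_intros cgc c\<phi>)
      also have "\<dots> = (\<integral>\<^sup>+s. ennreal (?u s * ?v s) \<partial>lborel)"
        by (intro nn_integral_cong) (auto simp: indicator_def)
      also have "\<dots> \<le> ennreal (G0 powr (1/q) * V powr (1/p))"
      proof (rule nn_integral_Holder[OF p(1) q p(2)])
        show "(\<lambda>s. ?u s) \<in> borel_measurable lborel"
          by (simp, intro borel_measurable_continuous_onI continuous_intros cgc)
        have "(\<lambda>s. norm (\<phi> s)) \<in> borel_measurable borel"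
          by (intro borel_measurable_continuous_onI continuous_intros c\<phi>)
        then show "?v \<in> borel_measurable lborel" by simp
        have [measurable]: "(\<lambda>s. norm (g (of_real s))) \<in> borel_measurable borel"
          by (intro borel_measurable_continuous_onI cg')
        have "?G = (\<integral>\<^sup>+s. ennreal (norm (g (of_real (x + 1 * s))) powr q) \<partial>lborel)"
          by (subst nn_integral_real_affine[where c=1 and t=x]) auto
        then show "(\<integral>\<^sup>+s. ennreal (?u s powr q) \<partial>lborel) \<le> ennreal G0" by (simp add: G0)
        show "(\<integral>\<^sup>+s. ennreal (?v s powr p) \<partial>lborel) \<le> ennreal V" unfolding Vn[symmetric]
          by (intro eq_refl nn_integral_cong) (simp add: indicator_def n\<phi> powr_powr p(3))
      qed (simp_all add: V0 G0)
      finally have "integral {-R..R} (\<lambda>s. ?u s * norm (\<phi> s)) \<le> G0 powr (1/q) * V powr (1/p)"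
        by (subst (asm) ennreal_le_iff) auto
      then show ?thesis using bF[of "of_real x"] by simp
    qed
    have "F (\<i> * of_real y) = integral ({-R..R}) (\<lambda>s. of_real (norm (?g s) powr q))"
      unfolding F_def by (intro integral_cong) (simp add: g\<phi>[unfolded Complex_eq] Complex_eq add.commute)
    also have "\<dots> = of_real V" unfolding V_def
      by (rule integral_unique[OF has_integral_of_real[OF integrable_integral[OF
          integrable_continuous_interval[OF continuous_on_subset[OF cq subset_UNIV]]]]])
    finally have FV: "norm (F (\<i> * of_real y)) = V" using V0 by simp
    have "norm (F (\<i> * of_real y)) \<le> (G0 powr (1/q) * V powr (1/p)) * exp (\<sigma> * \<bar>Im (\<i> * of_real y)\<bar>)"
      by (rule exponential_type_bound[OF hF _ s grF rF]) auto
    then have PL: "V \<le> G0 powr (1/q) * V powr (1/p) * exp (\<sigma> * \<bar>y\<bar>)" by (simp add: FV)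
    \<comment> \<open>The estimate \<open>PL\<close> contains \<open>V^(1/p)\<close> on the right,
      and dividing by it requires \<open>V\<close> to be finite. This is why the integral is cut off
      to \<open>[-R, R]\<close> and the cut-off removed by monotone convergence only at the
      end.\<close>
    have "V \<le> exp (q * \<sigma> * \<bar>y\<bar>) * G0"
    proof (cases "V = 0")
      case False
      then have Vp: "V > 0" using V0 by simp
      have "V powr (1/q) * V powr (1/p) = V" using Vp p(2) by (metis add.commute powr_add powr_one V0)
      then have "V powr (1/q) * V powr (1/p) \<le> (G0 powr (1/q) * exp (\<sigma> * \<bar>y\<bar>)) * V powr (1/p)"
        using PL by (simp add: mult.assoc mult.commute mult.left_commute)
      then have "V powr (1/q) \<le> G0 powr (1/q) * exp (\<sigma> * \<bar>y\<bar>)" using Vp by simp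
      then have "(V powr (1/q)) powr q \<le> (G0 powr (1/q) * exp (\<sigma> * \<bar>y\<bar>)) powr q"
        using q by (intro powr_mono2) auto
      then show ?thesis using q Vp G0 by (simp add: powr_powr powr_mult exp_powr_real mult_ac)
    qed (use G0 in auto)
    then have "ennreal V \<le> ennreal (exp (q * \<sigma> * \<bar>y\<bar>) * G0)" by (rule ennreal_leI)
    then show ?thesis unfolding Vn[symmetric] R_def .
  qed
  have "(\<lambda>x. ennreal (norm (?g x) powr q)) \<in> borel_measurable lborel"
    using borel_measurable_continuous_onI[OF cq] by simp
  then have "(\<integral>\<^sup>+x. ennreal (norm (?g x) powr q) \<partial>lborel) \<le> ennreal (exp (q * \<sigma> * \<bar>y\<bar>) * G0)"
  proof (rule nn_integral_le_exhausting[where A="\<lambda>n. {- real n..real n}", OF _ _ _ _ main])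
    fix x :: real
    obtain n :: nat where "\<bar>x\<bar> \<le> real n" using real_arch_simple by blast
    then show "\<exists>n::nat. x \<in> {- real n..real n}" by (intro exI[of _ n]) auto
  qed (auto simp: incseq_def)
  also have "\<dots> = ennreal (exp (q * \<sigma> * \<bar>y\<bar>)) * ?G"
    unfolding G0(1) using G0(2) by (intro ennreal_mult) auto
  finally show ?thesis .
qed

section \<open>The Plancherel-Polya inequality on the line\<close>

lemma borel_measurable_holomorphic: "f holomorphic_on UNIV \<Longrightarrow> f \<in> borel_measurable borel"
  by (rule borel_measurable_continuous_onI[OF holomorphic_on_imp_continuous_on])

lemma borel_measurable_Complex [measurable]:
  assumes [measurable]: "f \<in> borel_measurable M" "g \<in> borel_measurable M"
  shows "(\<lambda>x. Complex (f x) (g x)) \<in> borel_measurable M"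
  unfolding Complex_eq by measurable

lemma nn_integral_translate_real:
  assumes [measurable]: "f \<in> borel_measurable borel"
  shows "(\<integral>\<^sup>+x. f (x + t) \<partial>lborel) = (\<integral>\<^sup>+x. f x \<partial>lborel :: real measure)"
  using nn_integral_real_affine[OF assms, of 1 t] by (simp add: add.commute)

text \<open>The inner integral runs along horizontal lines, the quantity that
  \<open>nn_integral_strip_le\<close> controls. Rotation invariance is proved directly for this
  iterated form.\<close>

abbreviation plane_integral :: "(complex \<Rightarrow> ennreal) \<Rightarrow> ennreal" where
  "plane_integral F \<equiv> (\<integral>\<^sup>+y. (\<integral>\<^sup>+x. F (Complex x y) \<partial>lborel) \<partial>lborel)"

lemma plane_integral_swap:
  assumes [measurable]: "F \<in> borel_measurable borel"
  shows "plane_integral F = (\<integral>\<^sup>+x. (\<integral>\<^sup>+y. F (Complex x y) \<partial>lborel) \<partial>lborel)"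
proof -
  show ?thesis by (rule lborel_pair.Fubini') measurable
qed

lemma plane_integral_shear:
  assumes [measurable]: "F \<in> borel_measurable borel"
  shows "plane_integral (\<lambda>z. F (Complex (Re z + t * Im z) (Im z))) = plane_integral F"
    and "plane_integral (\<lambda>z. F (Complex (Re z) (Im z + t * Re z))) = plane_integral F"
proof -
  show "plane_integral (\<lambda>z. F (Complex (Re z + t * Im z) (Im z))) = plane_integral F"
  proof (rule nn_integral_cong)
    fix y
    show "(\<integral>\<^sup>+x. F (Complex (Re (Complex x y) + t * Im (Complex x y)) (Im (Complex x y))) \<partial>lborel)
        = (\<integral>\<^sup>+x. F (Complex x y) \<partial>lborel)"
      using nn_integral_translate_real[of "\<lambda>x. F (Complex x y)" "t * y"] by simp
  qed
  have "plane_integral (\<lambda>z. F (Complex (Re z) (Im z + t * Re z)))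
      = (\<integral>\<^sup>+x. (\<integral>\<^sup>+y. F (Complex x (y + t * x)) \<partial>lborel) \<partial>lborel)"
    by (subst plane_integral_swap) auto
  also have "\<dots> = (\<integral>\<^sup>+x. (\<integral>\<^sup>+y. F (Complex x y) \<partial>lborel) \<partial>lborel)"
    by (intro nn_integral_cong nn_integral_translate_real) measurable
  also have "\<dots> = plane_integral F" by (rule plane_integral_swap[symmetric]) simp
  finally show "plane_integral (\<lambda>z. F (Complex (Re z) (Im z + t * Re z))) = plane_integral F" .
qed

text \<open>A rotation by an angle other than \<open>\<pi>\<close> is a product of three shears.\<close>
lemma plane_integral_rotate_aux:
  assumes F: "F \<in> borel_measurable borel" and w: "norm w = 1" "Re w \<noteq> -1"
  shows "plane_integral (\<lambda>z. F (w * z)) = plane_integral F"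
proof -
  \<comment> \<open>Here \<open>t\<close> is the tangent of half the angle of \<open>w\<close>;
    \<open>Re w \<noteq> -1\<close> keeps it finite. The horizontal shear by \<open>- t\<close>, the
    vertical shear by \<open>s\<close>, and again the horizontal one by \<open>- t\<close> compose
    to multiplication by \<open>w\<close>.\<close>
  define c s t where "c = Re w" "s = Im w" "t = s / (1 + c)"
  have cs: "c * c + s * s = 1" using w(1) cmod_power2[of w] by (simp add: c_s_t_def power2_eq_square)
  have c: "1 + c \<noteq> 0" using w(2) by (auto simp: c_s_t_def)
  have t1: "t * (1 + c) = s" using c by (simp add: c_s_t_def)
  have "(1 - s * t) * (1 + c) = c * (1 + c)"
  proof -
    have "(1 - s * t) * (1 + c) = (1 + c) - s * (t * (1 + c))" by (simp add: algebra_simps)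
    then show ?thesis using cs unfolding t1 by (simp add: algebra_simps)
  qed
  then have t2: "1 - s * t = c" using c by simp
  note [measurable] = F
  let ?Y = "\<lambda>z. Im z + s * (Re z + (- t) * Im z)"
  let ?X = "\<lambda>z. Re z + (- t) * Im z + (- t) * ?Y z"
  have "plane_integral F = plane_integral (\<lambda>z. F (Complex (Re z + (- t) * Im z) (Im z)))"
    by (rule plane_integral_shear(1)[OF F, symmetric])
  also have "\<dots> = plane_integral (\<lambda>z. F (Complex (Re z + (- t) * (Im z + s * Re z)) (Im z + s * Re z)))"
    by (subst plane_integral_shear(2)[where t=s, symmetric]) auto
  also have "\<dots> = plane_integral (\<lambda>z. F (Complex (?X z) (?Y z)))"
    by (subst plane_integral_shear(1)[where t="- t", symmetric]) auto
  also have "\<dots> = plane_integral (\<lambda>z. F (w * z))"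
  proof -
    have "?X z = (1 - s * t) * Re z - (t * (1 + (1 - s * t))) * Im z" "?Y z = (1 - s * t) * Im z + s * Re z" for z
      by (simp_all add: algebra_simps)
    then have "Complex (?X z) (?Y z) = w * z" for z
      unfolding t2 t1 by (simp add: complex_eq_iff c_s_t_def)
    then show ?thesis by (simp only:)
  qed
  finally show ?thesis ..
qed

lemma plane_integral_rotate:
  assumes F[measurable]: "F \<in> borel_measurable borel" and w: "norm w = 1"
  shows "plane_integral (\<lambda>z. F (w * z)) = plane_integral F"
proof (cases "Re w = -1")
  case True
  then have "w = -1" using w cmod_power2[of w] by (simp add: complex_eq_iff)
  \<comment> \<open>The excluded half turn is composed of two quarter turns.\<close>
  then have "plane_integral (\<lambda>z. F (w * z)) = plane_integral (\<lambda>z. F (\<i> * (\<i> * z)))"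
    by (simp flip: mult.assoc)
  also have "\<dots> = plane_integral (\<lambda>z. F (\<i> * z))"
    by (rule plane_integral_rotate_aux) auto
  also have "\<dots> = plane_integral F" by (rule plane_integral_rotate_aux) auto
  finally show ?thesis .
qed (rule plane_integral_rotate_aux[OF F w])

lemma plane_integral_ball:
  assumes "r \<ge> 0"
  shows "plane_integral (indicator (ball 0 r)) = ennreal (pi * r\<^sup>2)"
proof -
  have "plane_integral (indicator (ball 0 r))
      = (\<integral>\<^sup>+y. (\<integral>\<^sup>+x. indicator (ball 0 r) (x :: real, y :: real) \<partial>lborel) \<partial>lborel)"
    by (intro nn_integral_cong) (auto simp: indicator_def norm_Pair cmod_def)
  also have "\<dots> = (\<integral>\<^sup>+z. indicator (ball 0 r) (z :: real \<times> real) \<partial>(lborel \<Otimes>\<^sub>M lborel))"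
  proof -
    show ?thesis by (rule lborel_pair.nn_integral_snd) (auto simp: lborel_prod intro!: borel_measurable_indicator)
  qed
  also have "\<dots> = emeasure lborel (ball (0 :: real \<times> real) r)" by (simp add: lborel_prod)
  also have "\<dots> = ennreal (pi * r\<^sup>2)" using assms by (simp add: emeasure_ball unit_ball_vol_2 power2_eq_square)
  finally show ?thesis .
qed

section \<open>Mean value inequalities for \<open>|h|^q\<close> on circles and discs\<close>

lemma circle_mean_value:
  fixes h :: "complex \<Rightarrow> complex"
  assumes "h holomorphic_on UNIV"
  shows "((\<lambda>t. h (exp (2 * of_real pi * \<i> * of_real t))) has_integral h 0) {0..1}"
proof -
  have "((\<lambda>u. h u / (u - 0)) has_contour_integral (2 * of_real pi * \<i> * h 0)) (circlepath 0 1)"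
    by (rule Cauchy_integral_circlepath_simple) (auto intro: holomorphic_on_subset[OF assms])
  then have "((\<lambda>x. h (circlepath 0 1 x) / (circlepath 0 1 x) * vector_derivative (circlepath 0 1) (at x within {0..1}))
      has_integral (2 * of_real pi * \<i> * h 0)) {0..1}"
    unfolding has_contour_integral_def by simp
  then have "((\<lambda>x. 2 * of_real pi * \<i> * h (exp (2 * of_real pi * \<i> * of_real x)))
      has_integral (2 * of_real pi * \<i> * h 0)) {0..1}"
    by (rule has_integral_eq[rotated]) (simp_all add: vector_derivative_circlepath01, simp add: circlepath)
  from has_integral_mult_right[OF this, of "1 / (2 * of_real pi * \<i>)"] show ?thesis by simp
qed

text \<open>The circle is parametrised by \<open>[0, 1]\<close>, of total mass 1, so Hoelder against
  the constant 1 raises the mean value inequality to the power \<open>q\<close> without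
  loss.\<close>

lemma powr_circle_mean_le:
  fixes h :: "complex \<Rightarrow> complex"
  assumes h: "h holomorphic_on UNIV" and q: "q > 1"
  shows "ennreal (norm (h 0) powr q) \<le>
    (\<integral>\<^sup>+t. ennreal (norm (h (exp (2 * of_real pi * \<i> * of_real t))) powr q) * indicator {0..1} t \<partial>lborel)"
proof -
  define e where "e = (\<lambda>t::real. exp (2 * of_real pi * \<i> * of_real t))"
  have ch: "continuous_on UNIV h" using h by (rule holomorphic_on_imp_continuous_on)
  have ce: "continuous_on UNIV (\<lambda>t. h (e t))"
    by (rule continuous_on_compose2[OF ch]) (auto simp: e_def intro!: continuous_intros)
  define I where "I = integral {0..1} (\<lambda>t. norm (h (e t)) powr q)"
  have cq: "continuous_on UNIV (\<lambda>t. norm (h (e t)) powr q)"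
    by (intro continuous_on_powr' continuous_intros ce) (use q in auto)
  have I: "(\<integral>\<^sup>+t. ennreal (norm (h (e t)) powr q) * indicator {0..1} t \<partial>lborel) = ennreal I"
    unfolding I_def by (rule nn_integral_interval_continuous[OF cq]) simp
  have I0: "I \<ge> 0" unfolding I_def
    by (intro integral_nonneg integrable_continuous_interval continuous_on_subset[OF cq]) auto
  define p where "p = q / (q - 1)"
  have p: "p > 1" "1 / p + 1 / q = 1" using q by (auto simp: p_def field_simps)
  have [measurable]: "(\<lambda>t. h (e t)) \<in> borel_measurable borel"
    by (rule borel_measurable_continuous_onI[OF ce])
  have "norm (h 0) \<le> integral {0..1} (\<lambda>t. norm (h (e t)))"
  proof -
    have "(\<lambda>t. h (e t)) integrable_on {0..1}" "(\<lambda>t. norm (h (e t))) integrable_on {0..1}"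
      by (intro integrable_continuous_interval continuous_intros continuous_on_subset[OF ce] subset_UNIV)+
    then have "norm (integral {0..1} (\<lambda>t. h (e t))) \<le> integral {0..1} (\<lambda>t. norm (h (e t)))"
      by (rule integral_norm_bound_integral) simp
    moreover have "integral {0..1} (\<lambda>t. h (e t)) = h 0"
      unfolding e_def by (rule integral_unique[OF circle_mean_value[OF h]])
    ultimately show ?thesis by simp
  qed
  then have "ennreal (norm (h 0)) \<le> ennreal (integral {0..1} (\<lambda>t. norm (h (e t))))"
    by (rule ennreal_leI)
  also have "\<dots> = (\<integral>\<^sup>+t. ennreal (norm (h (e t))) * indicator {0..1} t \<partial>lborel)"
    by (rule nn_integral_interval_continuous[symmetric]) (auto intro!: continuous_intros ce)
  also have "\<dots> = (\<integral>\<^sup>+t. ennreal ((norm (h (e t)) * indicator {0..1} t) * indicator {0..1} t) \<partial>lborel)"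
    by (intro nn_integral_cong) (simp add: indicator_def)
  also have "\<dots> \<le> ennreal (I powr (1 / q) * 1 powr (1 / p))"
  proof (rule nn_integral_Holder[OF p(1) q p(2)])
    show "(\<integral>\<^sup>+t. ennreal ((norm (h (e t)) * indicator {0..1} t) powr q) \<partial>lborel) \<le> ennreal I"
      unfolding I[symmetric] by (intro eq_refl nn_integral_cong) (simp add: indicator_def)
    have "(\<integral>\<^sup>+t. ennreal (indicator {0..1::real} t powr p) \<partial>lborel) = (\<integral>\<^sup>+t. indicator {0..1::real} t \<partial>lborel)"
      by (intro nn_integral_cong) (simp add: indicator_def)
    then show "(\<integral>\<^sup>+t. ennreal (indicator {0..1::real} t powr p) \<partial>lborel) \<le> ennreal 1" by simp
  qed (simp_all add: I0)
  finally have "norm (h 0) \<le> I powr (1 / q)" by (subst (asm) ennreal_le_iff) auto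
  then have "norm (h 0) powr q \<le> (I powr (1 / q)) powr q" using q by (intro powr_mono2) auto
  also have "\<dots> = I" using q I0 by (simp add: powr_powr)
  finally show ?thesis unfolding I[unfolded e_def] by (rule ennreal_leI)
qed

text \<open>This replaces polar coordinates: for each \<open>z\<close> in the disc the circle
  inequality is applied to \<open>w \<mapsto> g (c + w z)\<close> and then integrated over
  \<open>z\<close>. After exchanging the integrals, rotation invariance makes the integrand
  independent of the angle \<open>t\<close>.\<close>

lemma powr_disc_mean_le:
  fixes g :: "complex \<Rightarrow> complex"
  assumes g: "g holomorphic_on UNIV" and q: "q > 1" and r: "r \<ge> 0"
  shows "ennreal (norm (g c) powr q * (pi * r\<^sup>2)) \<le>
    plane_integral (\<lambda>z. ennreal (norm (g (c + z)) powr q) * indicator (ball 0 r) z)"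
proof -
  define e where "e = (\<lambda>t::real. exp (2 * of_real pi * \<i> * of_real t))"
  define U where "U = (\<lambda>z. ennreal (norm (g (c + z)) powr q) * indicator (ball 0 r) z)"
  have cg: "continuous_on UNIV g" using g by (rule holomorphic_on_imp_continuous_on)
  have [measurable]: "g \<in> borel_measurable borel" by (rule borel_measurable_continuous_onI[OF cg])
  have [measurable]: "e \<in> borel_measurable borel" unfolding e_def
    by (intro borel_measurable_continuous_onI continuous_intros)
  have [measurable]: "ball 0 r \<in> sets (borel :: complex measure)" by simp
  have U[measurable]: "U \<in> borel_measurable borel" unfolding U_def by measurable
  have ne: "norm (e t) = 1" for t by (simp add: e_def norm_exp_eq_Re)
  have mean: "ennreal (norm (g c) powr q) * indicator (ball 0 r) z \<le>
      (\<integral>\<^sup>+t. U (e t * z) * indicator {0..1} t \<partial>lborel)" for z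
  proof -
    have "ennreal (norm ((\<lambda>w. g (c + w * z)) 0) powr q) \<le>
      (\<integral>\<^sup>+t. ennreal (norm ((\<lambda>w. g (c + w * z)) (exp (2 * of_real pi * \<i> * of_real t))) powr q) * indicator {0..1} t \<partial>lborel)"
      by (rule powr_circle_mean_le[OF holomorphic_on_compose_gen[OF _ g, unfolded o_def] q])
        (auto intro!: holomorphic_intros)
    then have "ennreal (norm (g c) powr q) * indicator (ball 0 r) z \<le>
      (\<integral>\<^sup>+t. ennreal (norm (g (c + e t * z)) powr q) * indicator {0..1} t \<partial>lborel) * indicator (ball 0 r) z"
      by (intro mult_right_mono) (auto simp: e_def)
    also have "\<dots> = (\<integral>\<^sup>+t. ennreal (norm (g (c + e t * z)) powr q) * indicator {0..1} t * indicator (ball 0 r) z \<partial>lborel)"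
      by (rule nn_integral_multc[symmetric]) measurable
    also have "\<dots> = (\<integral>\<^sup>+t. U (e t * z) * indicator {0..1} t \<partial>lborel)"
      by (intro nn_integral_cong) (simp add: U_def indicator_def norm_mult ne)
    finally show ?thesis .
  qed
  have "ennreal (norm (g c) powr q * (pi * r\<^sup>2)) =
      plane_integral (\<lambda>z. ennreal (norm (g c) powr q) * indicator (ball 0 r) z)"
    using r by (simp add: nn_integral_cmult plane_integral_ball ennreal_mult)
  also have "\<dots> \<le> plane_integral (\<lambda>z. \<integral>\<^sup>+t. U (e t * z) * indicator {0..1} t \<partial>lborel)"
    by (intro nn_integral_mono mean)
  also have "\<dots> = (\<integral>\<^sup>+y. (\<integral>\<^sup>+t. (\<integral>\<^sup>+x. U (e t * Complex x y) * indicator {0..1} t \<partial>lborel) \<partial>lborel) \<partial>lborel)"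
    by (intro nn_integral_cong lborel_pair.Fubini') measurable
  also have "\<dots> = (\<integral>\<^sup>+t. plane_integral (\<lambda>z. U (e t * z) * indicator {0..1} t) \<partial>lborel)"
    by (rule lborel_pair.Fubini') measurable
  also have "\<dots> = (\<integral>\<^sup>+t. plane_integral U * indicator {0..1::real} t \<partial>lborel)"
  proof (intro nn_integral_cong)
    fix t :: real
    have "plane_integral (\<lambda>z. U (e t * z) * indicator {0..1} t) = plane_integral (\<lambda>z. U (e t * z)) * indicator {0..1} t"
      by (simp add: nn_integral_multc)
    also have "plane_integral (\<lambda>z. U (e t * z)) = plane_integral U"
      by (rule plane_integral_rotate[OF U ne])
    finally show "plane_integral (\<lambda>z. U (e t * z) * indicator {0..1} t) = plane_integral U * indicator {0..1} t" .
  qed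
  also have "\<dots> = plane_integral U" by (subst nn_integral_cmult) auto
  finally show ?thesis unfolding U_def .
qed

lemma nn_integral_exp_abs_le:
  assumes k: "k > 0" and h: "h \<ge> 0"
  shows "(\<integral>\<^sup>+y. ennreal (exp (k * \<bar>y\<bar>)) * indicator {-h..h} y \<partial>lborel) \<le> ennreal (2 * (exp (k * h) - 1) / k)"
proof -
  have D: "((\<lambda>y. exp (k * y) / k) has_real_derivative exp (k * y)) (at y)" for y
    using k by (auto intro!: derivative_eq_intros)
  have h1: "(\<integral>\<^sup>+y. ennreal (exp (k * y)) * indicator {0..h} y \<partial>lborel) = ennreal (exp (k * h) / k - exp (k * 0) / k)"
    by (rule nn_integral_FTC_Icc) (use h in \<open>auto intro!: DERIV_subset[OF D]\<close>)
  have eq: "exp (k * h) / k - exp (k * 0) / k = (exp (k * h) - 1) / k" by (simp add: diff_divide_distrib)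
  have h2: "(\<integral>\<^sup>+y. ennreal (exp (- (k * y))) * indicator {-h..0} y \<partial>lborel) = (\<integral>\<^sup>+y. ennreal (exp (k * y)) * indicator {0..h} y \<partial>lborel)"
    by (subst nn_integral_real_affine[where c="-1" and t=0]) (auto simp: indicator_def intro!: nn_integral_cong)
  have "(\<integral>\<^sup>+y. ennreal (exp (k * \<bar>y\<bar>)) * indicator {-h..h} y \<partial>lborel) \<le>
      (\<integral>\<^sup>+y. ennreal (exp (- (k * y))) * indicator {-h..0} y + ennreal (exp (k * y)) * indicator {0..h} y \<partial>lborel)"
    by (intro nn_integral_mono) (auto simp: indicator_def)
  also have "\<dots> = ennreal ((exp (k * h) - 1) / k) + ennreal ((exp (k * h) - 1) / k)"
    by (subst nn_integral_add) (simp_all add: h1[unfolded eq] h2)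
  also have "\<dots> = ennreal (2 * (exp (k * h) - 1) / k)"
    using k h by (subst ennreal_plus[symmetric]) (auto simp: add_divide_distrib[symmetric])
  finally show ?thesis .
qed

text \<open>The discs of radius \<open>1/2\<close> about the points \<open>a + n\<close> sit in unit
  squares that tile the strip \<open>|Im z| \<le> 1/2\<close>. The constant is
  \<open>4 / pi\<close>, the reciprocal area of the disc, times the integral of
  \<open>exp (q pi |y|)\<close> over \<open>|y| \<le> 1/2\<close>, which is at most
  \<open>2 (exp (q pi / 2) - 1) / (q pi)\<close>. The arbitrary shift \<open>a\<close> is needed for
  \<open>bernstein_bounded\<close>.\<close>

lemma plancherel_polya_1d:
  fixes g :: "complex \<Rightarrow> complex"
  assumes g: "g holomorphic_on UNIV" and q: "q > 1"
    and gr: "\<And>\<epsilon>. \<epsilon> > 0 \<Longrightarrow> \<exists>A. \<forall>z. norm (g z) \<le> A * exp ((pi + \<epsilon>) * norm z)"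
  shows "(\<integral>\<^sup>+n. ennreal (norm (g (of_real (a + of_int n))) powr q) \<partial>count_space UNIV)
    \<le> ennreal (8 * (exp (q * pi / 2) - 1) / (q * pi\<^sup>2)) * (\<integral>\<^sup>+x. ennreal (norm (g (of_real x)) powr q) \<partial>lborel)"
    (is "?S \<le> _ * ?G")
proof -
  have [measurable]: "g \<in> borel_measurable borel" by (rule borel_measurable_holomorphic[OF g])
  \<comment> \<open>The squares are half-open in the real direction, so that their indicators add up
    to exactly 1 at every abscissa.\<close>
  define W where "W = (\<lambda>n z. ennreal (norm (g z) powr q) *
     (indicator {-(1/2)..<1/2} (Re z - (a + of_int n)) * indicator {-(1/2)..1/2} (Im z)) :: ennreal)"
  have [measurable]: "W n \<in> borel_measurable borel" for n :: int
    unfolding W_def by measurable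
  have pt: "ennreal (norm (g (of_real (a + of_int n))) powr q) \<le> ennreal (4 / pi) * plane_integral (W n)" for n :: int
  proof -
    let ?c = "a + of_int n"
    have "ennreal (norm (g (of_real ?c)) powr q) = ennreal (4 / pi) * ennreal (norm (g (of_real ?c)) powr q * (pi * (1 / 2)\<^sup>2))"
      by (subst ennreal_mult[symmetric]) (auto simp: power2_eq_square)
    also have "\<dots> \<le> ennreal (4 / pi) * plane_integral (\<lambda>z. ennreal (norm (g (of_real ?c + z)) powr q) * indicator (ball 0 (1/2)) z)"
      by (intro mult_left_mono powr_disc_mean_le[OF g q]) auto
    also have "\<dots> \<le> ennreal (4 / pi) * (\<integral>\<^sup>+y. (\<integral>\<^sup>+x. W n (Complex (x + ?c) y) \<partial>lborel) \<partial>lborel)"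
    proof (intro mult_left_mono nn_integral_mono)
      fix x y :: real
      have "of_real ?c + Complex x y = Complex (x + ?c) y" by (simp add: complex_eq_iff)
      moreover have "\<bar>x\<bar> < 1/2" "\<bar>y\<bar> < 1/2" if "norm (Complex x y) < 1/2"
        using that abs_Re_le_cmod[of "Complex x y"] abs_Im_le_cmod[of "Complex x y"] by auto
      ultimately show "ennreal (norm (g (of_real ?c + Complex x y)) powr q) * indicator (ball 0 (1/2)) (Complex x y)
          \<le> W n (Complex (x + ?c) y)"
        by (fastforce simp: W_def indicator_def)
    qed simp
    also have "(\<integral>\<^sup>+y. (\<integral>\<^sup>+x. W n (Complex (x + ?c) y) \<partial>lborel) \<partial>lborel) = plane_integral (W n)"
    proof (rule nn_integral_cong)
      fix y
      show "(\<integral>\<^sup>+x. W n (Complex (x + ?c) y) \<partial>lborel) = (\<integral>\<^sup>+x. W n (Complex x y) \<partial>lborel)"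
        by (rule nn_integral_translate_real) measurable
    qed
    finally show ?thesis .
  qed
  have one: "(\<integral>\<^sup>+n. indicator {-(1/2)..<1/2} (x - (a + of_int n)) \<partial>count_space UNIV) = (1::ennreal)" for x :: real
  proof -
    have "indicator {-(1/2)..<1/2} (x - (a + of_int n)) = (indicator {\<lfloor>x - a + 1/2\<rfloor>} n :: ennreal)" for n :: int
      by (auto simp: indicator_def floor_eq_iff) linarith+
    then show ?thesis by simp
  qed
  have "?S \<le> (\<integral>\<^sup>+n. ennreal (4 / pi) * plane_integral (W n) \<partial>count_space UNIV)"
    by (intro nn_integral_mono pt)
  also have "\<dots> = ennreal (4 / pi) * (\<integral>\<^sup>+n. plane_integral (W n) \<partial>count_space UNIV)"
    by (rule nn_integral_cmult) simp
  also have "(\<integral>\<^sup>+n. plane_integral (W n) \<partial>count_space UNIV)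
      = (\<integral>\<^sup>+y. (\<integral>\<^sup>+n. (\<integral>\<^sup>+x. W n (Complex x y) \<partial>lborel) \<partial>count_space UNIV) \<partial>lborel)"
    by (rule nn_integral_count_space_nn_integral[symmetric]) auto
  also have "\<dots> = plane_integral (\<lambda>z. \<integral>\<^sup>+n. W n z \<partial>count_space UNIV)"
    by (intro nn_integral_cong nn_integral_count_space_nn_integral[symmetric]) auto
  also have "\<dots> = (\<integral>\<^sup>+y. (\<integral>\<^sup>+x. ennreal (norm (g (Complex x y)) powr q) \<partial>lborel) * indicator {-(1/2)..1/2} y \<partial>lborel)"
    unfolding W_def by (simp add: nn_integral_cmult nn_integral_multc one mult.assoc[symmetric])
  also have "\<dots> \<le> (\<integral>\<^sup>+y. (ennreal (exp (q * pi * \<bar>y\<bar>)) * ?G) * indicator {-(1/2)..1/2} y \<partial>lborel)"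
    by (intro nn_integral_mono mult_right_mono nn_integral_strip_le[OF g _ q gr]) auto
  also have "\<dots> = (\<integral>\<^sup>+y. ennreal (exp (q * pi * \<bar>y\<bar>)) * indicator {-(1/2)..1/2} y \<partial>lborel) * ?G"
    by (subst nn_integral_multc[symmetric]) (auto simp: mult_ac)
  also have "\<dots> \<le> ennreal (2 * (exp (q * pi * (1/2)) - 1) / (q * pi)) * ?G"
    by (intro mult_right_mono nn_integral_exp_abs_le) (use q in auto)
  also have "ennreal (4 / pi) * (ennreal (2 * (exp (q * pi * (1/2)) - 1) / (q * pi)) * ?G)
      = ennreal (4 / pi * (2 * (exp (q * pi * (1/2)) - 1) / (q * pi))) * ?G"
    unfolding mult.assoc[symmetric] using q by (subst ennreal_mult) auto
  also have "4 / pi * (2 * (exp (q * pi * (1/2)) - 1) / (q * pi)) = 8 * (exp (q * pi / 2) - 1) / (q * pi\<^sup>2)"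
    by (simp add: power2_eq_square)
  finally show ?thesis by (simp add: mult_left_mono)
qed

section \<open>The Plancherel-Polya inequality in several variables\<close>

text \<open>Counting measure on \<open>a + Z\<close> is pushed to the Borel sets of the line, so
  that it lives on the same sigma-algebra as \<open>lborel\<close> and either measure can serve as a
  factor in a product over the coordinates.\<close>

definition count_coset :: "real \<Rightarrow> real measure" where
  "count_coset a = distr (count_space (UNIV :: int set)) borel (\<lambda>n. a + of_int n)"

lemma sets_count_coset [simp, measurable_cong]: "sets (count_coset a) = sets borel"
  by (simp add: count_coset_def)

lemma space_count_coset [simp]: "space (count_coset a) = UNIV"
  by (simp add: count_coset_def)

lemma nn_integral_count_coset:
  assumes [measurable]: "f \<in> borel_measurable borel"
  shows "(\<integral>\<^sup>+x. f x \<partial>count_coset a) = (\<integral>\<^sup>+n. f (a + of_int n) \<partial>count_space (UNIV :: int set))"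
  unfolding count_coset_def by (subst nn_integral_distr) auto

lemma emeasure_count_coset_singleton: "emeasure (count_coset a) {a + of_int n} = 1"
proof -
  have "(\<lambda>n. a + of_int n) -` {a + of_int n} \<inter> space (count_space (UNIV :: int set)) = {n}" by auto
  then show ?thesis unfolding count_coset_def by (subst emeasure_distr) auto
qed

lemma sigma_finite_count_coset: "sigma_finite_measure (count_coset a)"
proof
  define P where "P = range (\<lambda>n::int. a + of_int n)"
  have cP: "countable P" by (simp add: P_def)
  then have sP: "P \<in> sets borel" by (rule sets.countable[rotated]) auto
  have "emeasure (count_coset a) (- P) = 0"
    unfolding count_coset_def using sP by (subst emeasure_distr) (auto simp: P_def vimage_def)
  moreover have "emeasure (count_coset a) {x} = 1" if "x \<in> P" for x
    using that emeasure_count_coset_singleton by (auto simp: P_def)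
  ultimately show "\<exists>A. countable A \<and> A \<subseteq> sets (count_coset a) \<and> \<Union> A = space (count_coset a) \<and>
      (\<forall>a'\<in>A. emeasure (count_coset a) a' \<noteq> \<infinity>)"
    \<comment> \<open>A countable cover by sets of finite measure: the singletons of the coset and
      its complement, which is a null set.\<close>
    using cP sP by (intro exI[of _ "insert (- P) ((\<lambda>x. {x}) ` P)"]) auto
qed

lemma product_sigma_finite_count_coset: "product_sigma_finite (\<lambda>j. count_coset (a j))"
  by (simp add: product_sigma_finite_def sigma_finite_count_coset)

lemma product_sigma_finite_lborel: "product_sigma_finite (\<lambda>j. lborel :: real measure)"
  by (simp add: product_sigma_finite_def lborel.sigma_finite_measure_axioms)

lemma borel_measurable_PiM_cong:
  assumes "f \<in> PiM I (\<lambda>_. borel) \<rightarrow>\<^sub>M N" "\<And>i. sets (\<mu> i) = sets borel"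
  shows "f \<in> PiM I \<mu> \<rightarrow>\<^sub>M N"
proof -
  have "sets (PiM I \<mu>) = sets (PiM I (\<lambda>_. borel))" by (rule sets_PiM_cong) (auto simp: assms(2))
  then show ?thesis using assms(1) measurable_cong_sets by blast
qed

text \<open>The factors \<open>\<mu> i\<close> are exchanged for \<open>\<nu> i\<close> one at a
  time, each at the cost of one \<open>B\<close>. The hypothesis therefore speaks of a single
  coordinate with all others frozen at arbitrary values.\<close>

lemma nn_integral_PiM_le:
  fixes \<mu> \<nu> :: "'i \<Rightarrow> real measure" and h :: "('i \<Rightarrow> real) \<Rightarrow> ennreal"
  assumes "finite I" and psf: "product_sigma_finite \<mu>" "product_sigma_finite \<nu>"
    and sets: "\<And>i. sets (\<mu> i) = sets borel" "\<And>i. sets (\<nu> i) = sets borel"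
    and h: "h \<in> borel_measurable (PiM I (\<lambda>_. borel))"
    and le: "\<And>i x. i \<in> I \<Longrightarrow> (\<integral>\<^sup>+y. h (x(i := y)) \<partial>\<mu> i) \<le> B * (\<integral>\<^sup>+y. h (x(i := y)) \<partial>\<nu> i)"
  shows "(\<integral>\<^sup>+t. h t \<partial>PiM I \<mu>) \<le> B ^ card I * (\<integral>\<^sup>+t. h t \<partial>PiM I \<nu>)"
  using \<open>finite I\<close> h le
proof (induction I arbitrary: h rule: finite_induct)
  case empty
  then show ?case by (simp add: PiM_empty)
next
  case (insert i I)
  interpret \<mu>: product_sigma_finite \<mu> by (rule psf)
  interpret \<nu>: product_sigma_finite \<nu> by (rule psf)
  interpret I: finite_product_sigma_finite \<mu> I by standard fact
  interpret P: pair_sigma_finite "PiM I \<mu>" "\<nu> i"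
    by (intro pair_sigma_finite.intro I.sigma_finite_measure_axioms \<nu>.sigma_finite_measures)
  note [measurable_cong] = sets
  note [measurable] = insert.prems(1)
  have m\<mu>: "h \<in> borel_measurable (PiM (insert i I) \<mu>)" and m\<nu>: "h \<in> borel_measurable (PiM (insert i I) \<nu>)"
    by (rule borel_measurable_PiM_cong[OF insert.prems(1)], simp add: sets)+
  have hy: "(\<lambda>x. h (x(i := y))) \<in> borel_measurable (PiM I (\<lambda>_. borel))" for y
    by measurable
  have IH: "(\<integral>\<^sup>+x. h (x(i := y)) \<partial>PiM I \<mu>) \<le> B ^ card I * (\<integral>\<^sup>+x. h (x(i := y)) \<partial>PiM I \<nu>)" for y
  proof (rule insert.IH[OF hy])
    fix j x assume j: "j \<in> I"
    then have "j \<noteq> i" using insert by auto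
    then have eq: "(x(j := z))(i := y) = (x(i := y))(j := z)" for z by auto
    show "(\<integral>\<^sup>+z. h ((x(j := z))(i := y)) \<partial>\<mu> j) \<le> B * (\<integral>\<^sup>+z. h ((x(j := z))(i := y)) \<partial>\<nu> j)"
      unfolding eq by (rule insert.prems(2)) (use j in simp)
  qed
  have "(\<integral>\<^sup>+t. h t \<partial>PiM (insert i I) \<mu>) = (\<integral>\<^sup>+x. (\<integral>\<^sup>+y. h (x(i := y)) \<partial>\<mu> i) \<partial>PiM I \<mu>)"
    by (rule \<mu>.product_nn_integral_insert[OF insert.hyps(1,2) m\<mu>])
  also have "\<dots> \<le> (\<integral>\<^sup>+x. B * (\<integral>\<^sup>+y. h (x(i := y)) \<partial>\<nu> i) \<partial>PiM I \<mu>)"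
    by (intro nn_integral_mono insert.prems(2)) simp
  also have "\<dots> = B * (\<integral>\<^sup>+x. (\<integral>\<^sup>+y. h (x(i := y)) \<partial>\<nu> i) \<partial>PiM I \<mu>)"
    by (rule nn_integral_cmult) measurable
  \<comment> \<open>Coordinate \<open>i\<close> already carries \<open>\<nu> i\<close>. Moving it
    outside leaves an integral over \<open>PiM I \<mu>\<close> for each fixed \<open>y\<close>, to
    which the induction hypothesis applies.\<close>
  also have "\<dots> = B * (\<integral>\<^sup>+y. (\<integral>\<^sup>+x. h (x(i := y)) \<partial>PiM I \<mu>) \<partial>\<nu> i)"
    by (intro arg_cong[where f="\<lambda>x. B * x"] P.Fubini'[symmetric]) measurable
  also have "\<dots> \<le> B * (\<integral>\<^sup>+y. B ^ card I * (\<integral>\<^sup>+x. h (x(i := y)) \<partial>PiM I \<nu>) \<partial>\<nu> i)"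
    by (intro mult_left_mono nn_integral_mono IH) auto
  also have "\<dots> = B * (B ^ card I * (\<integral>\<^sup>+y. (\<integral>\<^sup>+x. h (x(i := y)) \<partial>PiM I \<nu>) \<partial>\<nu> i))"
  proof -
    interpret I': finite_product_sigma_finite \<nu> I by standard fact
    show ?thesis
      by (intro arg_cong[where f="\<lambda>x. B * x"] nn_integral_cmult) measurable
  qed
  also have "\<dots> = B ^ card (insert i I) * (\<integral>\<^sup>+t. h t \<partial>PiM (insert i I) \<nu>)"
    using insert.hyps by (simp add: \<nu>.product_nn_integral_insert_rev[OF insert.hyps(1,2) m\<nu>] mult.assoc)
  finally show ?case .
qed

lemma measurable_vec_lambda:
  "(\<lambda>t. \<chi> j. t j) \<in> (PiM UNIV (\<lambda>_::'n::finite. borel :: real measure)) \<rightarrow>\<^sub>M (borel :: (real ^ 'n) measure)"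
proof (rule borel_measurable_euclidean_space[THEN iffD2], rule ballI)
  fix b :: "real ^ 'n" assume "b \<in> Basis"
  then obtain i where "b = axis i 1" by (auto simp: Basis_vec_def)
  then show "(\<lambda>t. (\<chi> j. t j) \<bullet> b) \<in> borel_measurable (PiM UNIV (\<lambda>_::'n. borel :: real measure))"
    by (simp add: inner_axis)
qed

lemma lborel_vec:
  "(lborel :: (real ^ 'n) measure) = distr (PiM UNIV (\<lambda>_::'n::finite. lborel)) borel (\<lambda>t. \<chi> j. t j)"
proof (rule lborel_eqI)
  fix l u :: "real ^ 'n"
  assume le: "\<And>b. b \<in> Basis \<Longrightarrow> l \<bullet> b \<le> u \<bullet> b"
  interpret product_sigma_finite "\<lambda>_::'n. lborel :: real measure" by (rule product_sigma_finite_lborel)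
  have le': "l $ j \<le> u $ j" for j using le[of "axis j 1"] by (simp add: inner_axis)
  have m: "(\<lambda>t. \<chi> j. t j) \<in> PiM UNIV (\<lambda>_::'n. lborel :: real measure) \<rightarrow>\<^sub>M (borel :: (real ^ 'n) measure)"
    by (rule borel_measurable_PiM_cong[OF measurable_vec_lambda]) simp
  have "(\<lambda>t. \<chi> j. t j) -` box l u \<inter> space (PiM UNIV (\<lambda>_::'n. lborel)) = PiE UNIV (\<lambda>j. {l$j<..<u$j})"
    by (auto simp: mem_box_cart space_PiM PiE_iff)
  then have "emeasure (distr (PiM UNIV (\<lambda>_::'n. lborel)) borel (\<lambda>t. \<chi> j. t j)) (box l u)
      = (\<Prod>j\<in>UNIV. emeasure lborel {l$j<..<u$j})"
    by (subst emeasure_distr[OF m]) (auto simp: emeasure_PiM)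
  also have "\<dots> = ennreal (\<Prod>j\<in>UNIV. u$j - l$j)"
    using le' by (simp add: prod_ennreal)
  also have "(\<Prod>j\<in>UNIV. u$j - l$j) = (\<Prod>b\<in>Basis. (u - l) \<bullet> b)"
    by (simp add: Basis_vec_def cart_eq_inner_axis axis_eq_axis prod.UNION_disjoint inner_diff_left)
  finally show "emeasure (distr (PiM UNIV (\<lambda>_::'n. lborel)) borel (\<lambda>t. \<chi> j. t j)) (box l u)
      = (\<Prod>b\<in>Basis. (u - l) \<bullet> b)" .
qed simp

section \<open>Real points, slices and the passage to several variables\<close>

definition cvec :: "('n \<Rightarrow> real) \<Rightarrow> complex ^ 'n" where
  "cvec t = (\<chi> j. complex_of_real (t j))"

lemma borel_measurable_real_restr:
  assumes "entire_multi f"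
  shows "real_restr f \<in> borel_measurable borel"
proof (rule borel_measurable_continuous_onI)
  show "continuous_on UNIV (real_restr f)" unfolding real_restr_def
    by (rule continuous_on_compose2[of UNIV f]) (use assms in \<open>auto simp: entire_multi_def intro!: continuous_intros\<close>)
qed

lemma measurable_cvec:
  assumes f: "entire_multi (f :: complex ^ 'n \<Rightarrow> complex)"
  shows "(\<lambda>t. f (cvec t)) \<in> borel_measurable (PiM UNIV (\<lambda>_. borel))"
  using measurable_compose[OF measurable_vec_lambda borel_measurable_real_restr[OF f]]
  by (simp add: real_restr_def cvec_def)

lemma Lq_integral_PiM:
  assumes f: "entire_multi (f :: complex ^ 'n \<Rightarrow> complex)"
  shows "Lq_integral q (real_restr f) = (\<integral>\<^sup>+t. ennreal (norm (f (cvec t)) powr q) \<partial>PiM UNIV (\<lambda>_. lborel))"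
proof -
  have m: "(\<lambda>t. \<chi> j. t j) \<in> PiM UNIV (\<lambda>_::'n. lborel :: real measure) \<rightarrow>\<^sub>M (borel :: (real ^ 'n) measure)"
    by (rule borel_measurable_PiM_cong[OF measurable_vec_lambda]) simp
  note [measurable] = borel_measurable_real_restr[OF f]
  show ?thesis unfolding Lq_integral_def
    by (subst lborel_vec, subst nn_integral_distr[OF m], measurable) (simp add: real_restr_def cvec_def)
qed

definition slice :: "(complex ^ 'n \<Rightarrow> complex) \<Rightarrow> ('n \<Rightarrow> real) \<Rightarrow> 'n \<Rightarrow> complex \<Rightarrow> complex" where
  "slice f x j w = f (\<chi> k. if k = j then w else complex_of_real (x k))"

lemma slice_of_real: "slice f x j (of_real y) = f (cvec (x(j := y)))"
  unfolding slice_def cvec_def by (rule arg_cong[where f=f]) (simp add: vec_eq_iff)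

lemma holomorphic_slice:
  assumes "entire_multi f"
  shows "slice f x j holomorphic_on UNIV"
proof -
  have "(\<lambda>w. f (\<chi> k. if k = j then w else cvec x $ k)) holomorphic_on UNIV"
    using assms by (auto simp: entire_multi_def)
  then show ?thesis by (simp add: slice_def[abs_def] cvec_def cong: if_cong)
qed

lemma exp_type_slice:
  assumes f: "exp_type_le \<sigma> f" and e: "\<epsilon> > 0"
  shows "\<exists>A. \<forall>w. norm (slice f x j w) \<le> A * exp ((\<sigma> + \<epsilon>) * norm w)"
proof -
  obtain A where A: "\<And>z. norm (f z) \<le> A * exp (\<Sum>j\<in>UNIV. (\<sigma> + \<epsilon>) * norm (z $ j))"
    using f e by (auto simp: exp_type_le_def)
  have "norm (slice f x j w) \<le> (A * exp (\<Sum>k\<in>UNIV - {j}. (\<sigma> + \<epsilon>) * \<bar>x k\<bar>)) * exp ((\<sigma> + \<epsilon>) * norm w)" for w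
  proof -
    have "(\<Sum>k\<in>UNIV. (\<sigma> + \<epsilon>) * norm ((\<chi> k. if k = j then w else complex_of_real (x k)) $ k))
      = (\<sigma> + \<epsilon>) * norm w + (\<Sum>k\<in>UNIV - {j}. (\<sigma> + \<epsilon>) * \<bar>x k\<bar>)"
      by (subst sum.remove[of _ j]) (auto intro!: sum.cong)
    then show ?thesis
      using A[of "\<chi> k. if k = j then w else complex_of_real (x k)"] by (simp add: slice_def exp_add mult_ac)
  qed
  then show ?thesis by blast
qed

lemma plancherel_polya:
  fixes f :: "complex ^ 'n \<Rightarrow> complex"
  assumes f: "entire_multi f" "exp_type_le pi f" and q: "q > 1"
  shows "(\<integral>\<^sup>+t. ennreal (norm (f (cvec t)) powr q) \<partial>PiM UNIV (\<lambda>j. count_coset (a j)))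
    \<le> ennreal (frakB CARD('n) q) * Lq_integral q (real_restr f)"
proof -
  let ?B = "8 * (exp (q * pi / 2) - 1) / (q * pi\<^sup>2)"
  note [measurable] = measurable_cvec[OF f(1)]
  have "(\<integral>\<^sup>+t. ennreal (norm (f (cvec t)) powr q) \<partial>PiM UNIV (\<lambda>j. count_coset (a j)))
    \<le> ennreal ?B ^ CARD('n) * (\<integral>\<^sup>+t. ennreal (norm (f (cvec t)) powr q) \<partial>PiM UNIV (\<lambda>j. lborel))"
  proof (rule nn_integral_PiM_le[OF _ product_sigma_finite_count_coset product_sigma_finite_lborel])
    fix i x
    have c: "continuous_on UNIV (slice f x i)"
      by (rule holomorphic_on_imp_continuous_on[OF holomorphic_slice[OF f(1)]])
    have [measurable]: "slice f x i \<in> borel_measurable borel" by (rule borel_measurable_continuous_onI[OF c])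
    have "(\<integral>\<^sup>+y. ennreal (norm (slice f x i (of_real y)) powr q) \<partial>count_coset (a i))
      \<le> ennreal ?B * (\<integral>\<^sup>+y. ennreal (norm (slice f x i (of_real y)) powr q) \<partial>lborel)"
      by (subst nn_integral_count_coset, measurable)
        (rule plancherel_polya_1d[OF holomorphic_slice[OF f(1)] q exp_type_slice[OF f(2)]])
    then show "(\<integral>\<^sup>+y. ennreal (norm (f (cvec (x(i := y)))) powr q) \<partial>count_coset (a i))
      \<le> ennreal ?B * (\<integral>\<^sup>+y. ennreal (norm (f (cvec (x(i := y)))) powr q) \<partial>lborel)"
      by (simp add: slice_of_real)
  qed auto
  moreover have "?B \<ge> 0" using q by auto
  ultimately show ?thesis by (simp add: Lq_integral_PiM[OF f(1)] frakB_def ennreal_power)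
qed

text \<open>The point \<open>x\<close> belongs to the lattice coset through \<open>x\<close>, where
  it has mass 1. Thus \<open>|f x|^q\<close> is at most the Plancherel-Polya sum over that coset,
  whose bound does not depend on the coset.\<close>

lemma bernstein_bounded:
  fixes f :: "complex ^ 'n \<Rightarrow> complex"
  assumes f: "entire_multi f" "exp_type_le pi f" "Lq_integral q (real_restr f) < \<infinity>" and q: "q > 1"
  obtains M where "M \<ge> 0" "\<And>x. norm (f (cvec x)) \<le> M"
proof -
  let ?C = "ennreal (frakB CARD('n) q) * Lq_integral q (real_restr f)"
  have "?C < \<infinity>" using f(3) by (simp add: ennreal_mult_less_top)
  then obtain C where C: "?C = ennreal C" "C \<ge> 0" by (cases ?C rule: ennreal_cases) auto
  have "norm (f (cvec x)) \<le> C powr (1 / q)" for x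
  proof -
    interpret product_sigma_finite "\<lambda>j. count_coset (x j)" by (rule product_sigma_finite_count_coset)
    have eq: "{x} = PiE UNIV (\<lambda>j. {x j})" by (auto simp: fun_eq_iff)
    have s: "{x} \<in> sets (PiM UNIV (\<lambda>j. count_coset (x j)))" unfolding eq by (rule sets_PiM_I_finite) auto
    have e: "emeasure (PiM UNIV (\<lambda>j. count_coset (x j))) {x} = 1"
      unfolding eq by (subst emeasure_PiM) (use emeasure_count_coset_singleton[of "x j" 0 for j] in auto)
    have "ennreal (norm (f (cvec x)) powr q)
        = (\<integral>\<^sup>+t. ennreal (norm (f (cvec x)) powr q) * indicator {x} t \<partial>PiM UNIV (\<lambda>j. count_coset (x j)))"
      using s e by (simp add: nn_integral_cmult_indicator)
    also have "\<dots> \<le> (\<integral>\<^sup>+t. ennreal (norm (f (cvec t)) powr q) \<partial>PiM UNIV (\<lambda>j. count_coset (x j)))"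
      by (intro nn_integral_mono) (auto simp: indicator_def)
    also have "\<dots> \<le> ennreal C" using plancherel_polya[OF f(1,2) q, of x] C by simp
    finally have "norm (f (cvec x)) powr q \<le> C" using C by simp
    then have "(norm (f (cvec x)) powr q) powr (1 / q) \<le> C powr (1 / q)" using q by (intro powr_mono2) auto
    then show ?thesis using q by (simp add: powr_powr)
  qed
  then show ?thesis using that[of "C powr (1 / q)"] by auto
qed

lemma slice_bound:
  fixes f :: "complex ^ 'n \<Rightarrow> complex"
  assumes f: "entire_multi f" "exp_type_le \<sigma> f" and M: "M \<ge> 0" "\<And>x. norm (f (cvec x)) \<le> M" and s: "\<sigma> \<ge> 0"
  shows "norm (slice f x j w) \<le> M * exp (\<sigma> * \<bar>Im w\<bar>)"
  by (rule exponential_type_bound[OF holomorphic_slice[OF f(1)] M(1) s exp_type_slice[OF f(2)]])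
    (auto simp: slice_of_real M)

section \<open>Dilations\<close>

definition dilate :: "real \<Rightarrow> (complex ^ 'n \<Rightarrow> complex) \<Rightarrow> complex ^ 'n \<Rightarrow> complex" where
  "dilate c f z = f (\<chi> j. of_real c * z $ j)"

lemma dilate_cvec: "dilate c f (cvec t) = f (cvec (\<lambda>j. c * t j))"
  unfolding dilate_def cvec_def by (rule arg_cong[where f=f]) (simp add: vec_eq_iff)

lemma entire_multi_dilate:
  assumes "entire_multi f"
  shows "entire_multi (dilate c f)"
  unfolding entire_multi_def
proof (intro conjI allI)
  show "continuous_on UNIV (dilate c f)" unfolding dilate_def
    by (rule continuous_on_compose2[of UNIV f]) (use assms in \<open>auto simp: entire_multi_def intro!: continuous_intros\<close>)
  fix z j
  have "(\<lambda>w. f (\<chi> k. if k = j then w else (\<chi> k. of_real c * z $ k) $ k)) holomorphic_on UNIV"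
    using assms by (auto simp: entire_multi_def)
  then have "(\<lambda>w. f (\<chi> k. if k = j then of_real c * w else (\<chi> k. of_real c * z $ k) $ k)) holomorphic_on UNIV"
    by (rule holomorphic_on_compose_gen[unfolded o_def, rotated]) (auto intro!: holomorphic_intros)
  moreover have "dilate c f (\<chi> k. if k = j then w else z $ k) = f (\<chi> k. if k = j then of_real c * w else (\<chi> k. of_real c * z $ k) $ k)" for w
    unfolding dilate_def by (rule arg_cong[where f=f]) (simp add: vec_eq_iff)
  ultimately show "(\<lambda>w. dilate c f (\<chi> k. if k = j then w else z $ k)) holomorphic_on UNIV"
    by simp
qed

lemma exp_type_dilate:
  assumes f: "exp_type_le \<sigma> f" and c: "c > 0" "c * \<sigma> \<le> \<tau>"
  shows "exp_type_le \<tau> (dilate c f)"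
  unfolding exp_type_le_def
proof (intro allI impI)
  fix \<epsilon> :: real assume "\<epsilon> > 0"
  then have "\<epsilon> / c > 0" using c by simp
  then obtain A where A: "\<And>z. norm (f z) \<le> A * exp (\<Sum>j\<in>UNIV. (\<sigma> + \<epsilon> / c) * norm (z $ j))"
    using f unfolding exp_type_le_def by blast
  have A0: "A \<ge> 0" using order_trans[OF norm_ge_zero A[of 0]] by simp
  have "norm (dilate c f z) \<le> A * exp (\<Sum>j\<in>UNIV. (\<tau> + \<epsilon>) * norm (z $ j))" for z
  proof -
    have "(\<sigma> + \<epsilon> / c) * norm ((\<chi> j. of_real c * z $ j) $ j) \<le> (\<tau> + \<epsilon>) * norm (z $ j)" for j
    proof -
      have "(\<sigma> + \<epsilon> / c) * norm ((\<chi> j. of_real c * z $ j) $ j) = (c * \<sigma> + \<epsilon>) * norm (z $ j)"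
        using c by (simp add: norm_mult field_simps)
      then show ?thesis using c by (simp add: mult_right_mono)
    qed
    then show ?thesis unfolding dilate_def using A0
      by (intro order_trans[OF A] mult_left_mono) (auto intro!: sum_mono)
  qed
  then show "\<exists>A. \<forall>z. norm (dilate c f z) \<le> A * exp (\<Sum>j\<in>UNIV. (\<tau> + \<epsilon>) * norm (z $ j))" by blast
qed

lemma Lq_integral_dilate:
  fixes f :: "complex ^ 'n \<Rightarrow> complex"
  assumes f: "entire_multi f" and c: "c > 0"
  shows "Lq_integral q (real_restr (dilate c f)) = ennreal (1 / c ^ CARD('n)) * Lq_integral q (real_restr f)"
proof -
  note [measurable] = borel_measurable_real_restr[OF f] borel_measurable_real_restr[OF entire_multi_dilate[OF f]]
  have eq: "real_restr (dilate c f) ((1 / c) *\<^sub>R x) = real_restr f x" for x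
    unfolding real_restr_def dilate_def by (rule arg_cong[where f=f]) (use c in \<open>simp add: vec_eq_iff\<close>)
  have "Lq_integral q (real_restr (dilate c f)) = (\<integral>\<^sup>+ x. ennreal (norm (real_restr (dilate c f) x) powr q)
      \<partial>density (distr lborel borel (\<lambda>x. 0 + (1 / c) *\<^sub>R x)) (\<lambda>_. ennreal (\<bar>1 / c\<bar> ^ DIM(real ^ 'n))))"
    unfolding Lq_integral_def using c by (subst lborel_affine[of "1 / c" 0]) auto
  also have "\<dots> = ennreal (1 / c ^ CARD('n)) * Lq_integral q (real_restr f)"
    using c by (simp add: nn_integral_density nn_integral_distr nn_integral_cmult Lq_integral_def eq power_one_over)
  finally show ?thesis .
qed

section \<open>Cardinal series on the line\<close>

lemma contour_integral_rectpath_bound: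
  assumes c: "continuous_on (path_image (rectpath a b)) f"
    and B: "B \<ge> 0" "\<And>z. z \<in> path_image (rectpath a b) \<Longrightarrow> norm (f z) \<le> B"
    and ab: "Re a \<le> Re b" "Im a \<le> Im b"
  shows "norm (contour_integral (rectpath a b) f) \<le> B * (2 * (Re b - Re a) + 2 * (Im b - Im a))"
proof -
  define a2 a4 where "a2 = Complex (Re b) (Im a)" "a4 = Complex (Re a) (Im b)"
  have pi: "path_image (rectpath a b) = closed_segment a a2 \<union> (closed_segment a2 b \<union> (closed_segment b a4 \<union> closed_segment a4 a))"
    unfolding rectpath_def Let_def a2_a4_def[symmetric] by (simp add: path_image_join)
  have i: "f contour_integrable_on linepath a a2" "f contour_integrable_on linepath a2 b"
    "f contour_integrable_on linepath b a4" "f contour_integrable_on linepath a4 a"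
    by (rule contour_integrable_continuous_linepath, rule continuous_on_subset[OF c], auto simp: pi)+
  have e: "contour_integral (rectpath a b) f = contour_integral (linepath a a2) f + (contour_integral (linepath a2 b) f
      + (contour_integral (linepath b a4) f + contour_integral (linepath a4 a) f))"
    unfolding rectpath_def Let_def a2_a4_def[symmetric]
    using i by (simp add: valid_path_join contour_integrable_join)
  have n: "norm (contour_integral (linepath a a2) f) \<le> B * norm (a2 - a)"
    "norm (contour_integral (linepath a2 b) f) \<le> B * norm (b - a2)"
    "norm (contour_integral (linepath b a4) f) \<le> B * norm (a4 - b)"
    "norm (contour_integral (linepath a4 a) f) \<le> B * norm (a - a4)"
    by (rule contour_integral_bound_linepath[OF _ B(1)], rule i, rule B(2), simp add: pi)+
  have l: "norm (a2 - a) = Re b - Re a" "norm (b - a2) = Im b - Im a"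
    "norm (a4 - b) = Re b - Re a" "norm (a - a4) = Im b - Im a"
    using ab by (auto simp: a2_a4_def cmod_def)
  have "norm (contour_integral (rectpath a b) f) \<le> norm (contour_integral (linepath a a2) f) + (norm (contour_integral (linepath a2 b) f)
      + (norm (contour_integral (linepath b a4) f) + norm (contour_integral (linepath a4 a) f)))"
    unfolding e by (intro norm_triangle_le add_left_mono order_refl)
  also have "\<dots> \<le> B * (Re b - Re a) + (B * (Im b - Im a) + (B * (Re b - Re a) + B * (Im b - Im a)))"
    using n unfolding l by (intro add_mono)
  finally show ?thesis by (simp add: algebra_simps)
qed

lemma sin_pi_mult_eq_0: "sin (of_real pi * w) = 0 \<longleftrightarrow> (\<exists>n. w = of_int n)" for w :: complex
proof -
  have "of_real pi * w = of_real (of_int n * pi) \<longleftrightarrow> w = of_int n" for n :: int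
    by (simp add: mult.commute)
  then show ?thesis by (simp add: sin_eq_0)
qed

text \<open>Since \<open>4 |sin z|^2 = e^(2 y) + e^(- 2 y) - 2 cos (2 x)\<close>, smallness can come
  only from the cosine. The two alternatives are those met on the sides of the square contour:
  \<open>cos (2 x) = -1\<close> on the vertical ones, large \<open>|y|\<close> on the horizontal
  ones.\<close>

lemma norm_sin_ge_exp:
  assumes z: "cos (2 * Re z) = -1 \<or> \<bar>Im z\<bar> \<ge> 1"
  shows "norm (sin z) \<ge> exp \<bar>Im z\<bar> / 4"
proof (rule power2_le_imp_le)
  let ?s = "exp (2 * Im z) + inverse (exp (2 * Im z))"
  have e: "(exp \<bar>Im z\<bar>)\<^sup>2 \<le> ?s"
    by (cases "Im z \<ge> 0") (auto simp: exp_double[symmetric] exp_minus[symmetric])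
  have "1 + 2 * \<bar>Im z\<bar> \<le> (exp \<bar>Im z\<bar>)\<^sup>2" using exp_ge_add_one_self[of "2 * \<bar>Im z\<bar>"] by (simp add: exp_double)
  moreover have "cos (2 * Re z) \<le> 1" by simp
  moreover have "e / 16 \<le> (s - 2 * c) / 4"
    if "1 + 2 * t \<le> e" "c \<le> 1" "e \<le> s" "c = -1 \<or> t \<ge> 1" "t \<ge> 0" for c e s t :: real
    using that by auto
  ultimately have "(exp \<bar>Im z\<bar>)\<^sup>2 / 16 \<le> (?s - 2 * cos (2 * Re z)) / 4" using e z by (meson abs_ge_zero)
  then show "(exp \<bar>Im z\<bar> / 4)\<^sup>2 \<le> (norm (sin z))\<^sup>2" unfolding norm_sin_squared by (simp add: power_divide)
qed simp

text \<open>The terms of the series are the residues of \<open>h(w) / (sin (\<pi> w) (w - x))\<close>.\<close>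
lemma sampling_residue_sum:
  fixes h :: "complex \<Rightarrow> complex" and x :: real
  assumes h: "h holomorphic_on UNIV" and x: "x \<notin> \<int>" and m: "\<bar>x\<bar> < real m + 1/2"
    and a: "a = Complex (- (real m + 1/2)) (- (real m + 1/2))" and b: "b = Complex (real m + 1/2) (real m + 1/2)"
  shows "contour_integral (rectpath a b) (\<lambda>w. h w / (sin (of_real pi * w) * (w - of_real x))) * of_real (sin (pi * x))
    = 2 * of_real pi * \<i> * (h (of_real x) - (\<Sum>n = - int m..int m. h (of_int n) * of_real (sinc (x - of_int n))))"
proof -
  let ?R = "\<lambda>n::int. h (of_int n) / (of_real pi * of_real (cos (pi * of_int n)) * (of_int n - of_real x))"
  define \<phi> where "\<phi> = (\<lambda>w. h w / (sin (of_real pi * w) * (w - of_real x)))"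
  \<comment> \<open>The half-side \<open>m + 1\<close> leaves room around the contour of half-side
    \<open>m + 1/2\<close>, while the open square still contains no integers beyond
    \<open>- m, ..., m\<close>.\<close>
  define S where "S = box (Complex (- (real m + 1)) (- (real m + 1))) (Complex (real m + 1) (real m + 1))"
  define Z where "Z = (of_int ` {- int m..int m} :: complex set)"
  define pts where "pts = insert (of_real x) Z"
  have xn: "complex_of_real x \<noteq> of_int n" for n
    using x by (metis Ints_of_int of_real_eq_iff of_real_of_int_eq)
  have x0: "complex_of_real x \<notin> Z" using xn by (auto simp: Z_def)
  have s0: "sin (complex_of_real pi * of_real x) \<noteq> 0"
    using xn by (auto simp: sin_pi_mult_eq_0)
  have hol: "\<phi> holomorphic_on S - pts"
    unfolding \<phi>_def
  proof (intro holomorphic_intros holomorphic_on_subset[OF h])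
    fix w assume w: "w \<in> S - pts"
    have "sin (of_real pi * w) \<noteq> 0"
    proof
      assume "sin (of_real pi * w) = 0"
      then obtain n where n: "w = of_int n" using sin_pi_mult_eq_0 by blast
      have "\<bar>of_int n\<bar> < real m + 1" using w by (auto simp: S_def in_box_complex_iff n)
      then have "n \<in> {- int m..int m}" by auto
      then show False using w n by (auto simp: pts_def Z_def)
    qed
    then show "sin (complex_of_real pi * w) * (w - complex_of_real x) \<noteq> 0"
      using w by (auto simp: pts_def)
  qed auto
  have sub: "pts \<subseteq> box a b"
  proof -
    have "of_int n \<in> box a b" if "n \<in> {- int m..int m}" for n :: int
    proof -
      have "\<bar>real_of_int n\<bar> \<le> real m" using that by auto
      then show ?thesis by (auto simp: in_box_complex_iff a b)
    qed
    moreover have "complex_of_real x \<in> box a b" using m by (auto simp: in_box_complex_iff a b)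
    ultimately show ?thesis by (auto simp: pts_def Z_def)
  qed
  have "contour_integral (rectpath a b) \<phi> = 2 * pi * \<i> * (\<Sum>p\<in>pts. winding_number (rectpath a b) p * residue \<phi> p)"
  proof (rule Residue_theorem[where S=S])
    show "path_image (rectpath a b) \<subseteq> S - pts"
    proof -
      have "path_image (rectpath a b) = cbox a b - box a b"
        by (rule path_image_rectpath_cbox_minus_box) (auto simp: a b)
      moreover have "cbox a b \<subseteq> S" by (auto simp: S_def a b in_box_complex_iff in_cbox_complex_iff)
      ultimately show ?thesis using sub by auto
    qed
    show "\<forall>z. z \<notin> S \<longrightarrow> winding_number (rectpath a b) z = 0"
    proof (intro allI impI winding_number_rectpath_outside)
      fix z assume "z \<notin> S"
      then show "z \<notin> cbox a b" by (auto simp: S_def a b in_box_complex_iff in_cbox_complex_iff)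
    qed (auto simp: a b)
    show "connected S" unfolding S_def by (intro convex_connected convex_box)
  qed (use hol in \<open>auto simp: S_def pts_def Z_def\<close>)
  also have "(\<Sum>p\<in>pts. winding_number (rectpath a b) p * residue \<phi> p) = (\<Sum>p\<in>pts. residue \<phi> p)"
    using sub by (intro sum.cong) (auto simp: winding_number_rectpath)
  also have "\<dots> = residue \<phi> (of_real x) + (\<Sum>p\<in>Z. residue \<phi> p)"
    unfolding pts_def using x0 by (subst sum.insert) (auto simp: Z_def)
  also have "(\<Sum>p\<in>Z. residue \<phi> p) = (\<Sum>n = - int m..int m. residue \<phi> (of_int n))"
    unfolding Z_def by (subst sum.reindex) (auto simp: inj_on_def)
  also have "residue \<phi> (of_real x) = h (of_real x) / sin (of_real pi * of_real x)"
  proof -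
    have o: "open {w. sin (complex_of_real pi * w) \<noteq> 0}"
      by (intro open_Collect_neq continuous_intros)
    have "residue (\<lambda>w. (h w / sin (of_real pi * w)) / (w - of_real x)) (of_real x) = h (of_real x) / sin (of_real pi * of_real x)"
      by (rule residue_simple[OF o]) (use s0 in \<open>auto intro!: holomorphic_intros holomorphic_on_subset[OF h]\<close>)
    then show ?thesis by (simp add: \<phi>_def)
  qed
  also have "(\<Sum>n = - int m..int m. residue \<phi> (of_int n))
      = (\<Sum>n = - int m..int m. ?R n)"
  proof (rule sum.cong[OF refl])
    fix n :: int
    \<comment> \<open>This radius excludes from the ball both the other integers and
      \<open>x\<close>, leaving the simple pole at \<open>n\<close>.\<close>
    define r where "r = min 1 (norm (of_int n - complex_of_real x))"
    have r: "r > 0" using xn[of n] by (auto simp: r_def)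
    have cn: "cos (complex_of_real pi * of_int n) = of_real (cos (pi * of_int n))"
      by (metis cos_of_real of_real_mult of_real_of_int_eq)
    show "residue \<phi> (of_int n) = ?R n"
    proof (rule residue_simple'[of "ball (of_int n) r"])
      show "\<phi> holomorphic_on ball (of_int n) r - {of_int n}"
        unfolding \<phi>_def
      proof (intro holomorphic_intros holomorphic_on_subset[OF h])
        fix w assume w: "w \<in> ball (of_int n) r - {complex_of_int n}"
        have "w \<noteq> of_real x" using w by (auto simp: r_def dist_norm)
        moreover have "sin (of_real pi * w) \<noteq> 0"
        proof
          assume "sin (of_real pi * w) = 0"
          then obtain k where k: "w = of_int k" using sin_pi_mult_eq_0 by blast
          have "norm (complex_of_int (n - k)) < 1" using w by (auto simp: r_def dist_norm k)
          then have "\<bar>real_of_int (n - k)\<bar> < 1" by (simp only: norm_of_int)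
          then have "n = k" by linarith
          then show False using w k by auto
        qed
        ultimately show "sin (complex_of_real pi * w) * (w - complex_of_real x) \<noteq> 0" by auto
      qed auto
      have D: "((\<lambda>w. sin (complex_of_real pi * w)) has_field_derivative of_real pi * cos (of_real pi * of_int n)) (at (of_int n))"
        by (auto intro!: derivative_eq_intros)
      have "sin (complex_of_real pi * of_int n) = 0" using sin_pi_mult_eq_0 by blast
      then have L: "((\<lambda>w. sin (complex_of_real pi * w) / (w - of_int n)) \<longlongrightarrow> of_real pi * cos (of_real pi * of_int n)) (at (of_int n))"
        using D unfolding has_field_derivative_iff by simp
      have hc: "(h \<longlongrightarrow> h (of_int n)) (at (of_int n))"
        using holomorphic_on_imp_continuous_on[OF h] by (simp add: continuous_on_eq_continuous_at isCont_def)
      have "((\<lambda>w. h w / ((sin (complex_of_real pi * w) / (w - of_int n)) * (w - of_real x))) \<longlongrightarrow>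
           h (of_int n) / ((of_real pi * cos (of_real pi * of_int n)) * (of_int n - of_real x))) (at (of_int n))"
        by (intro tendsto_intros L hc) (use xn[of n] in \<open>auto simp: cn\<close>)
      moreover have "\<phi> w * (w - of_int n) = h w / ((sin (complex_of_real pi * w) / (w - of_int n)) * (w - of_real x))" for w
        by (simp add: \<phi>_def mult_ac)
      ultimately show "((\<lambda>w. \<phi> w * (w - of_int n)) \<longlongrightarrow> ?R n) (at (of_int n))"
        unfolding cn by (simp only:)
    qed (use r in auto)
  qed
  finally have C: "contour_integral (rectpath a b) \<phi> = 2 * pi * \<i> * (h (of_real x) / sin (of_real pi * of_real x) +
     (\<Sum>n = - int m..int m. ?R n))" .
  have sx: "sin (complex_of_real pi * of_real x) = of_real (sin (pi * x))" by (simp flip: sin_of_real of_real_mult)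
  have t: "?R n * of_real (sin (pi * x))
      = - (h (of_int n) * of_real (sinc (x - of_int n)))" for n
  proof -
    have ne: "x - of_int n \<noteq> 0" using x by auto
    \<comment> \<open>The residue has \<open>cos (pi n)\<close> in the denominator, whereas
      \<open>sinc (x - n)\<close> has it in the numerator. The two agree because its square is
      1.\<close>
    define c e where "c = cos (pi * of_int n)" "e = x - of_int n"
    have "sin (pi * e) = sin (pi * x) * c"
      by (simp add: c_e_def right_diff_distrib sin_diff)
    moreover have "c * c = 1" by (simp add: c_e_def)
    ultimately have "sinc e = sin (pi * x) / (pi * c * e)"
      using ne by (auto simp: sinc_def c_e_def(2)[symmetric] divide_simps)
    moreover have "of_int n - complex_of_real x = - of_real e" by (simp add: c_e_def)
    ultimately show ?thesis unfolding c_e_def[symmetric] by simp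
  qed
  have "contour_integral (rectpath a b) \<phi> * of_real (sin (pi * x)) = 2 * pi * \<i> * (h (of_real x) +
     (\<Sum>n = - int m..int m. ?R n * of_real (sin (pi * x))))"
    unfolding C mult.assoc distrib_right sum_distrib_right using s0 unfolding sx by simp
  then show ?thesis unfolding t \<phi>_def by (simp add: sum_negf)
qed

text \<open>The growth \<open>exp (pi |Im w|)\<close> is cancelled by the sine in the denominator,
  and the factor \<open>1 / (1 + |w|)\<close> together with \<open>1 / |w - x|\<close> leaves an
  integrand of order \<open>L^(-2)\<close> on a contour of length \<open>8 L\<close>. For integer
  \<open>x\<close> the poles at \<open>x\<close> and at the integers coincide, so this case is
  settled directly: all terms but one vanish.\<close>

lemma sampling_theorem_1d:
  fixes h :: "complex \<Rightarrow> complex" and x :: real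
  assumes h: "h holomorphic_on UNIV"
    and K: "\<And>w. norm (h w) \<le> K * exp (pi * \<bar>Im w\<bar>) / (1 + norm w)"
  shows "(\<lambda>m. \<Sum>n = - int m..int m. h (of_int n) * of_real (sinc (x - of_int n))) \<longlonglongrightarrow> h (of_real x)"
    (is "?s \<longlonglongrightarrow> _")
proof (cases "x \<in> \<int>")
  case True
  then obtain k where k: "x = of_int k" by (auto elim: Ints_cases)
  have "?s m = h (of_real x)" if "m \<ge> nat \<bar>k\<bar>" for m
  proof -
    have "sinc (x - of_int n) = (if n = k then 1 else 0)" for n
      using sin_npi_int[of "k - n"] by (auto simp: sinc_def k)
    then have "?s m
        = (\<Sum>n = - int m..int m. if n = k then h (of_int k) else 0)"
      by (intro sum.cong) auto
    moreover have "k \<in> {- int m..int m}" using that by auto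
    ultimately show ?thesis by (simp add: k)
  qed
  then have "\<forall>\<^sub>F m in sequentially. ?s m = h (of_real x)"
    by (auto simp: eventually_sequentially)
  then show ?thesis by (rule tendsto_eventually)
next
  case False
  have K0: "K \<ge> 0" using order_trans[OF norm_ge_zero K[of 0]] by simp
  define s where "s = ?s"
  define E where "E = (\<lambda>m. 4 * K / ((1 + (real m + 1/2)) * (real m + 1/2 - \<bar>x\<bar>)) * (8 * (real m + 1/2)) / (2 * pi))"
  have bound: "norm (s m - h (of_real x)) \<le> E m" if m: "real m \<ge> \<bar>x\<bar>" for m
  proof -
    define L where "L = real m + 1/2"
    let ?B = "4 * K / ((1 + L) * (L - \<bar>x\<bar>))"
    have L: "L \<ge> 1/2" "L > \<bar>x\<bar>" using m by (auto simp: L_def)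
    define a where "a = Complex (- L) (- L)"
    define b where "b = Complex L L"
    define \<phi> where "\<phi> = (\<lambda>w. h w / (sin (of_real pi * w) * (w - of_real x)))"
    have pim: "path_image (rectpath a b) = {z. Re z \<in> {-L, L} \<and> Im z \<in> {-L..L}} \<union> {z. Im z \<in> {-L, L} \<and> Re z \<in> {-L..L}}"
      using L by (subst path_image_rectpath) (auto simp: a_def b_def)
    have cos1: "cos (2 * (pi * L)) = -1"
    proof -
      have "2 * (pi * L) = pi * of_int (2 * int m + 1)" by (simp add: L_def algebra_simps)
      then show ?thesis by (simp only: cos_npi_int) simp
    qed
    have sinb: "norm (sin (of_real pi * w)) \<ge> exp (pi * \<bar>Im w\<bar>) / 4" if w: "w \<in> path_image (rectpath a b)" for w
    proof -
      consider "\<bar>Re w\<bar> = L" | "\<bar>Im w\<bar> = L" using w L unfolding pim by auto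
      then show ?thesis
      proof cases
        case 1
        then have "cos (2 * Re (of_real pi * w)) = -1" using cos1 by (cases "Re w \<ge> 0") auto
        from norm_sin_ge_exp[OF disjI1[OF this]] show ?thesis by (simp add: abs_mult)
      next
        case 2
        have "pi * L \<ge> 2 * (1/2)" using L pi_ge_two by (intro mult_mono) auto
        then have "\<bar>Im (of_real pi * w)\<bar> \<ge> 1" using 2 by (simp add: abs_mult)
        from norm_sin_ge_exp[OF disjI2[OF this]] show ?thesis by (simp add: abs_mult)
      qed
    qed
    have nw: "norm w \<ge> L" "norm (w - of_real x) \<ge> L - \<bar>x\<bar>" if w: "w \<in> path_image (rectpath a b)" for w
    proof -
      consider "\<bar>Re w\<bar> = L" | "\<bar>Im w\<bar> = L" using w L unfolding pim by auto
      then show 1: "norm w \<ge> L" using abs_Re_le_cmod[of w] abs_Im_le_cmod[of w] by cases auto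
      then show "norm (w - of_real x) \<ge> L - \<bar>x\<bar>" using norm_triangle_ineq2[of w "of_real x"] by simp
    qed
    have nz: "sin (of_real pi * w) * (w - of_real x) \<noteq> 0" if "w \<in> path_image (rectpath a b)" for w
      using sinb[OF that] nw(2)[OF that] L(2)
      by (metis diff_gt_0_iff_gt divide_pos_pos exp_gt_zero mult_eq_0_iff norm_zero order_less_le_trans zero_less_numeral less_irrefl)
    have "norm (contour_integral (rectpath a b) \<phi>) \<le>
        ?B * (2 * (Re b - Re a) + 2 * (Im b - Im a))"
    proof (rule contour_integral_rectpath_bound)
      show "continuous_on (path_image (rectpath a b)) \<phi>" unfolding \<phi>_def using nz
        by (intro continuous_intros continuous_on_subset[OF holomorphic_on_imp_continuous_on[OF h]]) auto
      show "0 \<le> ?B" using K0 L by auto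
      fix w assume w: "w \<in> path_image (rectpath a b)"
      have "norm (\<phi> w) \<le> (K * exp (pi * \<bar>Im w\<bar>) / (1 + norm w)) / (exp (pi * \<bar>Im w\<bar>) / 4 * (L - \<bar>x\<bar>))"
        unfolding \<phi>_def norm_divide norm_mult
      proof (intro frac_le K mult_mono)
        show "0 \<le> K * exp (pi * \<bar>Im w\<bar>) / (1 + norm w)" using K0 by simp
      qed (use sinb[OF w] nw[OF w] L in auto)
      also have "\<dots> = 4 * K / ((1 + norm w) * (L - \<bar>x\<bar>))" by simp
      also have "\<dots> \<le> ?B"
        using nw[OF w] L K0 by (intro divide_left_mono mult_right_mono mult_pos_pos) auto
      finally show "norm (\<phi> w) \<le> ?B" .
    qed (use L in \<open>auto simp: a_def b_def\<close>)
    also have "2 * (Re b - Re a) + 2 * (Im b - Im a) = 8 * L" by (simp add: a_def b_def)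
    finally have n1: "norm (contour_integral (rectpath a b) \<phi>) \<le> ?B * (8 * L)" .
    have "2 * pi * norm (s m - h (of_real x)) = norm (2 * of_real pi * \<i> * (h (of_real x) - s m))"
      by (simp add: norm_mult norm_minus_commute)
    also have "\<dots> = norm (contour_integral (rectpath a b) \<phi> * of_real (sin (pi * x)))"
      unfolding s_def \<phi>_def
      by (subst sampling_residue_sum[OF h False]) (use L in \<open>auto simp: a_def b_def L_def\<close>)
    also have "\<dots> \<le> norm (contour_integral (rectpath a b) \<phi>) * 1"
      unfolding norm_mult by (intro mult_left_mono) auto
    also have "\<dots> \<le> ?B * (8 * L)" using n1 by simp
    finally have "norm (s m - h (of_real x)) * (2 * pi) \<le> ?B * (8 * L)"
      by (simp only: mult.commute[of _ "2 * pi"])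
    then have "norm (s m - h (of_real x)) \<le> ?B * (8 * L) / (2 * pi)"
      by (intro mult_imp_le_div_pos) auto
    then show ?thesis by (simp add: E_def L_def)
  qed
  have "E \<longlonglongrightarrow> 0" unfolding E_def by real_asymp
  moreover have "\<forall>\<^sub>F m in sequentially. norm (s m - h (of_real x)) \<le> E m"
  proof -
    obtain m0 :: nat where "\<bar>x\<bar> \<le> real m0" using real_arch_simple by blast
    then show ?thesis unfolding eventually_sequentially by (intro exI[of _ m0] allI impI bound) auto
  qed
  ultimately have "(\<lambda>m. s m - h (of_real x)) \<longlonglongrightarrow> 0" by (rule Lim_null_comparison[rotated])
  then show ?thesis unfolding s_def by (simp add: LIM_zero_iff)
qed

section \<open>The cardinal sine as an entire function\<close>

definition csinc :: "complex \<Rightarrow> complex" where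
  "csinc w = (if w = 0 then 1 else sin (of_real pi * w) / (of_real pi * w))"

lemma csinc_of_real: "csinc (of_real x) = of_real (sinc x)"
  by (simp add: csinc_def sinc_def flip: sin_of_real of_real_mult)

lemma holomorphic_csinc: "csinc holomorphic_on UNIV"
proof (rule no_isolated_singularity'[where K="{0}"])
  have "((\<lambda>w. sin (complex_of_real pi * w)) has_field_derivative of_real pi * cos (of_real pi * 0)) (at 0)"
    by (auto intro!: derivative_eq_intros)
  then have "((\<lambda>w. sin (complex_of_real pi * w) / w) \<longlongrightarrow> of_real pi) (at 0)"
    unfolding has_field_derivative_iff by simp
  then have "((\<lambda>w. sin (complex_of_real pi * w) / w / of_real pi) \<longlongrightarrow> of_real pi / of_real pi) (at 0)"
    by (intro tendsto_intros) auto
  then have "((\<lambda>w. sin (complex_of_real pi * w) / w / of_real pi) \<longlongrightarrow> 1) (at 0)" by simp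
  then have "(csinc \<longlongrightarrow> 1) (at 0)"
    by (rule Lim_transform_eventually) (auto simp: csinc_def eventually_at_filter mult.commute)
  then show "(csinc \<longlongrightarrow> csinc z) (at z within UNIV)" if "z \<in> {0}" for z
    using that by (simp add: csinc_def)
  have "(\<lambda>w. sin (complex_of_real pi * w) / (of_real pi * w)) holomorphic_on UNIV - {0}"
    by (intro holomorphic_intros) auto
  then show "csinc holomorphic_on UNIV - {0}"
    by (rule holomorphic_transform) (auto simp: csinc_def)
qed auto

lemma norm_sin_cos_le_exp: "norm (sin z) \<le> exp \<bar>Im z\<bar>" "norm (cos z) \<le> exp \<bar>Im z\<bar>" for z :: complex
proof -
  have e: "norm (exp (\<i> * z)) \<le> exp \<bar>Im z\<bar>" "norm (exp (- (\<i> * z))) \<le> exp \<bar>Im z\<bar>"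
    by (auto simp: norm_exp_eq_Re)
  have "norm (exp (\<i> * z) - exp (- (\<i> * z))) \<le> 2 * exp \<bar>Im z\<bar>"
    using norm_triangle_ineq4[of "exp (\<i> * z)" "exp (- (\<i> * z))"] e by linarith
  then show "norm (sin z) \<le> exp \<bar>Im z\<bar>" by (simp add: sin_exp_eq norm_divide norm_mult)
  have "norm (exp (\<i> * z) + exp (- (\<i> * z))) \<le> 2 * exp \<bar>Im z\<bar>"
    using norm_triangle_ineq[of "exp (\<i> * z)" "exp (- (\<i> * z))"] e by linarith
  then show "norm (cos z) \<le> exp \<bar>Im z\<bar>" by (simp add: cos_exp_eq norm_divide)
qed

lemma norm_csinc_le: "norm (csinc w) \<le> exp (pi * \<bar>Im w\<bar>)"
proof (cases "w = 0")
  case False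
  have "norm (sin (of_real pi * w) - sin 0) \<le> exp (pi * \<bar>Im w\<bar>) * norm (of_real pi * w - 0)"
  proof (rule field_differentiable_bound[where S="closed_segment 0 (of_real pi * w)" and f'=cos])
    fix z assume "z \<in> closed_segment 0 (of_real pi * w)"
    then obtain t where t: "0 \<le> t" "t \<le> 1" "z = t *\<^sub>R (of_real pi * w)" by (auto simp: in_segment)
    have "\<bar>Im z\<bar> = t * (pi * \<bar>Im w\<bar>)" using t by (simp add: abs_mult)
    also have "\<dots> \<le> 1 * (pi * \<bar>Im w\<bar>)" using t by (intro mult_right_mono) auto
    finally show "norm (cos z) \<le> exp (pi * \<bar>Im w\<bar>)"
      using norm_sin_cos_le_exp(2)[of z] by (simp add: order_trans)
  qed (auto intro: DERIV_subset[OF DERIV_sin])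
  then show ?thesis using False by (simp add: csinc_def norm_divide norm_mult divide_le_eq)
qed (simp add: csinc_def)

text \<open>The bounds for \<open>csinc w\<close> and for \<open>w * csinc w\<close> are added. The
  resulting form is the decay hypothesis of \<open>sampling_theorem_1d\<close>.\<close>

lemma norm_csinc_decay: "norm (csinc w) \<le> 2 * exp (pi * \<bar>Im w\<bar>) / (1 + norm w)"
proof -
  have "norm w * norm (csinc w) \<le> exp (pi * \<bar>Im w\<bar>)"
  proof (cases "w = 0")
    case False
    have "norm w * norm (csinc w) = norm (sin (of_real pi * w)) / pi"
      using False by (simp add: csinc_def norm_divide norm_mult)
    also have "\<dots> \<le> norm (sin (of_real pi * w)) / 1" using pi_ge_two by (intro divide_left_mono) auto
    also have "\<dots> \<le> exp (pi * \<bar>Im w\<bar>)" using norm_sin_cos_le_exp(1)[of "of_real pi * w"] by (simp add: abs_mult)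
    finally show ?thesis .
  qed simp
  then have "(1 + norm w) * norm (csinc w) \<le> 2 * exp (pi * \<bar>Im w\<bar>)"
    using norm_csinc_le[of w] by (simp add: distrib_right)
  moreover have "1 + norm w > 0" by (smt (verit) norm_ge_zero)
  ultimately show ?thesis by (simp add: pos_le_divide_eq mult.commute)
qed

lemma abs_sinc_le_1: "\<bar>sinc x\<bar> \<le> 1"
  using norm_csinc_le[of "of_real x"] by (simp add: csinc_of_real)

lemma nn_integral_count_space_int_le:
  fixes f :: "int \<Rightarrow> ennreal"
  assumes b: "\<And>m. (\<Sum>n = - int m..int m. f n) \<le> c"
  shows "(\<integral>\<^sup>+n. f n \<partial>count_space UNIV) \<le> c"
proof (rule nn_integral_le_exhausting[where A="\<lambda>m. {- int m..int m}"])
  fix n :: int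
  show "\<exists>m. n \<in> {- int m..int m}" by (intro exI[of _ "nat \<bar>n\<bar>"]) auto
next
  fix m
  have "(\<integral>\<^sup>+n. f n * indicator {- int m..int m} n \<partial>count_space UNIV) = (\<Sum>n = - int m..int m. f n)"
    by (subst nn_integral_count_space_indicator[symmetric]) (auto simp: nn_integral_count_space_finite)
  then show "(\<integral>\<^sup>+n. f n * indicator {- int m..int m} n \<partial>count_space UNIV) \<le> c" using b by simp
qed (auto simp: incseq_def)

text \<open>The cardinal series is applied to \<open>w \<mapsto> csinc (x - w)\<close> itself, whose
  samples are the coefficients of the series and whose value at \<open>x\<close> is 1.\<close>

lemma nn_integral_sinc_squared_le: "(\<integral>\<^sup>+n. ennreal ((sinc (x - of_int n))\<^sup>2) \<partial>count_space UNIV) \<le> 1"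
proof -
  define h where "h = (\<lambda>w. csinc (of_real x - w))"
  have hh: "h holomorphic_on UNIV" unfolding h_def
    by (rule holomorphic_on_compose_gen[OF _ holomorphic_csinc, unfolded o_def]) (auto intro!: holomorphic_intros)
  have hb: "norm (h w) \<le> (2 * (1 + \<bar>x\<bar>)) * exp (pi * \<bar>Im w\<bar>) / (1 + norm w)" for w
  proof -
    have p: "1 + norm (of_real x - w) > 0" "1 + norm w > 0" by (smt (verit) norm_ge_zero)+
    have "norm w \<le> \<bar>x\<bar> + norm (of_real x - w)"
      using norm_triangle_ineq4[of "of_real x" "of_real x - w"] by simp
    then have "1 + norm w \<le> (1 + \<bar>x\<bar>) * (1 + norm (of_real x - w))"
      by (simp add: ring_distribs) (smt (verit) mult_nonneg_nonneg norm_ge_zero abs_ge_zero)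
    then have "1 / (1 + norm (of_real x - w)) \<le> (1 + \<bar>x\<bar>) / (1 + norm w)"
      using p by (simp add: field_simps)
    then have le: "2 * exp (pi * \<bar>Im w\<bar>) * (1 / (1 + norm (of_real x - w))) \<le> 2 * exp (pi * \<bar>Im w\<bar>) * ((1 + \<bar>x\<bar>) / (1 + norm w))"
      by (intro mult_left_mono) auto
    have "norm (h w) \<le> 2 * exp (pi * \<bar>Im w\<bar>) * (1 / (1 + norm (of_real x - w)))"
      unfolding h_def using norm_csinc_decay[of "of_real x - w"] by simp
    also note le
    also have "2 * exp (pi * \<bar>Im w\<bar>) * ((1 + \<bar>x\<bar>) / (1 + norm w)) = (2 * (1 + \<bar>x\<bar>)) * exp (pi * \<bar>Im w\<bar>) / (1 + norm w)"
      by (simp add: mult_ac)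
    finally show ?thesis .
  qed
  define s where "s = (\<lambda>m. \<Sum>n = - int m..int m. (sinc (x - of_int n))\<^sup>2)"
  have "(\<lambda>m. \<Sum>n = - int m..int m. h (of_int n) * of_real (sinc (x - of_int n))) \<longlonglongrightarrow> h (of_real x)"
    by (rule sampling_theorem_1d[OF hh hb])
  moreover have "h (of_int n) = of_real (sinc (x - of_int n))" for n
    unfolding h_def by (simp flip: csinc_of_real)
  moreover have "h (of_real x) = of_real 1" by (simp add: h_def csinc_def)
  ultimately have "(\<lambda>m. complex_of_real (s m)) \<longlonglongrightarrow> of_real 1"
    by (simp add: s_def power2_eq_square)
  then have s1: "s \<longlonglongrightarrow> 1" by (simp only: tendsto_of_real_iff)
  have inc: "incseq s" unfolding s_def incseq_def by (auto intro!: sum_mono2)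
  have le: "s m \<le> 1" for m using incseq_le[OF inc s1] .
  have "(\<Sum>n = - int m..int m. ennreal ((sinc (x - of_int n))\<^sup>2)) \<le> 1" for m
    using le[of m] by (subst sum_ennreal) (auto simp: s_def)
  then show ?thesis by (rule nn_integral_count_space_int_le)
qed

section \<open>Power sums of the cardinal sine\<close>

lemma nn_integral_count_space_shift:
  fixes f :: "int \<Rightarrow> ennreal"
  shows "(\<integral>\<^sup>+n. f (k + n) \<partial>count_space UNIV) = (\<integral>\<^sup>+n. f n \<partial>count_space UNIV)"
  by (rule nn_integral_bij_count_space) (rule bij_betwI[where g="\<lambda>n. n - k"], auto)

lemma sum_int_symmetric:
  fixes f :: "int \<Rightarrow> 'a::comm_monoid_add"
  shows "(\<Sum>n = - int m..int m. f n) = f 0 + (\<Sum>j = 1..m. f (int j) + f (- int j))"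
proof (induction m)
  case (Suc m)
  have "{- int (Suc m)..int (Suc m)} = insert (int (Suc m)) (insert (- int (Suc m)) {- int m..int m})"
    by auto
  then have "(\<Sum>n = - int (Suc m)..int (Suc m). f n) = f (int (Suc m)) + (f (- int (Suc m)) + (\<Sum>n = - int m..int m. f n))"
    by simp
  then show ?case unfolding Suc.IH by (simp add: ac_simps)
qed simp

lemma powr_diff_ge:
  fixes x p :: real
  assumes x: "x > 0" and p: "p > 1"
  shows "(x + 1) powr (- p) \<le> (x powr (1 - p) - (x + 1) powr (1 - p)) / (p - 1)"
proof -
  obtain z where z: "x < z" "z < x + 1" "(x + 1) powr (1 - p) - x powr (1 - p) = (x + 1 - x) * ((1 - p) * z powr (1 - p - 1))"
  proof -
    have "\<exists>z>x. z < x + 1 \<and> (x + 1) powr (1 - p) - x powr (1 - p) = (x + 1 - x) * ((1 - p) * z powr (1 - p - 1))"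
    proof (rule MVT2)
      fix z assume "x \<le> z"
      then have "z > 0" using x by simp
      then show "((\<lambda>z. z powr (1 - p)) has_real_derivative (1 - p) * z powr (1 - p - 1)) (at z)"
        by (rule has_real_derivative_powr)
    qed simp
    then show ?thesis using that by blast
  qed
  have "(x + 1) powr (- p) \<le> z powr (- p)" using z x p by (intro powr_mono2') auto
  also have "\<dots> = (x powr (1 - p) - (x + 1) powr (1 - p)) / (p - 1)" using z(3) p by (simp add: field_simps)
  finally show ?thesis .
qed

lemma sum_powr_neg_le:
  fixes p :: real
  assumes p: "p > 1"
  shows "(\<Sum>i = 1..M. real i powr (- p)) \<le> p / (p - 1)"
proof -
  \<comment> \<open>The subtracted tail term makes the induction telescope through
    \<open>powr_diff_ge\<close>. At \<open>M = 0\<close> the right side is exactly 1, because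
    \<open>p / (p - 1) = 1 + 1 / (p - 1)\<close>.\<close>
  have "(\<Sum>i = 1..Suc M. real i powr (- p)) \<le> p / (p - 1) - real (Suc M) powr (1 - p) / (p - 1)" for M
  proof (induction M)
    case 0
    then show ?case using p by (simp add: diff_divide_distrib[symmetric])
  next
    case (Suc M)
    have "(\<Sum>i = 1..Suc (Suc M). real i powr (- p)) = (\<Sum>i = 1..Suc M. real i powr (- p)) + (real (Suc M) + 1) powr (- p)"
      by (simp add: add.commute)
    also have "\<dots> \<le> (p / (p - 1) - real (Suc M) powr (1 - p) / (p - 1))
        + (real (Suc M) powr (1 - p) - (real (Suc M) + 1) powr (1 - p)) / (p - 1)"
      using Suc.IH powr_diff_ge[of "real (Suc M)" p] p by (intro add_mono) auto
    also have "\<dots> = p / (p - 1) - real (Suc (Suc M)) powr (1 - p) / (p - 1)"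
      by (simp add: diff_divide_distrib add.commute)
    finally show ?case .
  qed
  note s = this
  show ?thesis
  proof (cases M)
    case 0
    then show ?thesis using p by simp
  next
    case (Suc M')
    have "real (Suc M') powr (1 - p) / (p - 1) \<ge> 0" using p by simp
    then show ?thesis unfolding Suc using s[of M'] by linarith
  qed
qed

lemma sum_even_odd:
  fixes f :: "nat \<Rightarrow> 'a::comm_monoid_add"
  shows "(\<Sum>j = 1..m. f (2 * j - 1) + f (2 * j)) = (\<Sum>i = 1..2 * m. f i)"
  by (induction m) (auto simp: ac_simps)

lemma abs_sinc_le_inverse: "y \<noteq> 0 \<Longrightarrow> \<bar>sinc y\<bar> \<le> 1 / (pi * \<bar>y\<bar>)"
  by (auto simp: sinc_def abs_mult intro!: divide_right_mono)

text \<open>For \<open>\<bar>t\<bar> \<le> 1/2\<close> the points \<open>t - n\<close> with \<open>n \<noteq> 0\<close> are, pairwise, at least as far from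
  the origin as the half-integers \<open>i/2\<close> with \<open>i \<ge> 1\<close>.\<close>
lemma sinc_powr_sum_near:
  fixes p t :: real
  assumes p: "p > 1" and t: "\<bar>t\<bar> \<le> 1/2"
  shows "(\<Sum>n = - int m..int m. \<bar>sinc (t - of_int n)\<bar> powr p) \<le> 1 + (2 / pi) powr p * (p / (p - 1))"
proof -
  define f where "f = (\<lambda>n::int. \<bar>sinc (t - of_int n)\<bar> powr p)"
  define c where "c = (\<lambda>i::nat. (2 / pi) powr p * real i powr (- p))"
  have f0: "f 0 \<le> 1" unfolding f_def using abs_sinc_le_1 p by (intro powr_le1) auto
  have one: "\<bar>sinc y\<bar> powr p \<le> c i" if "i \<ge> 1" "\<bar>y\<bar> \<ge> real i / 2" for y i
  proof -
    have y: "y \<noteq> 0" using that by auto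
    have "\<bar>sinc y\<bar> \<le> 1 / (pi * \<bar>y\<bar>)" by (rule abs_sinc_le_inverse[OF y])
    also have "\<dots> \<le> 1 / (pi * (real i / 2))" using that by (intro divide_left_mono mult_left_mono mult_pos_pos) auto
    also have "\<dots> = (2 / pi) * (1 / real i)" by simp
    finally have "\<bar>sinc y\<bar> powr p \<le> ((2 / pi) * (1 / real i)) powr p" using p by (intro powr_mono2) auto
    also have "\<dots> = c i" using that unfolding c_def by (subst powr_mult) (auto simp: powr_divide powr_minus_divide)
    finally show ?thesis .
  qed
  have pair: "f (int j) + f (- int j) \<le> c (2 * j - 1) + c (2 * j)" if j: "j \<ge> 1" for j
  proof (cases "t \<ge> 0")
    case True
    have "f (int j) \<le> c (2 * j - 1)" "f (- int j) \<le> c (2 * j)"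
      unfolding f_def by (rule one; use j t True in \<open>auto simp: of_nat_diff\<close>)+
    then show ?thesis by simp
  next
    case False
    have "f (- int j) \<le> c (2 * j - 1)" "f (int j) \<le> c (2 * j)"
      unfolding f_def by (rule one; use j t False in \<open>auto simp: of_nat_diff\<close>)+
    then show ?thesis by simp
  qed
  have "(\<Sum>n = - int m..int m. f n) \<le> 1 + (\<Sum>j = 1..m. c (2 * j - 1) + c (2 * j))"
    unfolding sum_int_symmetric by (rule add_mono[OF f0 sum_mono]) (rule pair, auto)
  also have "\<dots> = 1 + (2 / pi) powr p * (\<Sum>i = 1..2 * m. real i powr (- p))"
    unfolding sum_even_odd by (simp add: c_def sum_distrib_left)
  also have "\<dots> \<le> 1 + (2 / pi) powr p * (p / (p - 1))"
    by (intro add_left_mono mult_left_mono sum_powr_neg_le p) auto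
  finally show ?thesis by (simp add: f_def)
qed

text \<open>For \<open>p \<ge> 2\<close> the bound \<open>|sinc| \<le> 1\<close> puts the p-th
  powers below the squares, whose sum is at most 1. For \<open>p < 2\<close> the sum is shifted by
  the nearest integer and compared with half-integers.\<close>

lemma nn_integral_sinc_powr_le:
  assumes p: "p > 1"
  shows "(\<integral>\<^sup>+n. ennreal (\<bar>sinc (x - of_int n)\<bar> powr p) \<partial>count_space UNIV) \<le> ennreal (frakC p)"
proof (cases "p < 2")
  case False
  have "\<bar>sinc y\<bar> powr p \<le> (sinc y)\<^sup>2" for y
  proof -
    have "\<bar>sinc y\<bar> powr p \<le> \<bar>sinc y\<bar> powr 2"
      using False abs_sinc_le_1[of y] by (intro powr_mono') auto
    then show ?thesis by (cases "sinc y = 0") (auto simp: powr_numeral)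
  qed
  then have "(\<integral>\<^sup>+n. ennreal (\<bar>sinc (x - of_int n)\<bar> powr p) \<partial>count_space UNIV)
    \<le> (\<integral>\<^sup>+n. ennreal ((sinc (x - of_int n))\<^sup>2) \<partial>count_space UNIV)"
    by (intro nn_integral_mono ennreal_leI) auto
  also have "\<dots> \<le> 1" by (rule nn_integral_sinc_squared_le)
  finally show ?thesis using False by (simp add: frakC_def)
next
  case True
  define k where "k = round x"
  define t where "t = x - of_int k"
  have t: "\<bar>t\<bar> \<le> 1/2" using of_int_round_abs_le[of x] by (simp add: t_def k_def abs_minus_commute)
  have "(\<integral>\<^sup>+n. ennreal (\<bar>sinc (x - of_int n)\<bar> powr p) \<partial>count_space UNIV)
    = (\<integral>\<^sup>+n. ennreal (\<bar>sinc (x - of_int (k + n))\<bar> powr p) \<partial>count_space UNIV)"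
    by (rule nn_integral_count_space_shift[symmetric])
  also have "\<dots> = (\<integral>\<^sup>+n. ennreal (\<bar>sinc (t - of_int n)\<bar> powr p) \<partial>count_space UNIV)"
    by (simp add: t_def algebra_simps)
  also have "\<dots> \<le> ennreal (frakC p)"
  proof (rule nn_integral_count_space_int_le)
    fix m
    show "(\<Sum>n = - int m..int m. ennreal (\<bar>sinc (t - of_int n)\<bar> powr p)) \<le> ennreal (frakC p)"
      using sinc_powr_sum_near[OF p t, of m] True by (simp add: frakC_def ennreal_leI)
  qed
  finally show ?thesis .
qed

section \<open>Extremality of the half-integer in the tail sums\<close>

lemma sin_ge_mult_cos:
  assumes "0 \<le> y" "y \<le> pi / 2"
  shows "y * cos y \<le> sin y"
proof -
  have "(\<lambda>y. sin y - y * cos y) 0 \<le> (\<lambda>y. sin y - y * cos y) y"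
  proof (rule DERIV_nonneg_imp_nondecreasing[OF assms(1)])
    fix x assume x: "0 \<le> x" "x \<le> y"
    have "((\<lambda>y. sin y - y * cos y) has_real_derivative x * sin x) (at x)"
      by (auto intro!: derivative_eq_intros)
    moreover have "x * sin x \<ge> 0" using x assms by (intro mult_nonneg_nonneg sin_ge_zero) auto
    ultimately show "\<exists>d. ((\<lambda>y. sin y - y * cos y) has_real_derivative d) (at x) \<and> 0 \<le> d" by blast
  qed
  then show ?thesis by simp
qed

text \<open>This is \<open>y cot y \<le> 1 - y^2 / 3\<close>, where the right side is the start of
  the power series of \<open>y cot y\<close>. The derivative of the difference is
  \<open>y / 3 * (sin y - y cos y)\<close>, so the previous lemma applies.\<close>

lemma sin_cubic_ge_mult_cos:
  assumes "0 \<le> y" "y \<le> pi / 2"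
  shows "y * cos y \<le> sin y * (1 - y\<^sup>2 / 3)"
proof -
  let ?D = "\<lambda>y::real. sin y * (1 - y\<^sup>2 / 3) - y * cos y"
  have "?D 0 \<le> ?D y"
  proof (rule DERIV_nonneg_imp_nondecreasing[OF assms(1)])
    fix x assume x: "0 \<le> x" "x \<le> y"
    have "(?D has_real_derivative (x / 3 * (sin x - x * cos x))) (at x)"
      by (auto intro!: derivative_eq_intros simp: algebra_simps power2_eq_square)
    moreover have "x / 3 * (sin x - x * cos x) \<ge> 0"
      using x assms sin_ge_mult_cos[of x] by (intro mult_nonneg_nonneg) auto
    ultimately show "\<exists>d. (?D has_real_derivative d) (at x) \<and> 0 \<le> d" by blast
  qed
  then show ?thesis by simp
qed

text \<open>With \<open>A = (a - u)^(- p)\<close> and \<open>B = (a + u)^(- p)\<close> this reads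
  \<open>a (A - B) \<le> p u (A + B)\<close>, the form needed for the logarithmic derivative of
  \<open>A + B\<close>. The difference of the sides vanishes at \<open>u = 0\<close> and has the
  derivative \<open>p (p + 1) u ((a + u)^(p - 1) - (a - u)^(p - 1))\<close>.\<close>

lemma powr_cross_le:
  fixes a u p :: real
  assumes p: "p > 1" and u: "0 \<le> u" "u < a"
  shows "(a + u) powr p * (a - p * u) \<le> (a - u) powr p * (a + p * u)"
proof -
  let ?D = "\<lambda>u. (a - u) powr p * (a + p * u) - (a + u) powr p * (a - p * u)"
  have "?D 0 \<le> ?D u"
  proof (rule DERIV_nonneg_imp_nondecreasing[OF u(1)])
    fix x assume x: "0 \<le> x" "x \<le> u"
    then have x': "a - x > 0" "a + x > 0" using u by auto
    have e: "(a - x) powr p = (a - x) * (a - x) powr (p - 1)" "(a + x) powr p = (a + x) * (a + x) powr (p - 1)"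
      using x' by (simp_all add: powr_diff)
    have "(?D has_real_derivative (p * (p + 1) * x * ((a + x) powr (p - 1) - (a - x) powr (p - 1)))) (at x)"
      using x' by (auto intro!: derivative_eq_intros simp: e) (simp add: algebra_simps)
    moreover have "p * (p + 1) * x * ((a + x) powr (p - 1) - (a - x) powr (p - 1)) \<ge> 0"
      using x x' p by (intro mult_nonneg_nonneg) (auto intro!: powr_mono2)
    ultimately show "\<exists>d. (?D has_real_derivative d) (at x) \<and> 0 \<le> d" by blast
  qed
  then show ?thesis by simp
qed

text \<open>The maximum over \<open>u\<close> is at \<open>u = 0\<close>. Comparing second derivatives there gives the condition
  \<open>p + 1 \<le> \<pi>\<^sup>2 a\<^sup>2\<close>, which is what the hypothesis on \<open>q\<close> provides.\<close>
lemma cos_powr_pair_le: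
  fixes a u p :: real
  assumes p: "p > 1" and a: "a \<ge> 1" and pa: "p + 1 \<le> pi\<^sup>2 * a\<^sup>2" and u: "\<bar>u\<bar> < 1/2"
  shows "cos (pi * u) powr p * ((a + u) powr (- p) + (a - u) powr (- p)) \<le> 2 * a powr (- p)"
proof -
  have main: "cos (pi * u) powr p * ((a + u) powr (- p) + (a - u) powr (- p)) \<le> 2 * a powr (- p)"
    if u: "0 \<le> u" "u < 1/2" for u
  proof -
    let ?S = "\<lambda>u. (a + u) powr (- p) + (a - u) powr (- p)"
    \<comment> \<open>The logarithm of the left side; it is shown to decrease on
      \<open>[0, u]\<close>. The strict bound \<open>u < 1/2\<close> keeps the cosine positive,
      hence the logarithm meaningful.\<close>
    let ?H = "\<lambda>u. p * ln (cos (pi * u)) + ln (?S u)"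
    have cpos: "cos (pi * x) > 0" if "0 \<le> x" "x \<le> u" for x
    proof (rule cos_gt_zero_pi)
      show "- (pi / 2) < pi * x" using that pi_gt_zero by (smt (verit) mult_nonneg_nonneg divide_pos_pos)
      have "pi * x < pi * (1/2)" using that u by (intro mult_strict_left_mono) auto
      then show "pi * x < pi / 2" by simp
    qed
    have Spos: "?S x > 0" if "0 \<le> x" "x \<le> u" for x using that u a by (intro add_pos_pos) auto
    have "?H u \<le> ?H 0"
    proof (rule DERIV_nonpos_imp_nonincreasing[OF u(1)])
      fix x assume x: "0 \<le> x" "x \<le> u"
      have x': "a - x > 0" "a + x > 0" using x u a by auto
      define A where "A = (a - x) powr (- p)"
      define B where "B = (a + x) powr (- p)"
      define c where "c = cos (pi * x)"
      define s where "s = sin (pi * x)"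
      have AB: "A > 0" "B > 0" using x' by (auto simp: A_def B_def)
      have cp: "c > 0" unfolding c_def by (rule cpos[OF x])
      have e: "(a - x) powr (- p - 1) = A / (a - x)" "(a + x) powr (- p - 1) = B / (a + x)"
        using x' by (simp_all add: powr_diff A_def B_def)
      have "(?H has_real_derivative (p * (- pi * s / c) + p * (A / (a - x) - B / (a + x)) / (A + B))) (at x)"
        using cp x' AB Spos[OF x]
        by (auto intro!: derivative_eq_intros simp: e A_def[symmetric] B_def[symmetric] c_def[symmetric] s_def[symmetric])
          (simp add: field_simps)
      moreover have "p * (- pi * s / c) + p * (A / (a - x) - B / (a + x)) / (A + B) \<le> 0"
      proof -
        have ab: "a * (A - B) \<le> p * x * (A + B)"
        proof -
          have "A * B * ((a + x) powr p * (a - p * x)) \<le> A * B * ((a - x) powr p * (a + p * x))"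
            using AB x x' by (intro mult_left_mono powr_cross_le p) auto
          moreover have "B * (a + x) powr p = 1" "A * (a - x) powr p = 1"
            using x' by (auto simp: A_def B_def powr_minus)
          ultimately have "A * (a - p * x) \<le> B * (a + p * x)"
            by (metis (no_types, lifting) mult.assoc mult.commute mult.left_neutral)
          then show ?thesis by (simp add: algebra_simps)
        qed
        have "A / (a - x) - B / (a + x) = (a * (A - B) + x * (A + B)) / ((a - x) * (a + x))"
          using x' by (simp add: field_simps)
        also have "\<dots> \<le> ((p + 1) * x * (A + B)) / ((a - x) * (a + x))"
        proof (rule divide_right_mono)
          show "a * (A - B) + x * (A + B) \<le> (p + 1) * x * (A + B)" using ab by (simp add: algebra_simps)
        qed (use x' in simp)
        finally have "(A / (a - x) - B / (a + x)) / (A + B) \<le> ((p + 1) * x * (A + B)) / ((a - x) * (a + x)) / (A + B)"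
          using AB by (intro divide_right_mono) auto
        also have "\<dots> = (p + 1) * x / (a\<^sup>2 - x\<^sup>2)"
        proof -
          have "(a - x) * (a + x) = a\<^sup>2 - x\<^sup>2" by (simp add: power2_eq_square algebra_simps)
          moreover have "A + B \<noteq> 0" using AB by simp
          ultimately show ?thesis by simp
        qed
        \<comment> \<open>What remains is
          \<open>(p + 1) x / (a^2 - x^2) \<le> pi tan (pi x)\<close>. The hypothesis replaces
          \<open>p + 1\<close> by \<open>pi^2 a^2\<close>, the cubic bound replaces
          \<open>pi x cos (pi x)\<close>, and the surplus is absorbed because
          \<open>a^2 pi^2 / 3 \<ge> 1\<close>.\<close>
        also have "\<dots> \<le> pi * s / c"
        proof -
          have d: "a\<^sup>2 - x\<^sup>2 > 0" using x' mult_pos_pos[OF x'] by (simp add: power2_eq_square algebra_simps)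
          have y: "0 \<le> pi * x" "pi * x \<le> pi / 2"
            using x u mult_left_mono[of x "1/2" pi] by auto
          have s0: "s \<ge> 0" unfolding s_def using y by (intro sin_ge_zero) auto
          have "(p + 1) * x * c \<le> pi\<^sup>2 * a\<^sup>2 * x * c"
            using pa x cp by (intro mult_right_mono) auto
          also have "\<dots> = pi * a\<^sup>2 * (pi * x * c)" by (simp add: power2_eq_square)
          also have "\<dots> \<le> pi * a\<^sup>2 * (s * (1 - (pi * x)\<^sup>2 / 3))"
            unfolding c_def s_def using sin_cubic_ge_mult_cos[OF y] by (intro mult_left_mono) auto
          also have "\<dots> = pi * s * (a\<^sup>2 - a\<^sup>2 * (pi\<^sup>2 / 3) * x\<^sup>2)" by (simp add: power_mult_distrib algebra_simps)
          also have "\<dots> \<le> pi * s * (a\<^sup>2 - x\<^sup>2)"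
          proof (intro mult_left_mono diff_left_mono)
            have "3 \<le> pi\<^sup>2" using pi_ge_two power_mono[of 2 pi 2] by auto
            then have "1 * 1 \<le> a\<^sup>2 * (pi\<^sup>2 / 3)" using a by (intro mult_mono) auto
            then have "1 * x\<^sup>2 \<le> a\<^sup>2 * (pi\<^sup>2 / 3) * x\<^sup>2" by (intro mult_right_mono) auto
            then show "x\<^sup>2 \<le> a\<^sup>2 * (pi\<^sup>2 / 3) * x\<^sup>2" by simp
          qed (use s0 in auto)
          finally show ?thesis using d cp by (simp add: divide_le_eq le_divide_eq mult_ac)
        qed
        finally have "p * ((A / (a - x) - B / (a + x)) / (A + B)) \<le> p * (pi * s / c)" using p by (intro mult_left_mono) auto
        then show ?thesis by simp
      qed
      ultimately show "\<exists>d. (?H has_real_derivative d) (at x) \<and> d \<le> 0" by blast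
    qed
    moreover have "?H 0 = ln (2 * a powr (- p))" by simp
    moreover have "?H u = ln (cos (pi * u) powr p * ?S u)"
      using cpos[OF u(1) order_refl] Spos[OF u(1) order_refl] by (subst ln_mult) (auto simp: ln_powr)
    ultimately have "ln (cos (pi * u) powr p * ?S u) \<le> ln (2 * a powr (- p))" by simp
    then show ?thesis
      using cpos[OF u(1) order_refl] Spos[OF u(1) order_refl] a by (subst (asm) ln_le_cancel_iff) auto
  qed
  show ?thesis
  proof (cases "u \<ge> 0")
    case True
    then show ?thesis using main u by auto
  next
    case False
    then show ?thesis using main[of "- u"] u by (simp add: add.commute)
  qed
qed

lemma summable_incomplete_lambda:
  assumes p: "p > 1"
  shows "summable (\<lambda>n. (2 * (real (Suc n) + real N) - 1) powr (- p))"
proof (rule summable_comparison_test)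
  show "summable (\<lambda>n. real (Suc n) powr (- p))"
    using summable_Suc_iff[of "\<lambda>n. real n powr (- p)"] p by (simp add: summable_real_powr_iff)
  show "\<exists>M. \<forall>n\<ge>M. norm ((2 * (real (Suc n) + real N) - 1) powr (- p)) \<le> real (Suc n) powr (- p)"
    using p by (intro exI[of _ 0] allI impI) (auto intro!: powr_mono2')
qed

lemma sum_odd_powr_le_incomplete_lambda:
  assumes p: "p > 1"
  shows "(\<Sum>j = N..m. (2 * real j + 1) powr (- p)) \<le> incomplete_lambda p (real N)"
proof -
  have "(\<Sum>j = N..m. (2 * real j + 1) powr (- p)) \<le> (\<Sum>n<m + 1. (2 * (real (Suc n) + real N) - 1) powr (- p))"
  \<comment> \<open>With \<open>j = n + N\<close> the odd number \<open>2 j + 1\<close> is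
    \<open>2 (Suc n + N) - 1\<close>, the base of the n-th term of the series.\<close>
  proof (rule sum_le_included[where i="\<lambda>n. n + N"])
    show "\<forall>x\<in>{N..m}. \<exists>y\<in>{..<m + 1}. y + N = x \<and> (2 * real x + 1) powr (- p) \<le> (2 * (real (Suc y) + real N) - 1) powr (- p)"
    proof
      fix x assume "x \<in> {N..m}"
      then show "\<exists>y\<in>{..<m + 1}. y + N = x \<and> (2 * real x + 1) powr (- p) \<le> (2 * (real (Suc y) + real N) - 1) powr (- p)"
        by (intro bexI[of _ "x - N"]) (auto simp: of_nat_diff add.commute)
    qed
  qed auto
  also have "\<dots> \<le> incomplete_lambda p (real N)"
    unfolding incomplete_lambda_def by (intro sum_le_suminf summable_incomplete_lambda p) auto
  finally show ?thesis .
qed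

text \<open>Relative to the floor of \<open>x\<close>, the integers are paired as \<open>- j\<close>
  and \<open>1 + j\<close>, symmetric about \<open>1/2\<close>. Their distances to \<open>t\<close>
  are \<open>a + u\<close> and \<open>a - u\<close> with \<open>a = j + 1/2\<close>,
  \<open>u = t - 1/2\<close>, and the sine has the same modulus \<open>cos (pi u)\<close> at all of
  them. At \<open>u = 0\<close> the pair contributes \<open>2 a^(- p)\<close>, up to
  \<open>pi^(- p)\<close>, which is \<open>2^(p + 1) (2 j + 1)^(- p)\<close>.\<close>

lemma nn_integral_sinc_powr_tail_le:
  fixes x p :: real
  assumes p: "p > 1" and N: "N \<ge> 1" and pN: "p + 1 \<le> pi\<^sup>2 * (real N + 1/2)\<^sup>2"
  shows "(\<integral>\<^sup>+n. ennreal (\<bar>sinc (x - of_int n)\<bar> powr p) * indicator {y. \<bar>y\<bar> > real N} (x - of_int n) \<partial>count_space UNIV)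
     \<le> ennreal (2 powr (p + 1) / pi powr p * incomplete_lambda p (real N))"
    (is "_ \<le> ennreal ?C")
proof -
  define k where "k = \<lfloor>x\<rfloor>"
  define t where "t = x - of_int k"
  have t: "0 \<le> t" "t < 1" by (auto simp: t_def k_def) linarith+
  define g where "g = (\<lambda>n::int. \<bar>sinc (t - of_int n)\<bar> powr p * indicator {y. \<bar>y\<bar> > real N} (t - of_int n))"
  have g0: "g n \<ge> 0" for n by (simp add: g_def)
  have pair: "g (- int j) + g (1 + int j) \<le> 2 powr (p + 1) / pi powr p * (2 * real j + 1) powr (- p)" if j: "j \<ge> N" for j
  proof (cases "t = 0")
    \<comment> \<open>Here \<open>u = - 1/2\<close>, the endpoint that
      \<open>cos_powr_pair_le\<close> leaves out; \<open>sinc\<close> vanishes at both integers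
      since \<open>j \<ge> N \<ge> 1\<close>.\<close>
    case True
    have z: "sinc (of_int n) = 0" if "n \<noteq> 0" for n :: int
      using that by (simp add: sinc_def)
    have "g (- int j) = 0" "g (1 + int j) = 0"
      using z[of "int j"] z[of "- (1 + int j)"] j N by (auto simp: g_def True)
    then show ?thesis by simp
  next
    case False
    let ?s = "\<lambda>n::int. \<bar>sinc (t - of_int n)\<bar> powr p"
    define u where "u = t - 1/2"
    define a where "a = real j + 1/2"
    have u: "\<bar>u\<bar> < 1/2" using t False by (simp add: u_def abs_if)
    have a: "a \<ge> 1" "a + u > 0" "a - u > 0" using j N u by (auto simp: a_def)
    have cu: "cos (pi * u) = sin (pi * t)"
      by (simp add: u_def right_diff_distrib cos_diff)
    have c0: "cos (pi * u) \<ge> 0"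
    proof (rule cos_ge_zero)
      have "\<bar>pi * u\<bar> \<le> pi * (1/2)" using u unfolding abs_mult by (intro mult_mono) auto
      then show "- (pi / 2) \<le> pi * u" "pi * u \<le> pi / 2" by linarith+
    qed
    have s: "\<bar>sinc y\<bar> powr p = cos (pi * u) powr p / pi powr p * \<bar>y\<bar> powr (- p)"
      if "y \<noteq> 0" "\<bar>sin (pi * y)\<bar> = cos (pi * u)" for y
    proof -
      have "\<bar>sinc y\<bar> = cos (pi * u) / (pi * \<bar>y\<bar>)" using that by (simp add: sinc_def abs_mult)
      then show ?thesis using c0 by (simp add: powr_divide powr_mult powr_minus_divide)
    qed
    have sn: "\<bar>sin (pi * (t - of_int n))\<bar> = cos (pi * u)" for n :: int
      using c0 unfolding cu by (simp add: right_diff_distrib sin_diff)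
    have "g (- int j) \<le> ?s (- int j)" "g (1 + int j) \<le> ?s (1 + int j)"
      by (auto simp: g_def indicator_def)
    moreover have "?s (- int j) = cos (pi * u) powr p / pi powr p * (a + u) powr (- p)"
    proof -
      have "t - of_int (- int j) = a + u" by (simp add: a_def u_def)
      then show ?thesis using s[of "t - of_int (- int j)"] sn[of "- int j"] a by simp
    qed
    moreover have "?s (1 + int j) = cos (pi * u) powr p / pi powr p * (a - u) powr (- p)"
    proof -
      have "t - of_int (1 + int j) = - (a - u)" by (simp add: a_def u_def)
      then show ?thesis using s[of "t - of_int (1 + int j)"] sn[of "1 + int j"] a by simp
    qed
    ultimately have "g (- int j) + g (1 + int j) \<le> cos (pi * u) powr p * ((a + u) powr (- p) + (a - u) powr (- p)) / pi powr p"
      by (simp add: algebra_simps add_divide_distrib)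
    also have "\<dots> \<le> 2 * a powr (- p) / pi powr p"
    proof (intro divide_right_mono cos_powr_pair_le p a u)
      have "(real N + 1/2)\<^sup>2 \<le> a\<^sup>2" using j by (intro power_mono) (auto simp: a_def)
      then have "pi\<^sup>2 * (real N + 1/2)\<^sup>2 \<le> pi\<^sup>2 * a\<^sup>2" by (intro mult_left_mono) auto
      then show "p + 1 \<le> pi\<^sup>2 * a\<^sup>2" using pN by linarith
    qed auto
    also have "a powr (- p) = 2 powr p * (2 * real j + 1) powr (- p)"
    proof -
      have "a = (2 * real j + 1) / 2" by (simp add: a_def)
      show ?thesis unfolding \<open>a = (2 * real j + 1) / 2\<close> by (simp add: powr_divide powr_minus_divide)
    qed
    finally show ?thesis by (simp add: powr_add mult_ac)
  qed
  have zero: "g n = 0" if "- int N < n" "n < int N + 1" for n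
  proof -
    have "of_int n \<ge> 1 - real N" "of_int n \<le> real N" using that by linarith+
    then have "\<bar>t - of_int n\<bar> \<le> real N" using t by linarith
    then show ?thesis by (simp add: g_def)
  qed
  have fin: "(\<Sum>n = - int m..int m. g n) \<le> ?C" for m
  proof -
    let ?A = "(\<lambda>j. - int j) ` {N..m}" and ?B = "(\<lambda>j. 1 + int j) ` {N..m}"
    have "(\<Sum>n = - int m..int m. g n) \<le> (\<Sum>n\<in>?A \<union> ?B. g n)"
    proof -
      have "(\<Sum>n = - int m..int m. g n) = (\<Sum>n\<in>{- int m..int m} - {- int N<..<int N + 1}. g n)"
        using zero by (intro sum.mono_neutral_right) auto
      also have "\<dots> \<le> (\<Sum>n\<in>?A \<union> ?B. g n)"
      proof (rule sum_mono2)
        show "{- int m..int m} - {- int N<..<int N + 1} \<subseteq> ?A \<union> ?B"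
        proof
          fix n assume n: "n \<in> {- int m..int m} - {- int N<..<int N + 1}"
          show "n \<in> ?A \<union> ?B"
          proof (cases "n \<le> - int N")
            case True
            then have "n = - int (nat (- n))" "nat (- n) \<in> {N..m}" using n by auto
            then show ?thesis by blast
          next
            case False
            then have "n = 1 + int (nat (n - 1))" "nat (n - 1) \<in> {N..m}" using n by auto
            then show ?thesis by blast
          qed
        qed
      qed (auto simp: g0)
      finally show ?thesis .
    qed
    also have "\<dots> \<le> (\<Sum>n\<in>?A. g n) + (\<Sum>n\<in>?B. g n)"
      by (subst sum.union_disjoint) auto
    also have "\<dots> = (\<Sum>j = N..m. g (- int j) + g (1 + int j))"
      by (subst (1 2) sum.reindex) (auto simp: inj_on_def sum.distrib)
    also have "\<dots> \<le> (\<Sum>j = N..m. 2 powr (p + 1) / pi powr p * (2 * real j + 1) powr (- p))"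
      by (intro sum_mono pair) auto
    also have "\<dots> \<le> ?C"
      unfolding sum_distrib_left[symmetric] by (intro mult_left_mono sum_odd_powr_le_incomplete_lambda p) auto
    finally show ?thesis .
  qed
  have "(\<integral>\<^sup>+n. ennreal (\<bar>sinc (x - of_int n)\<bar> powr p) * indicator {y. \<bar>y\<bar> > real N} (x - of_int n) \<partial>count_space UNIV)
    = (\<integral>\<^sup>+n. ennreal (\<bar>sinc (x - of_int (k + n))\<bar> powr p) * indicator {y. \<bar>y\<bar> > real N} (x - of_int (k + n)) \<partial>count_space UNIV)"
    by (rule nn_integral_count_space_shift[symmetric])
  also have "\<dots> = (\<integral>\<^sup>+n. ennreal (g n) \<partial>count_space UNIV)"
  proof (rule nn_integral_cong)
    fix n :: int
    have eq: "x - of_int (k + n) = t - of_int n" by (simp add: t_def)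
    show "ennreal (\<bar>sinc (x - of_int (k + n))\<bar> powr p) * indicator {y. \<bar>y\<bar> > real N} (x - of_int (k + n)) = ennreal (g n)"
      unfolding eq g_def by (simp add: indicator_def)
  qed
  also have "\<dots> \<le> ennreal (?C)"
  proof (rule nn_integral_count_space_int_le)
    fix m
    show "(\<Sum>n = - int m..int m. ennreal (g n)) \<le> ennreal (?C)"
      using fin[of m] g0 by (simp add: ennreal_leI)
  qed
  finally show ?thesis .
qed

section \<open>Cardinal series in several variables\<close>

lemma continuous_on_sinc: "continuous_on UNIV sinc"
proof -
  have "continuous_on UNIV (\<lambda>x. Re (csinc (of_real x)))"
    by (intro continuous_intros continuous_on_compose2[OF holomorphic_on_imp_continuous_on[OF holomorphic_csinc]]) auto
  then show ?thesis by (simp add: csinc_of_real)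
qed

lemma borel_measurable_sinc [measurable]: "sinc \<in> borel_measurable borel"
  by (rule borel_measurable_continuous_onI[OF continuous_on_sinc])

text \<open>The residue argument yields a limit of symmetric partial sums. Integrability turns this
  limit into an integral against \<open>count_coset 0\<close>, to which Fubini applies.\<close>

lemma sampling_integral_1d:
  fixes h :: "complex \<Rightarrow> complex"
  assumes h: "h holomorphic_on UNIV"
    and K: "\<And>w. norm (h w) \<le> K * exp (pi * \<bar>Im w\<bar>) / (1 + norm w)"
    and int: "integrable (count_coset 0) (\<lambda>t. h (of_real t) * of_real (sinc (x - t)))"
  shows "(\<integral>t. h (of_real t) * of_real (sinc (x - t)) \<partial>count_coset 0) = h (of_real x)"
proof -
  define k where "k = (\<lambda>n::int. h (of_int n) * of_real (sinc (x - of_int n)))"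
  have [measurable]: "h \<in> borel_measurable borel"
    by (rule borel_measurable_holomorphic[OF h])
  have m: "(\<lambda>t. h (of_real t) * of_real (sinc (x - t))) \<in> borel_measurable borel" by measurable
  have ik: "integrable (count_space UNIV) k"
    using int unfolding count_coset_def by (subst (asm) integrable_distr_eq[OF _ m]) (auto simp: k_def)
  have eq: "(\<integral>t. h (of_real t) * of_real (sinc (x - t)) \<partial>count_coset 0) = (\<integral>n. k n \<partial>count_space UNIV)"
    unfolding count_coset_def by (subst integral_distr[OF _ m]) (auto simp: k_def)
  have "(\<lambda>m. \<integral>n. indicator {- int m..int m} n *\<^sub>R k n \<partial>count_space UNIV) \<longlonglongrightarrow> (\<integral>n. k n \<partial>count_space UNIV)"
  proof (rule integral_dominated_convergence[where w="\<lambda>n. norm (k n)"])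
    show "AE n in count_space UNIV. (\<lambda>m. indicator {- int m..int m} n *\<^sub>R k n) \<longlonglongrightarrow> k n"
    proof (rule AE_I2)
      fix n :: int
      have "\<forall>\<^sub>F m in sequentially. indicator {- int m..int m} n *\<^sub>R k n = k n"
        unfolding eventually_sequentially by (intro exI[of _ "nat \<bar>n\<bar>"]) (auto simp: indicator_def)
      then show "(\<lambda>m. indicator {- int m..int m} n *\<^sub>R k n) \<longlonglongrightarrow> k n" by (rule tendsto_eventually)
    qed
  qed (use ik in \<open>auto simp: indicator_def\<close>)
  moreover have "(\<integral>n. indicator {- int m..int m} n *\<^sub>R k n \<partial>count_space UNIV) = (\<Sum>n = - int m..int m. k n)" for m
  proof -
    have "{a \<in> UNIV. indicator {- int m..int m} a *\<^sub>R k a \<noteq> 0} \<subseteq> {- int m..int m}"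
      by (auto simp: indicator_def split: if_splits)
    moreover from this have "finite {a \<in> UNIV. indicator {- int m..int m} a *\<^sub>R k a \<noteq> 0}"
      by (rule finite_subset) simp
    ultimately show ?thesis
      by (subst lebesgue_integral_count_space_finite_support) (auto intro!: sum.mono_neutral_cong_left)
  qed
  ultimately have "(\<lambda>m. \<Sum>n = - int m..int m. k n) \<longlonglongrightarrow> (\<integral>n. k n \<partial>count_space UNIV)" by simp
  moreover have "(\<lambda>m. \<Sum>n = - int m..int m. k n) \<longlonglongrightarrow> h (of_real x)"
    unfolding k_def by (rule sampling_theorem_1d[OF h K])
  ultimately show ?thesis unfolding eq by (rule LIMSEQ_unique)
qed

abbreviation lattice_measure :: "('n::finite \<Rightarrow> real) measure" where
  "lattice_measure \<equiv> PiM UNIV (\<lambda>_. count_coset 0)"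

lemma integrable_PiM_dominated:
  fixes \<mu> :: "'i \<Rightarrow> real measure" and h :: "('i \<Rightarrow> real) \<Rightarrow> complex" and k :: "'i \<Rightarrow> real \<Rightarrow> complex"
    and d :: "'i \<Rightarrow> real \<Rightarrow> real"
  assumes I: "finite I" and psf: "product_sigma_finite \<mu>" and sets: "\<And>i. sets (\<mu> i) = sets borel"
    and h: "h \<in> borel_measurable (PiM I (\<lambda>_. borel))"
    and k: "\<And>i. k i \<in> borel_measurable borel" "\<And>i s. norm (k i s) \<le> 1"
    and d: "\<And>i. integrable (\<mu> i) (d i)" "\<And>i s. 0 \<le> d i s"
    and M: "M \<ge> 0" "\<And>t. norm (h t) \<le> M * (\<Prod>j\<in>I. d j (t j))"
  shows "integrable (PiM I \<mu>) (\<lambda>t. h t * (\<Prod>j\<in>I. k j (t j)))"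
proof (rule Bochner_Integration.integrable_bound)
  interpret product_sigma_finite \<mu> by (rule psf)
  note [measurable] = borel_measurable_PiM_cong[OF h sets] k(1)
  note [measurable_cong] = sets
  show "integrable (PiM I \<mu>) (\<lambda>t. M * (\<Prod>j\<in>I. d j (t j)))"
    using I by (intro integrable_mult_right product_integrable_prod d) auto
  show "AE t in PiM I \<mu>. norm (h t * (\<Prod>j\<in>I. k j (t j))) \<le> norm (M * (\<Prod>j\<in>I. d j (t j)))"
  proof (rule AE_I2)
    fix t
    have "norm (\<Prod>j\<in>I. k j (t j)) \<le> 1"
      unfolding prod_norm[symmetric] using k(2) by (intro prod_le_1) auto
    then have "norm (h t * (\<Prod>j\<in>I. k j (t j))) \<le> (M * (\<Prod>j\<in>I. d j (t j))) * 1"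
      unfolding norm_mult using M(1) d(2) by (intro mult_mono M(2)) (auto intro!: mult_nonneg_nonneg prod_nonneg)
    then show "norm (h t * (\<Prod>j\<in>I. k j (t j))) \<le> norm (M * (\<Prod>j\<in>I. d j (t j)))" by simp
  qed
  show "(\<lambda>t. h t * (\<Prod>j\<in>I. k j (t j))) \<in> borel_measurable (PiM I \<mu>)" using I by measurable
qed

text \<open>By Fubini, a kernel that reproduces \<open>h\<close> in each coordinate reproduces it in
  all of them together. The bound \<open>d i s \<le> 1\<close> carries the product majorant over to
  \<open>h\<close> with one coordinate fixed, as the induction requires. The restriction of
  \<open>x\<close> appears because points of \<open>PiM\<close> are \<open>undefined\<close> outside
  the index set.\<close>

lemma integral_PiM_reproducing:
  fixes \<mu> :: "'i \<Rightarrow> real measure" and h :: "('i \<Rightarrow> real) \<Rightarrow> complex" and k :: "'i \<Rightarrow> real \<Rightarrow> complex"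
    and d :: "'i \<Rightarrow> real \<Rightarrow> real"
  assumes "finite I" and psf: "product_sigma_finite \<mu>" and sets: "\<And>i. sets (\<mu> i) = sets borel"
    and h: "h \<in> borel_measurable (PiM I (\<lambda>_. borel))"
    and k: "\<And>i. k i \<in> borel_measurable borel" "\<And>i s. norm (k i s) \<le> 1"
    and d: "\<And>i. integrable (\<mu> i) (d i)" "\<And>i s. 0 \<le> d i s" "\<And>i s. d i s \<le> 1"
    and M: "M \<ge> 0" "\<And>t. norm (h t) \<le> M * (\<Prod>j\<in>I. d j (t j))"
    and rep: "\<And>i t. i \<in> I \<Longrightarrow> (\<integral>s. h (t(i := s)) * k i s \<partial>\<mu> i) = h (t(i := x i))"
  shows "(\<integral>t. h t * (\<Prod>j\<in>I. k j (t j)) \<partial>PiM I \<mu>) = h (restrict x I)"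
  using \<open>finite I\<close> h M rep
proof (induction I arbitrary: h rule: finite_induct)
  case empty
  have "(\<integral>t. h t \<partial>count_space {\<lambda>_. undefined}) = h (\<lambda>_. undefined)"
    by (simp add: lebesgue_integral_count_space_finite)
  then show ?case by (simp add: PiM_empty restrict_def)
next
  case (insert i I)
  interpret \<mu>: product_sigma_finite \<mu> by (rule psf)
  note [measurable_cong] = sets
  note [measurable] = insert.prems(1) k(1)
  have int: "integrable (PiM (insert i I) \<mu>) (\<lambda>t. h t * (\<Prod>j\<in>insert i I. k j (t j)))"
    using insert.hyps by (intro integrable_PiM_dominated[OF _ psf sets insert.prems(1) k d(1,2) insert.prems(2,3)]) auto
  have "(\<integral>t. h t * (\<Prod>j\<in>insert i I. k j (t j)) \<partial>PiM (insert i I) \<mu>)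
    = (\<integral>t. (\<integral>s. h (t(i := s)) * (\<Prod>j\<in>insert i I. k j ((t(i := s)) j)) \<partial>\<mu> i) \<partial>PiM I \<mu>)"
    by (rule \<mu>.product_integral_insert[OF insert.hyps int])
  also have "\<dots> = (\<integral>t. h (t(i := x i)) * (\<Prod>j\<in>I. k j (t j)) \<partial>PiM I \<mu>)"
  proof (rule Bochner_Integration.integral_cong[OF refl])
    fix t
    have "(\<Prod>j\<in>insert i I. k j ((t(i := s)) j)) = k i s * (\<Prod>j\<in>I. k j (t j))" for s
    proof -
      have "(\<Prod>j\<in>I. k j ((t(i := s)) j)) = (\<Prod>j\<in>I. k j (t j))" using insert.hyps by (intro prod.cong) auto
      then show ?thesis using insert.hyps by simp
    qed
    then have "(\<integral>s. h (t(i := s)) * (\<Prod>j\<in>insert i I. k j ((t(i := s)) j)) \<partial>\<mu> i)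
        = (\<integral>s. h (t(i := s)) * k i s * (\<Prod>j\<in>I. k j (t j)) \<partial>\<mu> i)"
      by (simp add: mult.assoc)
    also have "\<dots> = (\<integral>s. h (t(i := s)) * k i s \<partial>\<mu> i) * (\<Prod>j\<in>I. k j (t j))"
      by (rule integral_mult_left_zero)
    finally show "(\<integral>s. h (t(i := s)) * (\<Prod>j\<in>insert i I. k j ((t(i := s)) j)) \<partial>\<mu> i) = h (t(i := x i)) * (\<Prod>j\<in>I. k j (t j))"
      unfolding insert.prems(4)[OF insertI1] .
  qed
  also have "\<dots> = h ((restrict x I)(i := x i))"
  proof (rule insert.IH)
    show "(\<lambda>t. h (t(i := x i))) \<in> borel_measurable (PiM I (\<lambda>_. borel))" by measurable
    show "norm (h (t(i := x i))) \<le> M * (\<Prod>j\<in>I. d j (t j))" for t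
    proof -
      have "(\<Prod>j\<in>I. d j ((t(i := x i)) j)) = (\<Prod>j\<in>I. d j (t j))" using insert.hyps by (intro prod.cong) auto
      then have e: "(\<Prod>j\<in>insert i I. d j ((t(i := x i)) j)) = d i (x i) * (\<Prod>j\<in>I. d j (t j))"
        using insert.hyps by simp
      have "norm (h (t(i := x i))) \<le> M * (d i (x i) * (\<Prod>j\<in>I. d j (t j)))"
        using insert.prems(3)[of "t(i := x i)"] unfolding e .
      also have "\<dots> \<le> M * (1 * (\<Prod>j\<in>I. d j (t j)))"
        using M(1) d by (intro mult_left_mono mult_right_mono prod_nonneg) auto
      finally show ?thesis by simp
    qed
    fix j t assume j: "j \<in> I"
    then have ji: "j \<noteq> i" using insert.hyps by auto
    have eq: "(t(j := s))(i := x i) = (t(i := x i))(j := s)" for s using ji by auto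
    show "(\<integral>s. h ((t(j := s))(i := x i)) * k j s \<partial>\<mu> j) = h ((t(j := x j))(i := x i))"
      unfolding eq by (rule insert.prems(4)) (use j in simp)
  qed (rule M(1))
  also have "(restrict x I)(i := x i) = restrict x (insert i I)" by (auto simp: restrict_def fun_eq_iff)
  finally show ?case .
qed

lemma integrable_sinc_squared:
  assumes eta: "\<eta> > 0"
  shows "integrable (count_coset 0) (\<lambda>s. (sinc (\<eta> * s))\<^sup>2)"
proof (rule integrableI_bounded)
  have [measurable_cong]: "sets (count_coset 0) = sets borel" by simp
  show "(\<lambda>s. (sinc (\<eta> * s))\<^sup>2) \<in> borel_measurable (count_coset 0)" by measurable
  have le: "(sinc (\<eta> * of_int n))\<^sup>2 \<le> (1 / (pi * \<eta>))\<^sup>2 * \<bar>real_of_int n\<bar> powr (- 2)" if "n \<noteq> 0" for n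
  proof -
    have "\<bar>sinc (\<eta> * of_int n)\<bar> \<le> 1 / (pi * \<bar>\<eta> * of_int n\<bar>)" using eta that by (intro abs_sinc_le_inverse) auto
    then have "\<bar>sinc (\<eta> * of_int n)\<bar>\<^sup>2 \<le> (1 / (pi * \<bar>\<eta> * of_int n\<bar>))\<^sup>2" by (intro power_mono) auto
    also have "\<dots> = (1 / (pi * \<eta>))\<^sup>2 * \<bar>real_of_int n\<bar> powr (- 2)"
      using eta that by (simp add: abs_mult powr_minus_divide power_divide power_mult_distrib)
    finally show ?thesis by simp
  qed
  have "(\<integral>\<^sup>+s. ennreal (norm ((sinc (\<eta> * s))\<^sup>2)) \<partial>count_coset 0)
      = (\<integral>\<^sup>+n. ennreal ((sinc (\<eta> * of_int n))\<^sup>2) \<partial>count_space UNIV)"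
    by (subst nn_integral_count_coset) auto
  \<comment> \<open>The last factor is \<open>p / (p - 1)\<close> at \<open>p = 2\<close>; the 2 in
    front accounts for the two signs of \<open>n\<close>.\<close>
  also have "\<dots> \<le> ennreal (1 + 2 * (1 / (pi * \<eta>))\<^sup>2 * (2 / (2 - 1)))"
  proof (rule nn_integral_count_space_int_le)
    fix m
    have "(\<Sum>n = - int m..int m. (sinc (\<eta> * of_int n))\<^sup>2)
        \<le> 1 + (\<Sum>j = 1..m. 2 * (1 / (pi * \<eta>))\<^sup>2 * real j powr (- 2))"
      unfolding sum_int_symmetric
    proof (rule add_mono[OF _ sum_mono])
      show "(sinc (\<eta> * of_int 0))\<^sup>2 \<le> 1" by (simp add: sinc_def)
      fix j assume "j \<in> {1..m}"
      then show "(sinc (\<eta> * of_int (int j)))\<^sup>2 + (sinc (\<eta> * of_int (- int j)))\<^sup>2 \<le> 2 * (1 / (pi * \<eta>))\<^sup>2 * real j powr (- 2)"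
        using le[of "int j"] le[of "- int j"] by simp
    qed
    also have "\<dots> \<le> 1 + 2 * (1 / (pi * \<eta>))\<^sup>2 * (2 / (2 - 1))"
      unfolding sum_distrib_left[symmetric] using sum_powr_neg_le[of 2 m]
      by (intro add_left_mono mult_left_mono) auto
    finally have fin: "(\<Sum>n = - int m..int m. (sinc (\<eta> * of_int n))\<^sup>2) \<le> 1 + 2 * (1 / (pi * \<eta>))\<^sup>2 * (2 / (2 - 1))" .
    have eq: "(\<Sum>n = - int m..int m. ennreal ((sinc (\<eta> * of_int n))\<^sup>2)) = ennreal (\<Sum>n = - int m..int m. (sinc (\<eta> * of_int n))\<^sup>2)"
      by (rule sum_ennreal) simp
    show "(\<Sum>n = - int m..int m. ennreal ((sinc (\<eta> * of_int n))\<^sup>2)) \<le> ennreal (1 + 2 * (1 / (pi * \<eta>))\<^sup>2 * (2 / (2 - 1)))"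
      unfolding eq by (rule ennreal_leI[OF fin])
  qed
  also have "\<dots> < \<infinity>" by (simp only: ennreal_less_top infinity_ennreal_def)
  finally show "(\<integral>\<^sup>+s. ennreal (norm ((sinc (\<eta> * s))\<^sup>2)) \<partial>count_coset 0) < \<infinity>" .
qed

text \<open>Multiplying the dilation of \<open>f\<close> by squares of \<open>sinc\<close> keeps the exponential type at most \<open>\<pi>\<close>,
  since \<open>c + 2 \<eta> = 1\<close>, and makes the samples absolutely summable.\<close>
definition damped :: "real \<Rightarrow> real \<Rightarrow> (complex ^ 'n \<Rightarrow> complex) \<Rightarrow> ('n \<Rightarrow> real) \<Rightarrow> complex" where
  "damped c \<eta> f t = dilate c f (cvec t) * of_real (\<Prod>j\<in>UNIV. (sinc (\<eta> * t j))\<^sup>2)"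

lemma prod_sinc_squared_le_1: "(\<Prod>j\<in>A. (sinc (g j))\<^sup>2) \<le> 1" "0 \<le> (\<Prod>j\<in>A. (sinc (g j))\<^sup>2)"
  using abs_sinc_le_1 by (auto intro!: prod_le_1 prod_nonneg simp: abs_square_le_1)

lemma damped_sampling:
  fixes f :: "complex ^ 'n \<Rightarrow> complex"
  assumes f: "entire_multi f" "exp_type_le pi f" and M: "M \<ge> 0" "\<And>x. norm (f (cvec x)) \<le> M"
    and c: "c > 0" and eta: "\<eta> > 0" and ce: "c + 2 * \<eta> = 1"
  shows "(\<integral>t. damped c \<eta> f t * (\<Prod>j\<in>UNIV. of_real (sinc (x j - t j))) \<partial>lattice_measure) = damped c \<eta> f x"
    and "damped c \<eta> f \<in> borel_measurable (PiM UNIV (\<lambda>_. borel))"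
    and "integrable lattice_measure (\<lambda>t. damped c \<eta> f t * (\<Prod>j\<in>UNIV. of_real (sinc (x j - t j))))"
proof -
  let ?d = "\<lambda>(j::'n) s. (sinc (\<eta> * s))\<^sup>2"
  have fc: "entire_multi (dilate c f)" "exp_type_le (c * pi) (dilate c f)"
    using entire_multi_dilate[OF f(1)] exp_type_dilate[OF f(2) c order_refl] by auto
  have Mc: "norm (dilate c f (cvec t)) \<le> M" for t by (simp add: dilate_cvec M)
  note [measurable] = measurable_cvec[OF fc(1)]
  show m[measurable]: "damped c \<eta> f \<in> borel_measurable (PiM UNIV (\<lambda>_. borel))"
    unfolding damped_def[abs_def] by measurable
  have nb: "norm (damped c \<eta> f t) \<le> M * (\<Prod>j\<in>UNIV. ?d j (t j))" for t
    unfolding damped_def norm_mult norm_of_real abs_of_nonneg[OF prod_sinc_squared_le_1(2)]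
    by (intro mult_right_mono Mc prod_sinc_squared_le_1(2))
  have d1: "0 \<le> ?d j s" "?d j s \<le> 1" for j s using abs_sinc_le_1[of "\<eta> * s"] by (auto simp: abs_square_le_1)
  have k1: "norm (complex_of_real (sinc y)) \<le> 1" for y using abs_sinc_le_1 by simp
  have rep: "(\<integral>s. damped c \<eta> f (t(i := s)) * of_real (sinc (x i - s)) \<partial>count_coset 0) = damped c \<eta> f (t(i := x i))" for i t
  proof -
    define P where "P = (\<Prod>j\<in>UNIV - {i}. (sinc (\<eta> * t j))\<^sup>2)"
    have P: "0 \<le> P" "P \<le> 1" unfolding P_def by (rule prod_sinc_squared_le_1)+
    \<comment> \<open>The entire extension of the damped function in coordinate \<open>i\<close>.
      The squares of \<open>sinc\<close> in the other coordinates are frozen into the constant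
      \<open>P\<close>.\<close>
    define H where "H = (\<lambda>w. slice (dilate c f) t i w * (csinc (of_real \<eta> * w))\<^sup>2 * of_real P)"
    have dP: "(\<Prod>j\<in>UNIV. (sinc (\<eta> * (t(i := s)) j))\<^sup>2) = (sinc (\<eta> * s))\<^sup>2 * P" for s
      unfolding P_def by (subst prod.remove[of _ i]) auto
    have HH: "damped c \<eta> f (t(i := s)) = H (of_real s)" for s
    proof -
      have "csinc (of_real \<eta> * of_real s) = of_real (sinc (\<eta> * s))" by (simp flip: csinc_of_real)
      then show ?thesis by (simp only: damped_def H_def slice_of_real dP) simp
    qed
    have hol: "H holomorphic_on UNIV" unfolding H_def
      by (intro holomorphic_intros holomorphic_slice[OF fc(1)] holomorphic_on_compose_gen[OF _ holomorphic_csinc, unfolded o_def]) auto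
    have bd: "norm (H w) \<le> (2 * M / \<eta>) * exp (pi * \<bar>Im w\<bar>) / (1 + norm w)" for w
    proof -
      have imw: "\<bar>Im (of_real \<eta> * w)\<bar> = \<eta> * \<bar>Im w\<bar>" "norm (of_real \<eta> * w) = \<eta> * norm w"
        using eta by (auto simp: abs_mult norm_mult)
      define e where "e = exp (pi * (\<eta> * \<bar>Im w\<bar>))"
      have pw: "1 + norm w > 0" "1 + \<eta> * norm w > 0" using eta by (auto intro!: add_pos_nonneg)
      \<comment> \<open>One factor \<open>csinc\<close> supplies the decay and the other is bounded
        by its growth only. The exponents add up to \<open>(c + 2 * \<eta>) * pi * |Im w|\<close>,
        that is, to \<open>pi * |Im w|\<close>.\<close>
      have "norm (H w) \<le> (M * exp (c * pi * \<bar>Im w\<bar>)) * ((2 * e / (1 + \<eta> * norm w)) * e) * 1"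
        unfolding H_def norm_mult power2_eq_square
      proof (intro mult_mono)
        show "norm (slice (dilate c f) t i w) \<le> M * exp (c * pi * \<bar>Im w\<bar>)"
          by (rule slice_bound[OF fc M(1) Mc]) (use c in simp)
        show "norm (csinc (of_real \<eta> * w)) \<le> 2 * e / (1 + \<eta> * norm w)"
          using norm_csinc_decay[of "of_real \<eta> * w"] unfolding imw e_def .
        show "norm (csinc (of_real \<eta> * w)) \<le> e"
          using norm_csinc_le[of "of_real \<eta> * w"] unfolding imw e_def .
      qed (use P M pw in \<open>auto simp: e_def intro!: mult_nonneg_nonneg\<close>)
      also have "\<dots> = 2 * M * (exp (c * pi * \<bar>Im w\<bar>) * e * e) * (1 / (1 + \<eta> * norm w))" by simp
      also have "exp (c * pi * \<bar>Im w\<bar>) * e * e = exp (pi * \<bar>Im w\<bar>)"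
      proof -
        have "c * pi * \<bar>Im w\<bar> + pi * (\<eta> * \<bar>Im w\<bar>) + pi * (\<eta> * \<bar>Im w\<bar>) = (c + 2 * \<eta>) * (pi * \<bar>Im w\<bar>)"
          by (simp add: algebra_simps)
        then show ?thesis unfolding e_def exp_add[symmetric] ce by simp
      qed
      also have "2 * M * exp (pi * \<bar>Im w\<bar>) * (1 / (1 + \<eta> * norm w)) \<le> 2 * M * exp (pi * \<bar>Im w\<bar>) * (1 / (\<eta> * (1 + norm w)))"
      proof (intro mult_left_mono divide_left_mono)
        \<comment> \<open>Trading \<open>1 + \<eta> * |w|\<close> for
          \<open>\<eta> * (1 + |w|)\<close> costs the factor \<open>1 / \<eta>\<close> in the
          constant, which may depend on \<open>\<eta>\<close>: it serves only to justify the
          cardinal series.\<close>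
        have "\<eta> \<le> 1" using ce c by simp
        then show "\<eta> * (1 + norm w) \<le> 1 + \<eta> * norm w" by (simp add: algebra_simps)
      qed (use pw eta M in auto)
      finally show ?thesis by simp
    qed
    have int: "integrable (count_coset 0) (\<lambda>s. H (of_real s) * of_real (sinc (x i - s)))"
    proof (rule Bochner_Integration.integrable_bound)
      show "integrable (count_coset 0) (\<lambda>s. M * (sinc (\<eta> * s))\<^sup>2)"
        by (intro integrable_mult_right integrable_sinc_squared eta)
      have [measurable]: "H \<in> borel_measurable borel"
        by (rule borel_measurable_holomorphic[OF hol])
      show "(\<lambda>s. H (of_real s) * of_real (sinc (x i - s))) \<in> borel_measurable (count_coset 0)" by measurable
      show "AE s in count_coset 0. norm (H (of_real s) * of_real (sinc (x i - s))) \<le> norm (M * (sinc (\<eta> * s))\<^sup>2)"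
      proof (rule AE_I2)
        fix s
        have "norm (H (of_real s)) \<le> M * ((sinc (\<eta> * s))\<^sup>2 * P)"
          using nb[of "t(i := s)"] unfolding dP HH .
        also have "\<dots> \<le> M * ((sinc (\<eta> * s))\<^sup>2 * 1)" using M P by (intro mult_left_mono) auto
        finally have "norm (H (of_real s)) * norm (complex_of_real (sinc (x i - s))) \<le> (M * (sinc (\<eta> * s))\<^sup>2) * 1"
          using M k1 by (intro mult_mono) auto
        then show "norm (H (of_real s) * of_real (sinc (x i - s))) \<le> norm (M * (sinc (\<eta> * s))\<^sup>2)"
          using M(1) by (simp add: norm_mult)
      qed
    qed
    show ?thesis using sampling_integral_1d[OF hol bd int] by (simp add: HH)
  qed
  let ?J = "\<lambda>t. damped c \<eta> f t * (\<Prod>j\<in>UNIV. of_real (sinc (x j - t j)))"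
  have psf: "product_sigma_finite (\<lambda>_::'n. count_coset 0)" by (rule product_sigma_finite_count_coset)
  have "(\<integral>t. ?J t \<partial>lattice_measure) = damped c \<eta> f (restrict x UNIV)"
    by (rule integral_PiM_reproducing[where M=M and d="?d", OF _ psf _ m _ _ _ _ _ M(1) nb])
      (rule rep | simp add: k1 d1 integrable_sinc_squared[OF eta] del: norm_of_real fun_upd_apply)+
  then show "(\<integral>t. ?J t \<partial>lattice_measure) = damped c \<eta> f x" by (simp add: restrict_UNIV)
  show "integrable lattice_measure ?J"
    by (rule integrable_PiM_dominated[where M=M and d="?d", OF _ psf _ m _ _ _ _ M(1) nb])
      (simp_all add: k1 d1 integrable_sinc_squared[OF eta] del: norm_of_real)
qed

section \<open>The truncation error\<close>

text \<open>The exceptional set is a union of slabs, one for each coordinate that is off the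
  integers, and every slab is null by one vanishing factor.\<close>

lemma AE_PiM_lattice:
  "AE t in (lattice_measure :: ('n::finite \<Rightarrow> real) measure). \<forall>j. \<exists>n. t j = of_int n"
proof -
  let ?M = "lattice_measure :: ('n \<Rightarrow> real) measure"
  interpret product_sigma_finite "\<lambda>_::'n. count_coset 0" by (rule product_sigma_finite_count_coset)
  define R where "R = range (of_int :: int \<Rightarrow> real)"
  have R: "R \<in> sets borel" unfolding R_def by (rule sets.countable[rotated]) auto
  have R0: "emeasure (count_coset 0) (- R) = 0"
    unfolding count_coset_def using R by (subst emeasure_distr) (auto simp: R_def vimage_def)
  define A where "A = (\<lambda>j::'n. PiE UNIV (\<lambda>i. if i = j then - R else UNIV))"
  have A: "A j \<in> null_sets ?M" for j
  proof (rule null_setsI)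
    have s: "(if i = j then - R else UNIV) \<in> sets (count_coset 0)" for i using R by auto
    show "A j \<in> sets ?M" unfolding A_def using s by (intro sets_PiM_I_finite) auto
    have "emeasure ?M (A j) = (\<Prod>i\<in>UNIV. emeasure (count_coset 0) (if i = j then - R else UNIV))"
      unfolding A_def using s by (intro emeasure_PiM) auto
    also have "\<dots> = 0" by (rule prod_zero) (auto intro!: bexI[of _ j] simp: R0)
    finally show "emeasure ?M (A j) = 0" .
  qed
  show ?thesis
  proof (rule AE_I')
    show "(\<Union>j. A j) \<in> null_sets ?M" using A by (intro null_sets_UN') auto
    show "{t \<in> space ?M. \<not> (\<forall>j. \<exists>n. t j = of_int n)} \<subseteq> (\<Union>j. A j)"
      by (auto simp: A_def R_def PiE_iff image_iff, blast)
  qed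
qed

lemma finite_vec_set:
  assumes "\<And>j. finite (A j)"
  shows "finite {n :: 'a ^ 'n. \<forall>j. n $ j \<in> A j}"
proof -
  have "{n :: 'a ^ 'n. \<forall>j. n $ j \<in> A j} \<subseteq> vec_lambda ` PiE UNIV A"
  proof
    fix n :: "'a ^ 'n" assume "n \<in> {n. \<forall>j. n $ j \<in> A j}"
    then show "n \<in> vec_lambda ` PiE UNIV A"
      by (intro image_eqI[of _ _ "\<lambda>j. n $ j"]) auto
  qed
  moreover have "finite (PiE (UNIV :: 'n set) A)" using assms by (intro finite_PiE) auto
  ultimately show ?thesis by (meson finite_imageI finite_subset)
qed

lemma finite_index_set:
  fixes N :: "nat ^ 'n"
  shows "finite (index_set N x)"
proof (rule finite_subset[OF _ finite_vec_set])
  show "index_set N x \<subseteq> {n. \<forall>j. n $ j \<in> {\<lfloor>x $ j - real (N $ j)\<rfloor>..\<lceil>x $ j + real (N $ j)\<rceil>}}"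
    unfolding index_set_def
  proof (intro Collect_mono impI allI)
    fix n :: "int ^ 'n" and j
    assume "\<forall>j. \<bar>x $ j - real_of_int (n $ j)\<bar> \<le> real (N $ j)"
    then have "\<bar>x $ j - real_of_int (n $ j)\<bar> \<le> real (N $ j)" by blast
    then show "n $ j \<in> {\<lfloor>x $ j - real (N $ j)\<rfloor>..\<lceil>x $ j + real (N $ j)\<rceil>}"
      by (auto simp: floor_le_iff le_ceiling_iff)
  qed
qed simp

lemma frakC_nonneg: "p > 1 \<Longrightarrow> frakC p \<ge> 0"
  by (auto simp: frakC_def)

lemma incomplete_lambda_nonneg: "p > 1 \<Longrightarrow> incomplete_lambda p (real N) \<ge> 0"
  unfolding incomplete_lambda_def by (intro suminf_nonneg summable_incomplete_lambda) auto

lemma nn_integral_sinc_prod_tail_le: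
  fixes N :: "nat ^ 'n" and x :: "real ^ 'n"
  assumes p: "p > 1" and N: "\<And>j. N $ j \<ge> 1" and pN: "\<And>j. p + 1 \<le> pi\<^sup>2 * (real (N $ j) + 1/2)\<^sup>2"
  shows "(\<integral>\<^sup>+t. ennreal ((\<bar>\<Prod>j\<in>UNIV. sinc (x $ j - t j)\<bar> * indicator {t. \<exists>j. \<bar>x $ j - t j\<bar> > real (N $ j)} t) powr p)
       \<partial>lattice_measure)
    \<le> ennreal (frakC p ^ (CARD('n) - 1) * (2 powr (p + 1) / pi powr p) * (\<Sum>j\<in>UNIV. incomplete_lambda p (real (N $ j))))"
    (is "(\<integral>\<^sup>+t. ?w t \<partial>_) \<le> _")
proof -
  interpret product_sigma_finite "\<lambda>_::'n. count_coset 0" by (rule product_sigma_finite_count_coset)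
  have [measurable_cong]: "sets (count_coset 0) = sets borel" by simp
  \<comment> \<open>The index \<open>j\<close> names a coordinate that leaves the box, and only its
    factor keeps the tail indicator. Each product therefore factorises into one tail sum and
    \<open>CARD('n) - 1\<close> full sums; summing over \<open>j\<close> is a union bound.\<close>
  define g :: "'n \<Rightarrow> 'n \<Rightarrow> real \<Rightarrow> ennreal" where
    "g j i s = ennreal (\<bar>sinc (x $ i - s)\<bar> powr p) * (if i = j then indicator {y. \<bar>y\<bar> > real (N $ i)} (x $ i - s) else 1)" for j i s
  have [measurable]: "{y. \<bar>y\<bar> > c} \<in> sets borel" for c :: real by measurable
  have "(\<lambda>s. ennreal (\<bar>sinc (x $ i - s)\<bar> powr p) * indicator {y. \<bar>y\<bar> > real (N $ i)} (x $ i - s)) \<in> borel_measurable borel"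
    "(\<lambda>s. ennreal (\<bar>sinc (x $ i - s)\<bar> powr p)) \<in> borel_measurable borel" for i
    by measurable
  then have gb: "g j i \<in> borel_measurable borel" for j i
    unfolding g_def[abs_def] by (cases "i = j") simp_all
  have gm: "g j i \<in> borel_measurable (count_coset 0)" for j i
    using gb measurable_cong_sets[OF sets_count_coset refl] by blast
  let ?\<tau> = "\<lambda>j. 2 powr (p + 1) / pi powr p * incomplete_lambda p (real (N $ j))"
  let ?\<kappa> = "\<lambda>j i. if i = j then ?\<tau> i else frakC p"
  have tau: "?\<tau> j \<ge> 0" for j using incomplete_lambda_nonneg[OF p] by (intro mult_nonneg_nonneg) auto
  have C: "frakC p \<ge> 0" by (rule frakC_nonneg[OF p])
  have le: "?w t
      \<le> (\<Sum>j\<in>UNIV. \<Prod>i\<in>UNIV. g j i (t i))" for t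
  proof (cases "\<exists>j. \<bar>x $ j - t j\<bar> > real (N $ j)")
    case True
    then obtain j where j: "\<bar>x $ j - t j\<bar> > real (N $ j)" by blast
    have "?w t
        = ennreal (\<Prod>i\<in>UNIV. \<bar>sinc (x $ i - t i)\<bar> powr p)"
      using True by (simp add: abs_prod prod_powr_distrib)
    also have "\<dots> = (\<Prod>i\<in>UNIV. ennreal (\<bar>sinc (x $ i - t i)\<bar> powr p))"
      by (rule prod_ennreal[symmetric]) auto
    also have "\<dots> = (\<Prod>i\<in>UNIV. g j i (t i))"
      by (intro prod.cong) (use j in \<open>auto simp: g_def\<close>)
    also have "\<dots> \<le> (\<Sum>j\<in>UNIV. \<Prod>i\<in>UNIV. g j i (t i))"
      by (rule member_le_sum) auto
    finally show ?thesis .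
  qed simp
  have one: "(\<integral>\<^sup>+s. g j i s \<partial>count_coset 0) \<le> ennreal (?\<kappa> j i)" for i j
  proof (cases "i = j")
    case True
    then show ?thesis using nn_integral_sinc_powr_tail_le[OF p N[of i] pN[of i], where x="x $ i"]
      by (subst nn_integral_count_coset[OF gb]) (simp add: g_def)
  next
    case False
    then show ?thesis using nn_integral_sinc_powr_le[OF p, where x="x $ i"]
      by (subst nn_integral_count_coset[OF gb]) (simp add: g_def)
  qed
  have "(\<integral>\<^sup>+t. ?w t \<partial>lattice_measure) \<le> (\<integral>\<^sup>+t. (\<Sum>j\<in>UNIV. \<Prod>i\<in>UNIV. g j i (t i)) \<partial>lattice_measure)"
    by (intro nn_integral_mono le)
  also have "\<dots> = (\<Sum>j\<in>UNIV. \<integral>\<^sup>+t. (\<Prod>i\<in>UNIV. g j i (t i)) \<partial>lattice_measure)"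
  proof (rule nn_integral_sum)
    note [measurable] = gb
    show "(\<lambda>t. \<Prod>i\<in>UNIV. g j i (t i)) \<in> borel_measurable lattice_measure" for j by measurable
  qed
  also have "\<dots> = (\<Sum>j\<in>UNIV. \<Prod>i\<in>UNIV. (\<integral>\<^sup>+s. g j i s \<partial>count_coset 0))"
    using gm by (intro sum.cong product_nn_integral_prod) auto
  also have "\<dots> \<le> (\<Sum>j\<in>UNIV. \<Prod>i\<in>UNIV. ennreal (?\<kappa> j i))"
    by (intro sum_mono prod_mono_ennreal one)
  also have "\<dots> = (\<Sum>j\<in>UNIV. ennreal (?\<tau> j * frakC p ^ (CARD('n) - 1)))"
  proof (intro sum.cong refl)
    fix j :: 'n
    have "(\<Prod>i\<in>UNIV. ennreal (?\<kappa> j i)) = ennreal (\<Prod>i\<in>UNIV. ?\<kappa> j i)"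
      by (rule prod_ennreal) (use tau C in auto)
    also have "(\<Prod>i\<in>UNIV. ?\<kappa> j i) = ?\<tau> j * (\<Prod>i\<in>UNIV - {j}. frakC p)"
      by (subst prod.remove[of _ j]) auto
    finally show "(\<Prod>i\<in>UNIV. ennreal (?\<kappa> j i)) = ennreal (?\<tau> j * frakC p ^ (CARD('n) - 1))"
      by (simp add: card_Diff_singleton)
  qed
  also have "\<dots> = ennreal (\<Sum>j\<in>UNIV. ?\<tau> j * frakC p ^ (CARD('n) - 1))"
    by (rule sum_ennreal) (intro mult_nonneg_nonneg tau zero_le_power C)
  also have "(\<Sum>j\<in>UNIV. ?\<tau> j * frakC p ^ (CARD('n) - 1))
      = frakC p ^ (CARD('n) - 1) * (2 powr (p + 1) / pi powr p) * (\<Sum>j\<in>UNIV. incomplete_lambda p (real (N $ j)))"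
    unfolding sum_distrib_left by (intro sum.cong) (simp_all only: mult_ac)
  finally show ?thesis .
qed

lemma damped_trunc_bound:
  fixes f :: "complex ^ 'n \<Rightarrow> complex" and N :: "nat ^ 'n" and x :: "real ^ 'n"
  assumes f: "entire_multi f" "exp_type_le pi f" and M: "M \<ge> 0" "\<And>x. norm (f (cvec x)) \<le> M"
    and c: "c > 0" and eta: "\<eta> > 0" and ce: "c + 2 * \<eta> = 1"
    and pq: "p > 1" "q > 1" "1 / p + 1 / q = 1"
    and N: "\<And>j. N $ j \<ge> 1" and pN: "\<And>j. p + 1 \<le> pi\<^sup>2 * (real (N $ j) + 1/2)\<^sup>2"
    and G: "Lq_integral q (real_restr (dilate c f)) = ennreal G" "G \<ge> 0"
  shows "norm (damped c \<eta> f (\<lambda>j. x $ j) - (\<Sum>n\<in>index_set N x. damped c \<eta> f (\<lambda>j. of_int (n $ j)) *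
        of_real (\<Prod>j\<in>UNIV. sinc (x $ j - of_int (n $ j)))))
    \<le> (frakB CARD('n) q * G) powr (1 / q) *
      (frakC p ^ (CARD('n) - 1) * (2 powr (p + 1) / pi powr p) * (\<Sum>j\<in>UNIV. incomplete_lambda p (real (N $ j)))) powr (1 / p)"
    (is "_ \<le> ?a powr _ * ?b powr _")
proof -
  let ?\<mu> = "lattice_measure :: ('n \<Rightarrow> real) measure"
  interpret product_sigma_finite "\<lambda>_::'n. count_coset 0" by (rule product_sigma_finite_count_coset)
  define P :: "int ^ 'n \<Rightarrow> 'n \<Rightarrow> real" where "P = (\<lambda>n j. of_int (n $ j))"
  define \<phi> where "\<phi> = (\<lambda>t. damped c \<eta> f t * of_real (\<Prod>j\<in>UNIV. sinc (x $ j - t j)))"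
  define E where "E = {t. \<exists>j. \<bar>x $ j - t j\<bar> > real (N $ j)}"
  have int\<phi>: "integrable ?\<mu> \<phi>"
    using damped_sampling(3)[OF f M c eta ce, of "\<lambda>j. x $ j"] by (simp add: \<phi>_def)
  have I\<phi>: "(\<integral>t. \<phi> t \<partial>?\<mu>) = damped c \<eta> f (\<lambda>j. x $ j)"
    using damped_sampling(1)[OF f M c eta ce, of "\<lambda>j. x $ j"] by (simp add: \<phi>_def)
  have dm: "damped c \<eta> f \<in> borel_measurable ?\<mu>"
    by (rule borel_measurable_PiM_cong[OF damped_sampling(2)[OF f M c eta ce]]) simp
  have Em: "E \<in> sets ?\<mu>"
  proof -
    have [measurable_cong]: "sets (count_coset 0) = sets borel" by simp
    have "E = {t \<in> space ?\<mu>. \<exists>j\<in>UNIV. \<bar>x $ j - t j\<bar> > real (N $ j)}"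
      by (auto simp: E_def space_PiM)
    also have "\<dots> \<in> sets ?\<mu>" by measurable
    finally show ?thesis .
  qed
  have Ps: "{P n} \<in> sets ?\<mu>" "emeasure ?\<mu> {P n} = 1" for n
  proof -
    have eq: "{P n} = PiE UNIV (\<lambda>j. {P n j})" by (auto simp: fun_eq_iff)
    show "{P n} \<in> sets ?\<mu>" unfolding eq by (rule sets_PiM_I_finite) auto
    show "emeasure ?\<mu> {P n} = 1" unfolding eq
      by (subst emeasure_PiM) (use emeasure_count_coset_singleton[of 0] in \<open>auto simp: P_def\<close>)
  qed
  have injP: "P n = P m \<longleftrightarrow> n = m" for n m by (auto simp: P_def fun_eq_iff vec_eq_iff)
  \<comment> \<open>The truncated sum written as the integral of a function supported on finitely
    many lattice points. The error is then the integral of \<open>\<phi> - \<psi>\<close>, which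
    almost everywhere has the modulus of \<open>\<phi>\<close> restricted to
    \<open>E\<close>.\<close>
  define \<psi> where "\<psi> = (\<lambda>t. \<Sum>n\<in>index_set N x. indicator {P n} t *\<^sub>R \<phi> (P n))"
  have ii: "integrable ?\<mu> (\<lambda>t. indicator {P n} t *\<^sub>R \<phi> (P n))" for n
    using Ps by (intro integrable_indicator) auto
  have int\<psi>: "integrable ?\<mu> \<psi>" unfolding \<psi>_def using ii by (intro Bochner_Integration.integrable_sum)
  have I\<psi>: "(\<integral>t. \<psi> t \<partial>?\<mu>) = (\<Sum>n\<in>index_set N x. \<phi> (P n))"
    unfolding \<psi>_def
  proof (subst Bochner_Integration.integral_sum[OF ii], rule sum.cong[OF refl])
    fix n
    have "measure ?\<mu> {P n} = 1" using Ps(2) by (simp add: measure_def)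
    then show "(\<integral>t. indicator {P n} t *\<^sub>R \<phi> (P n) \<partial>?\<mu>) = \<phi> (P n)"
      using Ps[of n] by (subst integral_scaleR_left) (auto simp: sets.Int_space_eq2)
  qed
  have diff: "AE t in ?\<mu>. norm (\<phi> t - \<psi> t) = norm (\<phi> t) * indicator E t"
    using AE_PiM_lattice
  proof eventually_elim
    case (elim t)
    then obtain m where "\<And>j. t j = of_int (m j)" by metis
    then have t: "t = P (\<chi> j. m j)" by (auto simp: P_def)
    define n where "n = (\<chi> j. m j)"
    have "\<psi> t = (\<Sum>k\<in>index_set N x. if k = n then \<phi> (P k) else 0)"
      unfolding \<psi>_def t n_def[symmetric] by (intro sum.cong) (auto simp: indicator_def injP)
    then have "\<psi> t = (if n \<in> index_set N x then \<phi> t else 0)"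
      by (simp add: finite_index_set t n_def[symmetric])
    moreover have "n \<in> index_set N x \<longleftrightarrow> t \<notin> E"
      unfolding t n_def[symmetric] by (auto simp: index_set_def E_def P_def not_less)
    ultimately show ?case by (auto simp: indicator_def)
  qed
  let ?u = "\<lambda>t. norm (damped c \<eta> f t)" and ?v = "\<lambda>t. \<bar>\<Prod>j\<in>UNIV. sinc (x $ j - t j)\<bar> * indicator E t"
  have "norm ((\<integral>t. \<phi> t \<partial>?\<mu>) - (\<integral>t. \<psi> t \<partial>?\<mu>)) = norm (\<integral>t. \<phi> t - \<psi> t \<partial>?\<mu>)"
    using int\<phi> int\<psi> by simp
  then have "ennreal (norm ((\<integral>t. \<phi> t \<partial>?\<mu>) - (\<integral>t. \<psi> t \<partial>?\<mu>))) \<le> (\<integral>\<^sup>+t. ennreal (norm (\<phi> t - \<psi> t)) \<partial>?\<mu>)"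
    using integral_norm_bound_ennreal[of ?\<mu> "\<lambda>t. \<phi> t - \<psi> t"] int\<phi> int\<psi> by simp
  also have "\<dots> = (\<integral>\<^sup>+t. ennreal (?u t * ?v t) \<partial>?\<mu>)"
    by (rule nn_integral_cong_AE)
      (use diff in \<open>eventually_elim, simp add: \<phi>_def norm_mult abs_prod prod_norm[symmetric] mult.assoc\<close>)
  also have "\<dots> \<le> ennreal (?a powr (1 / q) * ?b powr (1 / p))"
  proof (rule nn_integral_Holder[OF pq])
    show "?u \<in> borel_measurable ?\<mu>" using dm by measurable
    have [measurable_cong]: "sets (count_coset 0) = sets borel" by simp
    note [measurable] = Em
    show "?v \<in> borel_measurable ?\<mu>" by measurable
    have fc: "entire_multi (dilate c f)" "exp_type_le pi (dilate c f)"
    proof -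
      have "c * pi \<le> pi" using ce eta pi_gt_zero by (simp add: mult_le_cancel_right1)
      then show "exp_type_le pi (dilate c f)" by (rule exp_type_dilate[OF f(2) c])
    qed (rule entire_multi_dilate[OF f(1)])
    \<comment> \<open>The squares of \<open>sinc\<close> are at most 1, so Plancherel-Polya is
      applied to the dilation alone, of type at most \<open>pi\<close>; the damping leaves the
      constant untouched.\<close>
    have "?u t \<le> norm (dilate c f (cvec t))" for t
      unfolding damped_def norm_mult norm_of_real abs_of_nonneg[OF prod_sinc_squared_le_1(2)]
      using prod_sinc_squared_le_1(1)[of "\<lambda>j. \<eta> * t j" UNIV] by (simp add: mult_left_le)
    then have "(\<integral>\<^sup>+t. ennreal (?u t powr q) \<partial>?\<mu>) \<le> (\<integral>\<^sup>+t. ennreal (norm (dilate c f (cvec t)) powr q) \<partial>?\<mu>)"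
      using pq by (intro nn_integral_mono ennreal_leI powr_mono2) auto
    also have "\<dots> \<le> ennreal (frakB CARD('n) q) * ennreal G"
      using plancherel_polya[OF fc pq(2), of "\<lambda>_. 0"] unfolding G .
    also have "\<dots> = ennreal ?a" by (rule ennreal_mult[symmetric]) (use pq G in \<open>auto simp: frakB_def\<close>)
    finally show "(\<integral>\<^sup>+t. ennreal (?u t powr q) \<partial>?\<mu>) \<le> ennreal ?a" .
    show "(\<integral>\<^sup>+t. ennreal (?v t powr p) \<partial>?\<mu>) \<le> ennreal ?b"
      unfolding E_def by (rule nn_integral_sinc_prod_tail_le[OF pq(1) N pN])
    show "?a \<ge> 0" using pq G by (auto simp: frakB_def)
    show "?b \<ge> 0" using frakC_nonneg[OF pq(1)] incomplete_lambda_nonneg[OF pq(1)]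
      by (intro mult_nonneg_nonneg sum_nonneg) auto
  qed auto
  finally have "norm ((\<integral>t. \<phi> t \<partial>?\<mu>) - (\<integral>t. \<psi> t \<partial>?\<mu>)) \<le> ?a powr (1 / q) * ?b powr (1 / p)"
    by (subst (asm) ennreal_le_iff) auto
  then show ?thesis unfolding I\<phi> I\<psi> unfolding \<phi>_def P_def .
qed

section \<open>Measurability of the error and removal of the damping\<close>

lemma damped_tendsto:
  fixes f :: "complex ^ 'n \<Rightarrow> complex"
  assumes f: "entire_multi f" and c: "c \<longlonglongrightarrow> 1" and e: "\<eta> \<longlonglongrightarrow> 0"
  shows "(\<lambda>k. damped (c k) (\<eta> k) f t) \<longlonglongrightarrow> f (cvec t)"
proof -
  have "continuous_on UNIV f" using f by (simp add: entire_multi_def)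
  then have cf: "isCont f (cvec t)" by (simp add: continuous_on_eq_continuous_at)
  have "(\<lambda>k. cvec (\<lambda>j. c k * t j)) \<longlonglongrightarrow> cvec (\<lambda>j. 1 * t j)"
    unfolding cvec_def by (intro tendsto_intros c)
  then have "(\<lambda>k. cvec (\<lambda>j. c k * t j)) \<longlonglongrightarrow> cvec t" by simp
  then have 1: "(\<lambda>k. f (cvec (\<lambda>j. c k * t j))) \<longlonglongrightarrow> f (cvec t)"
    by (rule isCont_tendsto_compose[OF cf])
  have "(\<lambda>k. sinc (\<eta> k * t j)) \<longlonglongrightarrow> sinc (0 * t j)" for j
  proof (rule isCont_tendsto_compose[where g=sinc])
    show "isCont sinc (0 * t j)" using continuous_on_sinc by (simp add: continuous_on_eq_continuous_at)
  qed (intro tendsto_intros e)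
  then have s: "(\<lambda>k. sinc (\<eta> k * t j)) \<longlonglongrightarrow> 1" for j by (simp add: sinc_def)
  have "(\<lambda>k. \<Prod>j\<in>UNIV. (sinc (\<eta> k * t j))\<^sup>2) \<longlonglongrightarrow> (\<Prod>j\<in>(UNIV :: 'n set). 1\<^sup>2)"
    by (intro tendsto_intros s)
  then have 2: "(\<lambda>k. complex_of_real (\<Prod>j\<in>UNIV. (sinc (\<eta> k * t j))\<^sup>2)) \<longlonglongrightarrow> of_real 1"
    by (intro tendsto_of_real) simp
  show ?thesis using tendsto_mult[OF 1 2] by (simp add: damped_def dilate_cvec)
qed

text \<open>The index set moves with \<open>x\<close>, so the sum is written as a pointwise limit of
  sums over fixed cubes \<open>D K\<close>, each term being cut off by the indicator of a closed
  set. The limit is attained once the cube contains the index set.\<close>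

lemma borel_measurable_trunc_error:
  fixes N :: "nat ^ 'n" and f :: "complex ^ 'n \<Rightarrow> complex"
  assumes f: "entire_multi f"
  shows "trunc_error N f \<in> borel_measurable borel"
proof -
  define s where "s = (\<lambda>(n :: int ^ 'n) (x :: real ^ 'n). f (\<chi> j. of_int (n $ j)) * complex_of_real (\<Prod>j\<in>UNIV. sinc (x $ j - of_int (n $ j))))"
  define D where "D = (\<lambda>K::nat. {n :: int ^ 'n. \<forall>j. n $ j \<in> {- int K..int K}})"
  have fD: "finite (D K)" for K unfolding D_def by (rule finite_vec_set) simp
  have [measurable]: "s n \<in> borel_measurable borel" for n
    unfolding s_def
    by (intro borel_measurable_continuous_onI continuous_intros continuous_on_compose2[OF continuous_on_sinc]) auto
  have [measurable]: "{x. n \<in> index_set N x} \<in> sets borel" for n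
  proof (rule borel_closed)
    show "closed {x. n \<in> index_set N x}"
      unfolding index_set_def by (simp, intro closed_Collect_all closed_Collect_le continuous_intros)
  qed
  define v where "v = (\<lambda>n x. indicator {x. n \<in> index_set N x} x *\<^sub>R s n x)"
  have [measurable]: "v n \<in> borel_measurable borel" for n unfolding v_def by measurable
  have sum: "(\<lambda>x. \<Sum>n\<in>index_set N x. s n x) \<in> borel_measurable borel"
  proof (rule borel_measurable_LIMSEQ_metric)
    show "(\<lambda>x. \<Sum>n\<in>D K. v n x) \<in> borel_measurable borel" for K
      by measurable
    fix x :: "real ^ 'n"
    have "(\<Sum>n\<in>D K. v n x) = (\<Sum>n\<in>index_set N x. s n x)"
      if K: "(\<Sum>j\<in>UNIV. nat \<lceil>\<bar>x $ j\<bar>\<rceil> + N $ j) \<le> K" for K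
    proof -
      have "n \<in> D K" if n: "n \<in> index_set N x" for n
        unfolding D_def
      proof (rule CollectI, rule allI)
        fix j
        have "\<bar>x $ j - real_of_int (n $ j)\<bar> \<le> real (N $ j)" using n by (auto simp: index_set_def)
        then have "\<bar>real_of_int (n $ j)\<bar> \<le> \<bar>x $ j\<bar> + real (N $ j)" by linarith
        moreover have "\<bar>x $ j\<bar> \<le> real (nat \<lceil>\<bar>x $ j\<bar>\<rceil>)" by linarith
        moreover have "nat \<lceil>\<bar>x $ j\<bar>\<rceil> + N $ j \<le> (\<Sum>j\<in>UNIV. nat \<lceil>\<bar>x $ j\<bar>\<rceil> + N $ j)"
          by (rule member_le_sum) auto
        ultimately have "\<bar>real_of_int (n $ j)\<bar> \<le> real K" using K by linarith
        then show "n $ j \<in> {- int K..int K}" by auto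
      qed
      then have "(\<Sum>n\<in>index_set N x. s n x) = (\<Sum>n\<in>D K. if n \<in> index_set N x then s n x else 0)"
        using fD by (intro sum.mono_neutral_cong_left) auto
      also have "\<dots> = (\<Sum>n\<in>D K. v n x)"
        by (intro sum.cong) (auto simp: v_def indicator_def)
      finally show ?thesis ..
    qed
    then have "\<forall>\<^sub>F K in sequentially. (\<Sum>n\<in>D K. v n x) = (\<Sum>n\<in>index_set N x. s n x)"
      unfolding eventually_sequentially by blast
    then show "(\<lambda>K. \<Sum>n\<in>D K. v n x) \<longlonglongrightarrow> (\<Sum>n\<in>index_set N x. s n x)"
      by (rule tendsto_eventually)
  qed
  have "(\<lambda>x. real_restr f x - (\<Sum>n\<in>index_set N x. s n x)) \<in> borel_measurable borel"
    using sum borel_measurable_real_restr[OF f] by measurable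
  then show ?thesis by (simp add: trunc_error_def[abs_def] real_restr_def s_def)
qed

text \<open>With \<open>1 / p = 1 - 1 / q\<close>, the p-th root of \<open>2^(p + 1) / pi^p\<close>
  is \<open>2^(1 + 1/p) / pi = 2^(2 - 1/q) / pi\<close>, the leading constant; the p-th root of the
  power of \<open>frakC\<close> gives its exponent.\<close>

lemma const_C_eq:
  fixes N :: "nat ^ 'n"
  assumes q: "q > 1" and p: "p = q / (q - 1)"
  shows "(frakB CARD('n) q * G) powr (1 / q) *
      (frakC p ^ (CARD('n) - 1) * (2 powr (p + 1) / pi powr p) * (\<Sum>j\<in>UNIV. incomplete_lambda p (real (N $ j)))) powr (1 / p)
    = const_C N q * G powr (1 / q)"
proof -
  let ?\<Lambda> = "\<Sum>j\<in>UNIV. incomplete_lambda p (real (N $ j))"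
  have p1: "p > 1" using q by (simp add: p)
  have ip: "1 / p = 1 - 1 / q" using q by (simp add: p field_simps)
  have C: "frakC p > 0" using p1 by (auto simp: frakC_def intro!: add_pos_nonneg)
  have d: "real (CARD('n) - 1) = real CARD('n) - 1" by (simp add: of_nat_diff Suc_leI)
  have "(frakC p ^ (CARD('n) - 1) * (2 powr (p + 1) / pi powr p) * ?\<Lambda>) powr (1 / p)
      = (frakC p ^ (CARD('n) - 1)) powr (1 / p) * (2 powr (p + 1)) powr (1 / p) / (pi powr p) powr (1 / p) * ?\<Lambda> powr (1 / p)"
    using C incomplete_lambda_nonneg[OF p1] by (simp add: powr_mult powr_divide sum_nonneg)
  also have "(frakC p ^ (CARD('n) - 1)) powr (1 / p) = frakC p powr ((real CARD('n) - 1) * (1 - 1 / q))"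
    using C by (simp add: powr_realpow[symmetric] powr_powr d ip)
  also have "(2 powr (p + 1)) powr (1 / p) = 2 powr (2 - 1 / q)"
  proof -
    have "(p + 1) * (1 / p) = 1 + 1 / p" using p1 by (simp add: field_simps)
    also have "\<dots> = 2 - 1 / q" by (simp add: ip)
    finally show ?thesis by (simp only: powr_powr)
  qed
  also have "(pi powr p) powr (1 / p) = pi" using p1 by (simp add: powr_powr)
  finally show ?thesis
    by (simp add: const_C_def p[symmetric] ip powr_mult mult_ac)
qed

lemma norm_trunc_error_le:
  fixes f :: "complex ^ 'n \<Rightarrow> complex" and N :: "nat ^ 'n" and x :: "real ^ 'n"
  assumes f: "entire_multi f" "exp_type_le pi f" "Lq_integral q (real_restr f) < \<infinity>"
    and q: "q > 1" and p: "p = q / (q - 1)"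
    and N: "\<And>j. N $ j \<ge> 1" and pN: "\<And>j. p + 1 \<le> pi\<^sup>2 * (real (N $ j) + 1/2)\<^sup>2"
  shows "norm (trunc_error N f x) \<le> const_C N q * Lq_norm q (real_restr f)"
proof -
  obtain M where M: "M \<ge> 0" "\<And>x. norm (f (cvec x)) \<le> M"
    using bernstein_bounded[OF f q] by blast
  have p1: "p > 1" "1 / p + 1 / q = 1" using q by (auto simp: p field_simps)
  obtain G where G: "Lq_integral q (real_restr f) = ennreal G" "G \<ge> 0"
    using f(3) by (cases "Lq_integral q (real_restr f)" rule: ennreal_cases) auto
  \<comment> \<open>The offset 3 makes \<open>2 * \<eta> k \<le> 2/3\<close>, so \<open>c k\<close>
    is positive already for \<open>k = 0\<close>.\<close>
  define \<eta> where "\<eta> = (\<lambda>k. 1 / (real k + 3))"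
  define c where "c = (\<lambda>k. 1 - 2 * \<eta> k)"
  have e: "\<eta> k > 0" "c k > 0" "c k + 2 * \<eta> k = 1" for k
  proof -
    show "\<eta> k > 0" by (simp add: \<eta>_def)
    have "\<eta> k \<le> 1 / 3" unfolding \<eta>_def by (intro divide_left_mono) auto
    then show "c k > 0" by (simp add: c_def)
    show "c k + 2 * \<eta> k = 1" by (simp add: c_def)
  qed
  have elim: "\<eta> \<longlonglongrightarrow> 0" unfolding \<eta>_def by real_asymp
  have "c \<longlonglongrightarrow> 1 - 2 * 0" unfolding c_def by (intro tendsto_intros elim)
  then have clim: "c \<longlonglongrightarrow> 1" by simp
  define L where "L = (\<lambda>k. damped (c k) (\<eta> k) f (\<lambda>j. x $ j) - (\<Sum>n\<in>index_set N x. damped (c k) (\<eta> k) f (\<lambda>j. of_int (n $ j)) *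
        of_real (\<Prod>j\<in>UNIV. sinc (x $ j - of_int (n $ j)))))"
  have "norm (L k) \<le> const_C N q * (G / c k ^ CARD('n)) powr (1 / q)" for k
  proof -
    have Lq: "Lq_integral q (real_restr (dilate (c k) f)) = ennreal (G / c k ^ CARD('n))"
      unfolding Lq_integral_dilate[OF f(1) e(2)] G using G e(2)[of k] by (subst ennreal_mult[symmetric]) auto
    have "G / c k ^ CARD('n) \<ge> 0" using G e(2)[of k] by simp
    from damped_trunc_bound[OF f(1,2) M e(2,1,3) p1(1) q p1(2) N pN Lq this, of x]
    show ?thesis unfolding L_def const_C_eq[OF q p] .
  qed
  moreover have "(\<lambda>k. norm (L k)) \<longlonglongrightarrow> norm (trunc_error N f x)"
  proof -
    have cv: "cvec (\<lambda>j. of_int (n $ j)) = (\<chi> j. of_int (n $ j))" for n :: "int ^ 'n" by (simp add: cvec_def)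
    have "L \<longlonglongrightarrow> f (cvec (\<lambda>j. x $ j)) - (\<Sum>n\<in>index_set N x. f (cvec (\<lambda>j. of_int (n $ j))) *
        of_real (\<Prod>j\<in>UNIV. sinc (x $ j - of_int (n $ j))))"
      unfolding L_def by (intro tendsto_diff tendsto_sum tendsto_mult_right damped_tendsto f(1) clim elim)
    then show ?thesis unfolding cv trunc_error_def cvec_def by (rule tendsto_norm)
  qed
  moreover have "(\<lambda>k. const_C N q * (G / c k ^ CARD('n)) powr (1 / q)) \<longlonglongrightarrow> const_C N q * G powr (1 / q)"
  proof -
    \<comment> \<open>The norm of the dilation differs from that of \<open>f\<close> by a power of
      \<open>c k\<close>; isolating this factor shows that it tends to 1.\<close>
    have eq: "(G / c k ^ CARD('n)) powr (1 / q) = G powr (1 / q) * (1 / c k ^ CARD('n)) powr (1 / q)" for k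
      using G(2) e(2)[of k] by (subst powr_mult[symmetric]) auto
    have "(\<lambda>k. const_C N q * (G powr (1 / q) * (1 / c k ^ CARD('n)) powr (1 / q))) \<longlonglongrightarrow>
        const_C N q * (G powr (1 / q) * (1 / 1 ^ CARD('n)) powr (1 / q))"
      by (intro tendsto_intros clim) auto
    then show ?thesis unfolding eq by simp
  qed
  ultimately have "norm (trunc_error N f x) \<le> const_C N q * G powr (1 / q)"
    by (intro LIMSEQ_le) auto
  then show ?thesis using G by (simp add: Lq_norm_def)
qed

theorem theorem5:
  fixes N :: "nat ^ 'n" and f :: "complex ^ 'n \<Rightarrow> complex" and q :: real
  assumes "\<forall>j. N $ j \<ge> 1"
    and "bernstein_class q f"
    and "q \<ge> 1 + 1 / (pi\<^sup>2 * (real (Min (range (\<lambda>j. N $ j))) + 1 / 2)\<^sup>2 - 2)"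
  shows "esssup lborel (\<lambda>x. ereal (norm (trunc_error N f x)))
           \<le> ereal (const_C N q * Lq_norm q (real_restr f))"
proof -
  have f: "entire_multi f" "exp_type_le pi f" "Lq_integral q (real_restr f) < \<infinity>"
    using assms(2) by (auto simp: bernstein_class_def)
  define m where "m = Min (range (\<lambda>j. N $ j))"
  have "m \<in> range (\<lambda>j. N $ j)" unfolding m_def by (intro Min_in) auto
  then have m1: "m \<ge> 1" using assms(1) by auto
  have mle: "m \<le> N $ j" for j unfolding m_def by (intro Min_le) auto
  \<comment> \<open>Since \<open>m \<ge> 1\<close> and \<open>pi \<ge> 2\<close>, the product is at
    least \<open>4 * 9/4 = 9\<close>, so \<open>A\<close> is positive. This forces
    \<open>q > 1\<close> and makes the dual exponent \<open>p\<close> available.\<close>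
  define A where "A = pi\<^sup>2 * (real m + 1 / 2)\<^sup>2 - 2"
  have A: "A > 0"
  proof -
    have "(3 / 2)\<^sup>2 \<le> (real m + 1 / 2)\<^sup>2" using m1 by (intro power_mono) auto
    moreover have "2\<^sup>2 \<le> pi\<^sup>2" using pi_ge_two by (intro power_mono) auto
    ultimately have "2\<^sup>2 * (3 / 2)\<^sup>2 \<le> pi\<^sup>2 * (real m + 1 / 2)\<^sup>2" by (intro mult_mono) auto
    then show ?thesis by (simp add: A_def power2_eq_square)
  qed
  have qA: "q - 1 \<ge> 1 / A" using assms(3) by (simp add: A_def m_def)
  then have q: "q > 1" using A by (smt (verit) divide_pos_pos)
  define p where "p = q / (q - 1)"
  have "p + 1 \<le> pi\<^sup>2 * (real (N $ j) + 1/2)\<^sup>2" for j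
  proof -
    have "1 / (q - 1) \<le> A" using qA A q by (simp add: field_simps)
    moreover have "p = 1 + 1 / (q - 1)" using q by (simp add: p_def field_simps)
    ultimately have "p + 1 \<le> pi\<^sup>2 * (real m + 1 / 2)\<^sup>2" by (simp add: A_def)
    also have "\<dots> \<le> pi\<^sup>2 * (real (N $ j) + 1 / 2)\<^sup>2"
      using mle[of j] by (intro mult_left_mono power_mono) auto
    finally show ?thesis .
  qed
  then have "norm (trunc_error N f x) \<le> const_C N q * Lq_norm q (real_restr f)" for x
    using norm_trunc_error_le[OF f q p_def] assms(1) by auto
  moreover have "(\<lambda>x. ereal (norm (trunc_error N f x))) \<in> borel_measurable lborel"
    using borel_measurable_trunc_error[OF f(1)] by simp
  ultimately show ?thesis by (intro esssup_I) auto
qed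

end
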